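(* Assume the following. (Dyadic dependence) For any two disjoint index sets $S_1,S_2\subset\{1,\dots,N\}$, the families $\{(\mathbf{x}_n,u_n)\}_{n\in S_1}$ and $\{(\mathbf{x}_m,u_m)\}_{m\in S_2}$ are independent whenever $\psi(n)\cap\psi(m)=\emptyset$ for every $n\in S_1$ and $m\in S_2$. (Bounded support) There are finite constants $C_x,C_u$ with $\|\mathbf{x}_n\|\le C_x$ and $|u_n|\le C_u$ almost surely for all $n$ and $N$. (Identification) $\mathbb{E}[\mathbf{x}_nu_n]=\mathbf{0}$ for all $n$, and there is a constant $c_Q$ with $\lambda_{\min}(Q_N)\ge c_Q>0$ for all $N$. (Variance accumulation) $\Omega_N$ is positive definite and $\delta_N:=N(\mathcal{M}^{H})^{3}/\lambda_{\min}(\Omega_N)^{2}\to0$. (Configuration) $K$ is fixed and $\mathcal{M}^{L}\ge1$ as $G\to\infty$. Let $\{R_N\}$ be an arbitrary sequence of nonrandom $K\times q$ matrices of full column rank $q\le K$. Write $\mathcal{V}_N:=R_N'V_NR_N$ and $\widehat{\mathcal{V}}_N:=R_N'\widehat{V}_NR_N$. Then, as $G\to\infty$: (a) $\mathcal{V}_N^{-1/2}R_N'(\widehat{\boldsymbol{\beta}}-\boldsymbol{\beta})\to_d N(\mathbf{0},I_q)$; (b) $\mathcal{V}_N^{-1/2}\widehat{\mathcal{V}}_N\mathcal{V}_N^{-1/2}\to_p I_q$; (c) $\mathbb{P}(\widehat{\mathcal{V}}_N\succ0)\to1$, and on that event $\widehat{\mathcal{V}}_N^{-1/2}R_N'(\widehat{\boldsymbol{\beta}}-\boldsymbol{\beta})\to_d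 N(\mathbf{0},I_q)$; (d) under $H_0:R_N'\boldsymbol{\beta}=\mathbf{r}$, the Wald statistic $$W_N:=\big(R_N'\widehat{\boldsymbol{\beta}}-\mathbf{r}\big)'\widehat{\mathcal{V}}_N^{-1}\big(R_N'\widehat{\boldsymbol{\beta}}-\mathbf{r}\big)$$ satisfies $W_N\to_d\chi^2_q$.
   Context: Setting. Units are indexed $g=1,\dots,G$ and all limits are as $G\to\infty$. For each $G$ there are observations $n=1,\dots,N$, $N=N_G$. Each observation carries a nonrandom support (its dyad) $\psi(n)\subset\{1,\dots,G\}$ with $|\psi(n)|=2$; $\psi$ need not be injective. Everything may form a triangular array (the configuration and the joint law of the data may change with $G$). Put $M_g:=\#\{n:g\in\psi(n)\}$, $\mathcal{M}^{H}:=\max_gM_g$, $\mathcal{M}^{L}:=\min_gM_g$, and $\mathbf{1}_{nm}:=\mathbf{1}\{\psi(n)\cap\psi(m)\neq\emptyset\}$. Model: $y_n=\boldsymbol{\beta}'\mathbf{x}_n+u_n$, with $\mathbf{x}_n\in\mathbb{R}^K$ and $u_n\in\mathbb{R}$ random and $\boldsymbol\beta\in\mathbb{R}^K$. Define $S_N:=\sum_n\mathbf{x}_nu_n$, $\Omega_N:=\operatorname{Var}(S_N)$, $Q_N:=N^{-1}\sum_n\mathbb{E}[\mathbf{x}_n\mathbf{x}_n']$, $\widehat{Q}_N:=N^{-1}\sum_n\mathbf{x}_n\mathbf{x}_n'$. Estimators: let $\mathcal{E}_N$ be the event that $\sum_n\mathbf{x}_n\mathbf{x}_n'$ is invertible.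 On $\mathcal{E}_N$, $\widehat{\boldsymbol{\beta}}:=(\sum_n\mathbf{x}_n\mathbf{x}_n')^{-1}\sum_n\mathbf{x}_ny_n$ and $\widehat{u}_n:=y_n-\widehat{\boldsymbol{\beta}}'\mathbf{x}_n$; on the complement, $\widehat{\boldsymbol{\beta}}:=\mathbf{0}$ and $\widehat{u}_n:=y_n$. Put $$\widehat{\Omega}_N:=\sum_{n=1}^N\sum_{m=1}^N\mathbf{1}_{nm}\widehat{u}_n\widehat{u}_m\mathbf{x}_n\mathbf{x}_m',\qquad V_N:=N^{-2}Q_N^{-1}\Omega_NQ_N^{-1},\qquad \widehat{V}_N:=N^{-2}\widehat{Q}_N^{-1}\widehat{\Omega}_N\widehat{Q}_N^{-1}\ \text{on }\mathcal{E}_N,$$ and $\widehat{V}_N:=\mathbf{0}$ on $\mathcal{E}_N^c$. The Wald statistic $W_N$ is set to $0$ whenever $\widehat{\mathcal{V}}_N$ is singular. Notation: $\lambda_{\min}$ is the smallest eigenvalue; $\|\cdot\|$ is the Euclidean norm for vectors and the spectral norm for matrices; for symmetric positive definite $A$, $A^{1/2}$ is the symmetric square root and $A^{-1/2}:=(A^{1/2})^{-1}$; $A\succ0$ means positive definite. A distributional convergence "on an event" whose probability tends to one means that the statistic may be defined arbitrarily off the event. *)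

theory Defs
  imports "HOL-Probability.Probability"
begin

definition outer :: "real ^ 'm \<Rightarrow> real ^ 'n \<Rightarrow> real ^ 'n ^ 'm" where
  "outer a b = (\<chi> i j. a $ i * b $ j)"

definition pos_def :: "real ^ 'n ^ 'n \<Rightarrow> bool" where
  "pos_def A \<longleftrightarrow> transpose A = A \<and> (\<forall>v. v \<noteq> 0 \<longrightarrow> 0 < v \<bullet> (A *v v))"

definition eigenval :: "real ^ 'n ^ 'n \<Rightarrow> real \<Rightarrow> bool" where
  "eigenval A c \<longleftrightarrow> (\<exists>v. v \<noteq> 0 \<and> A *v v = c *\<^sub>R v)"

definition lambda_min :: "real ^ 'n ^ 'n \<Rightarrow> real" where
  "lambda_min A = (LEAST c. eigenval A c)"

text \<open>A positive definite matrix has many symmetric square roots; the one meant is the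
  unique positive definite one.\<close>

definition mat_sqrt :: "real ^ 'n ^ 'n \<Rightarrow> real ^ 'n ^ 'n" where
  "mat_sqrt A = (THE B. pos_def B \<and> B ** B = A)"

definition mat_inv_sqrt :: "real ^ 'n ^ 'n \<Rightarrow> real ^ 'n ^ 'n" where
  "mat_inv_sqrt A = matrix_inv (mat_sqrt A)"

text \<open>The type-class norm on matrices is the Frobenius norm, hence a separate spectral norm.\<close>

definition spectral_norm :: "real ^ 'n ^ 'm \<Rightarrow> real" where
  "spectral_norm A = onorm (\<lambda>v. A *v v)"

text \<open>\<open>N(0, I)\<close> is the law of a vector of independent standard normal variables, chi-square
  with \<open>q\<close> degrees of freedom that of the sum of their \<open>q\<close> squares.\<close>

definition std_normal_vec :: "(real ^ 'q) measure" where
  "std_normal_vec =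
     distr (\<Pi>\<^sub>M i\<in>(UNIV :: 'q set). std_normal_distribution) borel (\<lambda>z. \<chi> i. z i)"

definition chi_square_distribution :: "nat \<Rightarrow> real measure" where
  "chi_square_distribution q =
     distr (\<Pi>\<^sub>M i\<in>{1..q}. std_normal_distribution) borel (\<lambda>z. \<Sum>i=1..q. (z i)\<^sup>2)"

text \<open>Both notions allow the probability space to vary along the sequence. Measurability
  is part of the definitions, since otherwise \<^const>\<open>measure\<close> and the Bochner integral
  would silently return 0.\<close>

definition converges_in_distribution ::
  "(nat \<Rightarrow> 'a measure) \<Rightarrow> (nat \<Rightarrow> 'a \<Rightarrow> 'b::topological_space) \<Rightarrow> 'b measure \<Rightarrow> bool" where
  "converges_in_distribution M X \<mu> \<longleftrightarrow>
     (\<forall>\<^sub>F G in sequentially. X G \<in> borel_measurable (M G)) \<and>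
     (\<forall>f :: 'b \<Rightarrow> real. continuous_on UNIV f \<and> bounded (range f) \<longrightarrow>
        (\<lambda>G. \<integral>\<omega>. f (X G \<omega>) \<partial>M G) \<longlonglongrightarrow> (\<integral>z. f z \<partial>\<mu>))"

definition mat_converges_in_probability ::
  "(nat \<Rightarrow> 'a measure) \<Rightarrow> (nat \<Rightarrow> 'a \<Rightarrow> real ^ 'n ^ 'm) \<Rightarrow> real ^ 'n ^ 'm \<Rightarrow> bool" where
  "mat_converges_in_probability M A C \<longleftrightarrow>
     (\<forall>\<^sub>F G in sequentially. A G \<in> borel_measurable (M G)) \<and>
     (\<forall>\<epsilon>>0. (\<lambda>G. measure (M G) {\<omega> \<in> space (M G). spectral_norm (A G \<omega> - C) > \<epsilon>})
        \<longlonglongrightarrow> 0)"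

text \<open>Observations are indexed by \<open>{1..N}\<close>, units by \<open>{1..G}\<close>; \<open>\<psi> n\<close> is the dyad of
  observation \<open>n\<close>.\<close>

definition unit_count :: "nat \<Rightarrow> (nat \<Rightarrow> nat set) \<Rightarrow> nat \<Rightarrow> nat" where
  "unit_count N \<psi> g = card {n \<in> {1..N}. g \<in> \<psi> n}"

definition count_max :: "nat \<Rightarrow> nat \<Rightarrow> (nat \<Rightarrow> nat set) \<Rightarrow> nat" where
  "count_max G N \<psi> = Max (unit_count N \<psi> ` {1..G})"

definition count_min :: "nat \<Rightarrow> nat \<Rightarrow> (nat \<Rightarrow> nat set) \<Rightarrow> nat" where
  "count_min G N \<psi> = Min (unit_count N \<psi> ` {1..G})"

definition covariance_matrix :: "'a measure \<Rightarrow> ('a \<Rightarrow> real ^ 'k) \<Rightarrow> real ^ 'k ^ 'k" where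
  "covariance_matrix M S =
     (let m = (\<integral>\<omega>. S \<omega> \<partial>M) in (\<integral>\<omega>. outer (S \<omega> - m) (S \<omega> - m) \<partial>M))"

definition score_sum ::
  "nat \<Rightarrow> (nat \<Rightarrow> 'a \<Rightarrow> real ^ 'k) \<Rightarrow> (nat \<Rightarrow> 'a \<Rightarrow> real) \<Rightarrow> 'a \<Rightarrow> real ^ 'k" where
  "score_sum N x u \<omega> = (\<Sum>n=1..N. u n \<omega> *\<^sub>R x n \<omega>)"

definition Omega_pop ::
  "'a measure \<Rightarrow> nat \<Rightarrow> (nat \<Rightarrow> 'a \<Rightarrow> real ^ 'k) \<Rightarrow> (nat \<Rightarrow> 'a \<Rightarrow> real) \<Rightarrow> real ^ 'k ^ 'k" where
  "Omega_pop M N x u = covariance_matrix M (score_sum N x u)"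

definition Q_pop :: "'a measure \<Rightarrow> nat \<Rightarrow> (nat \<Rightarrow> 'a \<Rightarrow> real ^ 'k) \<Rightarrow> real ^ 'k ^ 'k" where
  "Q_pop M N x = (1 / real N) *\<^sub>R (\<Sum>n=1..N. \<integral>\<omega>. outer (x n \<omega>) (x n \<omega>) \<partial>M)"

definition V_pop ::
  "'a measure \<Rightarrow> nat \<Rightarrow> (nat \<Rightarrow> 'a \<Rightarrow> real ^ 'k) \<Rightarrow> (nat \<Rightarrow> 'a \<Rightarrow> real) \<Rightarrow> real ^ 'k ^ 'k" where
  "V_pop M N x u =
     (1 / (real N)\<^sup>2) *\<^sub>R
       (matrix_inv (Q_pop M N x) ** Omega_pop M N x u ** matrix_inv (Q_pop M N x))"

text \<open>The estimators are functions of a realised sample \<open>(x, y)\<close>.\<close>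

definition gram :: "nat \<Rightarrow> (nat \<Rightarrow> real ^ 'k) \<Rightarrow> real ^ 'k ^ 'k" where
  "gram N x = (\<Sum>n=1..N. outer (x n) (x n))"

definition beta_hat :: "nat \<Rightarrow> (nat \<Rightarrow> real ^ 'k) \<Rightarrow> (nat \<Rightarrow> real) \<Rightarrow> real ^ 'k" where
  "beta_hat N x y =
     (if invertible (gram N x) then matrix_inv (gram N x) *v (\<Sum>n=1..N. y n *\<^sub>R x n) else 0)"

text \<open>If the Gram matrix is singular then \<^const>\<open>beta_hat\<close> is 0 and the residual is \<open>y n\<close>.\<close>

definition residual :: "nat \<Rightarrow> (nat \<Rightarrow> real ^ 'k) \<Rightarrow> (nat \<Rightarrow> real) \<Rightarrow> nat \<Rightarrow> real" where
  "residual N x y n = y n - beta_hat N x y \<bullet> x n"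

definition Q_hat :: "nat \<Rightarrow> (nat \<Rightarrow> real ^ 'k) \<Rightarrow> real ^ 'k ^ 'k" where
  "Q_hat N x = (1 / real N) *\<^sub>R gram N x"

definition Omega_hat ::
  "nat \<Rightarrow> (nat \<Rightarrow> nat set) \<Rightarrow> (nat \<Rightarrow> real ^ 'k) \<Rightarrow> (nat \<Rightarrow> real) \<Rightarrow> real ^ 'k ^ 'k" where
  "Omega_hat N \<psi> x y =
     (\<Sum>n=1..N. \<Sum>m=1..N.
        (of_bool (\<psi> n \<inter> \<psi> m \<noteq> {}) * residual N x y n * residual N x y m) *\<^sub>R outer (x n) (x m))"

definition V_hat ::
  "nat \<Rightarrow> (nat \<Rightarrow> nat set) \<Rightarrow> (nat \<Rightarrow> real ^ 'k) \<Rightarrow> (nat \<Rightarrow> real) \<Rightarrow> real ^ 'k ^ 'k" where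
  "V_hat N \<psi> x y =
     (if invertible (gram N x)
      then (1 / (real N)\<^sup>2) *\<^sub>R (matrix_inv (Q_hat N x) ** Omega_hat N \<psi> x y ** matrix_inv (Q_hat N x))
      else 0)"

definition sandwich :: "real ^ 'q ^ 'k \<Rightarrow> real ^ 'k ^ 'k \<Rightarrow> real ^ 'q ^ 'q" where
  "sandwich R V = transpose R ** V ** R"

definition wald ::
  "nat \<Rightarrow> (nat \<Rightarrow> nat set) \<Rightarrow> real ^ 'q ^ 'k \<Rightarrow> real ^ 'q
     \<Rightarrow> (nat \<Rightarrow> real ^ 'k) \<Rightarrow> (nat \<Rightarrow> real) \<Rightarrow> real" where
  "wald N \<psi> R r x y =
     (let W = sandwich R (V_hat N \<psi> x y); d = transpose R *v beta_hat N x y - r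
      in if invertible W then d \<bullet> (matrix_inv W *v d) else 0)"

end

theory Submission
  imports Defs
begin

text \<open>
  The normalised score is a sum over a dependency graph of degree at most \<open>D = 2 \<M>\<^sup>H\<close>. Stein's
  method with a third-order expansion shows that, up to errors governed by
  \<open>N D\<^sup>3 / \<lambda>\<^sup>2\<close>, its law satisfies \<open>E[W f(W)] = E[f'(W)] - (\<kappa>/2) E[f''(W)]\<close> with \<open>\<kappa>\<close> the third cumulant.
  The hypothesis does not bound \<open>\<kappa>\<close> directly, but no probability law satisfies this identity with
  \<open>\<kappa> \<noteq> 0\<close>: a suitable Gaussian bump is a strictly positive test function for it. Hence
  \<open>\<kappa> \<rightarrow> 0\<close> and the characteristic function solves \<open>\<phi>' = - s \<phi>\<close> asymptotically.

  The estimation error of \<open>\<Omega>\<close> is of order \<open>(N D\<^sup>3)\<^sup>1\<^sup>/\<^sup>2\<close>, which is negligible against \<open>\<lambda>\<close>. Passing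
  from \<open>\<V>\<^sup>-\<^sup>1\<^sup>/\<^sup>2\<close> to its estimate uses a bound for \<open>A\<^sup>-\<^sup>1\<^sup>/\<^sup>2 B\<^sup>1\<^sup>/\<^sup>2 - I\<close> in terms of \<open>B\<^sup>-\<^sup>1\<^sup>/\<^sup>2 A B\<^sup>-\<^sup>1\<^sup>/\<^sup>2 - I\<close> that does not
  depend on condition numbers, because the restrictions \<open>R\<close> may be arbitrarily badly scaled.
\<close>


section \<open>Real matrices\<close>

subsection \<open>Frobenius norm and inner product of matrices\<close>

text \<open>With summands of order \<lambda>^(-1/2), a third-order normal approximation has an error
  of order N D^2 / \<lambda>^(3/2). This is the 3/4 power of N D^3 / \<lambda>^2 times (N/D)^(1/4),
  which the hypothesis does not make small; hence one more order is expanded and the third-order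
  coefficient is eliminated by a separate argument. The hypothesis acts a second time through
  \<lambda> = O(N D), which turns it into D/N \<rightarrow> 0, and through D \<le> 2 N, which gives
  D^2 / \<lambda> \<rightarrow> 0. So a single rate \<open>\<eta>\<close> governs the Gram matrix,
  the linearization and the covariance estimator. Probability and algebra are kept apart. The
  sandwich is analysed pathwise, for one realised sample. The random inputs are collected in one
  nonnegative variable \<open>Z\<close> of bounded mean, and each negligible error is shown to be
  small almost surely on Z \<le> B^2 for all large G. As nothing limits the scaling of R, pathwise
  errors are kept in the form of a factor times A, where A \<Omega> A' = I.\<close>

lemma matrix_vector_mult_dot: "((A::real^'n^'m) *v v) $ i = A $ i \<bullet> v"
  by (rule matrix_vector_mul_component)

lemma transpose_dot: "(transpose A *v v) \<bullet> w = v \<bullet> ((A::real^'n^'m) *v w)"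
  by (simp add: dot_lmul_matrix)

lemma matrix_mul_minus_left: "(A - B) ** C = A ** C - B ** (C::real^'n^'m)"
  by (vector matrix_matrix_mult_def left_diff_distrib sum_subtractf)

lemma matrix_mul_minus_right: "A ** (B - C) = A ** B - A ** (C::real^'n^'m)"
  by (vector matrix_matrix_mult_def right_diff_distrib sum_subtractf)

lemma matrix_mul_plus_left: "(A + B) ** C = A ** C + B ** (C::real^'n^'m)"
  by (vector matrix_matrix_mult_def distrib_right sum.distrib)

lemma matrix_mul_scaleR_left: "(c *\<^sub>R A) ** B = c *\<^sub>R (A ** (B::real^'n^'m))"
  by (vector matrix_matrix_mult_def sum_distrib_left mult.assoc)

lemma matrix_mul_scaleR_right: "A ** (c *\<^sub>R B) = c *\<^sub>R (A ** (B::real^'n^'m))"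
  by (vector matrix_matrix_mult_def sum_distrib_left mult.left_commute)

lemmas mat_algebra = matrix_mul_minus_left matrix_mul_minus_right matrix_mul_plus_left
  matrix_add_ldistrib matrix_mul_scaleR_left matrix_mul_scaleR_right matrix_mul_assoc

lemma transpose_minus: "transpose (A - B) = transpose A - transpose (B::real^'n^'m)"
  by (vector transpose_def)

lemma transpose_plus: "transpose (A + B) = transpose A + transpose (B::real^'n^'m)"
  by (vector transpose_def)

lemma inner_transpose: "transpose A \<bullet> transpose B = A \<bullet> (B::real^'n^'m)"
  unfolding inner_vec_def transpose_def by (simp, subst sum.swap, simp)

lemma norm_transpose [simp]: "norm (transpose A) = norm (A::real^'n^'m)"
  by (simp add: norm_eq_sqrt_inner inner_transpose)

text \<open>Cyclicity of the trace: the inner product that matrices inherit as vectors of vectors is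
  tr(A' C).\<close>

lemma inner_matrix_mul_left: "(A ** B) \<bullet> C = B \<bullet> (transpose A ** (C::real^'n^'m))"
proof -
  have "(A ** B) \<bullet> C = (\<Sum>i\<in>UNIV. \<Sum>j\<in>UNIV. \<Sum>k\<in>UNIV. A$i$k * B$k$j * C$i$j)"
    unfolding inner_vec_def matrix_matrix_mult_def by (simp add: sum_distrib_right)
  also have "\<dots> = (\<Sum>i\<in>UNIV. \<Sum>k\<in>UNIV. \<Sum>j\<in>UNIV. A$i$k * B$k$j * C$i$j)"
    by (intro sum.cong refl sum.swap)
  also have "\<dots> = (\<Sum>k\<in>UNIV. \<Sum>i\<in>UNIV. \<Sum>j\<in>UNIV. A$i$k * B$k$j * C$i$j)"
    by (rule sum.swap)
  also have "\<dots> = (\<Sum>k\<in>UNIV. \<Sum>j\<in>UNIV. \<Sum>i\<in>UNIV. A$i$k * B$k$j * C$i$j)"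
    by (intro sum.cong refl sum.swap)
  also have "\<dots> = B \<bullet> (transpose A ** C)"
    unfolding inner_vec_def matrix_matrix_mult_def transpose_def
    by (simp add: sum_distrib_left mult_ac)
  finally show ?thesis .
qed

lemma inner_matrix_mul_right: "(A ** B) \<bullet> C = A \<bullet> ((C::real^'n^'m) ** transpose B)"
proof -
  have "(A ** B) \<bullet> C = (transpose B ** transpose A) \<bullet> transpose C"
    by (simp add: inner_transpose flip: matrix_transpose_mul)
  also have "\<dots> = transpose A \<bullet> transpose (C ** transpose B)"
    by (simp add: inner_matrix_mul_left matrix_transpose_mul)
  finally show ?thesis by (simp add: inner_transpose)
qed

lemma norm_matrix_sq_rows: "(norm (A::real^'n^'m))\<^sup>2 = (\<Sum>i\<in>UNIV. (norm (A$i))\<^sup>2)"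
  by (simp add: power2_norm_eq_inner inner_vec_def)

lemma norm_matrix_vector_mult_le: "norm (A *v v) \<le> norm (A::real^'n^'m) * norm v"
proof -
  have "(norm (A *v v))\<^sup>2 = (\<Sum>i\<in>UNIV. (A$i \<bullet> v)\<^sup>2)"
    unfolding power2_norm_eq_inner by (simp add: inner_vec_def[of "A *v v"] matrix_vector_mult_dot power2_eq_square)
  also have "\<dots> \<le> (\<Sum>i\<in>UNIV. (norm (A$i))\<^sup>2 * (norm v)\<^sup>2)"
    by (intro sum_mono) (metis Cauchy_Schwarz_ineq2 abs_le_square_iff abs_mult abs_norm_cancel power_mult_distrib)
  also have "\<dots> = (norm A * norm v)\<^sup>2"
    by (simp add: norm_matrix_sq_rows power_mult_distrib sum_distrib_right)
  finally show ?thesis by (rule power2_le_imp_le) simp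
qed

text \<open>The operator bound is applied to each column of B. Measuring only one factor in the
  Frobenius norm keeps dimension factors out of the constants. Columns appear as rows of the
  transpose because indexing is by rows.\<close>

lemma norm_matrix_mul_op_le:
  fixes A :: "real^'n^'m" and B :: "real^'k^'n"
  assumes "\<And>v. norm (A *v v) \<le> a * norm v" "0 \<le> a"
  shows "norm (A ** B) \<le> a * norm B"
proof -
  have row: "transpose (A ** B) $ j = A *v (transpose B $ j)" for j
    by (vector transpose_def matrix_matrix_mult_def matrix_vector_mult_def)
  have "(norm (A ** B))\<^sup>2 = (\<Sum>j\<in>UNIV. (norm (A *v (transpose B $ j)))\<^sup>2)"
    by (subst norm_transpose[symmetric], subst norm_matrix_sq_rows, simp only: row)
  also have "\<dots> \<le> (\<Sum>j\<in>UNIV. (a * norm (transpose B $ j))\<^sup>2)"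
    by (intro sum_mono power_mono assms) simp
  also have "\<dots> = (a * norm B)\<^sup>2"
    by (simp add: power_mult_distrib sum_distrib_left[symmetric] norm_matrix_sq_rows[symmetric])
  finally show ?thesis by (rule power2_le_imp_le) (use assms in simp)
qed

lemma norm_matrix_mul_le: "norm (A ** B) \<le> norm A * norm (B::real^'k^'n)"
  by (rule norm_matrix_mul_op_le[OF norm_matrix_vector_mult_le]) simp

lemma norm_matrix_mul3_le:
  "norm (A ** B ** C) \<le> norm A * norm B * norm (C::real^'k^'n)"
  by (meson mult_right_mono norm_ge_zero norm_matrix_mul_le order_trans)

text \<open>The case B = I of \<open>norm_matrix_mul_op_le\<close>; the factor is the Frobenius norm
  of the identity.\<close>

lemma norm_le_op_bound:
  fixes A :: "real^'n^'m"
  assumes "\<And>v. norm (A *v v) \<le> a * norm v" "0 \<le> a"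
  shows "norm A \<le> sqrt CARD('n) * a"
proof -
  have n1: "norm (mat 1 :: real^'n^'n) = sqrt CARD('n)"
    by (simp add: norm_eq_sqrt_inner inner_vec_def mat_def if_distrib cong: if_cong)
  have "norm (A ** mat 1) \<le> a * norm (mat 1 :: real^'n^'n)"
    by (rule norm_matrix_mul_op_le[OF assms])
  then show ?thesis by (simp add: n1 mult.commute)
qed

lemma spectral_norm_le_norm: "spectral_norm A \<le> norm A"
  unfolding spectral_norm_def by (rule onorm_le) (rule norm_matrix_vector_mult_le)

lemma outer_mult_vec: "outer a b *v v = (b \<bullet> v) *\<^sub>R a"
  by (vector outer_def matrix_vector_mult_def inner_vec_def sum_distrib_left mult_ac)

lemma norm_outer: "norm (outer a b) = norm a * norm b"
proof -
  have "(norm (outer a b))\<^sup>2 = (norm a * norm b)\<^sup>2"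
    unfolding power2_norm_eq_inner power_mult_distrib
    by (simp add: inner_vec_def outer_def sum_product power2_eq_square mult_ac)
      (rule sum.swap)
  then show ?thesis by (simp add: power2_eq_iff_nonneg)
qed

subsection \<open>The smallest eigenvalue\<close>

lemma symmetric_dot: "transpose A = A \<Longrightarrow> (A *v v) \<bullet> w = v \<bullet> ((A::real^'n^'n) *v w)"
  by (metis transpose_dot)

text \<open>First-order condition at a minimum without calculus: for nonzero b the step t = -b/c
  lets the linear term beat the quadratic one as soon as a < 2 c, and c = |a| + 1 guarantees
  this.\<close>

lemma linear_coeff_zero:
  fixes a b :: real
  assumes "\<And>t. 0 \<le> 2 * t * b + t\<^sup>2 * a"
  shows "b = 0"
proof (rule ccontr)
  assume b: "b \<noteq> 0"
  define c where "c = \<bar>a\<bar> + 1"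
  have c: "c > 0" "a < c" "c \<ge> 1" by (auto simp: c_def)
  have "2 * (- b / c) * b + (- b / c)\<^sup>2 * a = (b\<^sup>2 / c) * (a / c - 2)"
    using c by (simp add: field_simps power2_eq_square)
  moreover have "a / c - 2 < 0" using c by (simp add: field_simps)
  ultimately show False using assms[of "- b / c"] b c
    by (metis divide_pos_pos mult_pos_neg not_le zero_less_power2)
qed

text \<open>The Rayleigh quotient attains its minimum on the compact unit sphere, and stationarity
  of the minimiser in every direction w is the eigenvalue equation.\<close>

lemma symmetric_min_eigenvalue:
  fixes A :: "real^'n^'n"
  assumes sym: "transpose A = A"
  obtains c v where "norm v = 1" "A *v v = c *\<^sub>R v" "\<And>w. c * (w \<bullet> w) \<le> w \<bullet> (A *v w)"
proof -
  have "continuous_on (sphere 0 1) (\<lambda>v. v \<bullet> (A *v v))"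
    by (intro continuous_intros linear_continuous_on linear_conv_bounded_linear[THEN iffD1]) simp
  moreover have "sphere (0::real^'n) 1 \<noteq> {}" by simp
  ultimately obtain v where v: "norm v = 1"
    and min: "\<And>w. norm w = 1 \<Longrightarrow> v \<bullet> (A *v v) \<le> w \<bullet> (A *v w)"
    using continuous_attains_inf[of "sphere 0 1" "\<lambda>v. v \<bullet> (A *v v)"] by auto
  define c where "c = v \<bullet> (A *v v)"
  have ray: "c * (w \<bullet> w) \<le> w \<bullet> (A *v w)" for w
  proof (cases "w = 0")
    case False
    have "c \<le> (w /\<^sub>R norm w) \<bullet> (A *v (w /\<^sub>R norm w))"
      unfolding c_def by (rule min) (use False in simp)
    also have "\<dots> = (w \<bullet> (A *v w)) / (norm w)\<^sup>2"
      by (simp add: matrix_vector_mult_scaleR power2_eq_square divide_inverse)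
    finally show ?thesis using False
      by (simp add: pos_le_divide_eq power2_norm_eq_inner)
  qed simp
  have "w \<bullet> (A *v v - c *\<^sub>R v) = 0" for w
  proof (rule linear_coeff_zero)
    fix t
    have vv: "v \<bullet> v = 1" using v by (metis norm_eq_1)
    have "c * ((v + t *\<^sub>R w) \<bullet> (v + t *\<^sub>R w)) \<le> (v + t *\<^sub>R w) \<bullet> (A *v (v + t *\<^sub>R w))" by (rule ray)
    moreover have "v \<bullet> (A *v w) = w \<bullet> (A *v v)" using symmetric_dot[OF sym] by (metis inner_commute)
    ultimately show "0 \<le> 2 * t * (w \<bullet> (A *v v - c *\<^sub>R v)) + t\<^sup>2 * (w \<bullet> (A *v w) - c * (w \<bullet> w))"
      by (simp add: matrix_vector_right_distrib matrix_vector_mult_scaleR inner_add_left inner_add_right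
          inner_diff_right vv c_def[symmetric] inner_commute[of v w] algebra_simps power2_eq_square)
  qed
  then have "A *v v = c *\<^sub>R v" by (metis eq_iff_diff_eq_0 inner_eq_zero_iff)
  with v show thesis using ray by (rule that)
qed

text \<open>\<open>LEAST\<close> over the reals carries information only once a least element is
  exhibited. The minimum of the Rayleigh quotient is an eigenvalue and a lower bound for all the
  others.\<close>

lemma lambda_min_rayleigh:
  fixes A :: "real^'n^'n"
  assumes sym: "transpose A = A"
  shows "lambda_min A * (w \<bullet> w) \<le> w \<bullet> (A *v w)" and "\<exists>v. norm v = 1 \<and> v \<bullet> (A *v v) = lambda_min A"
proof -
  obtain c v where v: "norm v = 1" "A *v v = c *\<^sub>R v" and ray: "\<And>w. c * (w \<bullet> w) \<le> w \<bullet> (A *v w)"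
    using symmetric_min_eigenvalue[OF sym] by blast
  have "lambda_min A = c" unfolding lambda_min_def
  proof (rule Least_equality)
    show "eigenval A c" unfolding eigenval_def using v by (intro exI[of _ v]) auto
    fix d assume "eigenval A d"
    then obtain w where w: "w \<noteq> 0" "A *v w = d *\<^sub>R w" unfolding eigenval_def by auto
    then show "c \<le> d" using ray[of w] by simp
  qed
  with ray v show "lambda_min A * (w \<bullet> w) \<le> w \<bullet> (A *v w)"
    and "\<exists>v. norm v = 1 \<and> v \<bullet> (A *v v) = lambda_min A"
    by (auto simp: norm_eq_1 intro!: exI[of _ v])
qed

lemma pos_defD: "pos_def A \<Longrightarrow> transpose A = A" "pos_def A \<Longrightarrow> v \<noteq> 0 \<Longrightarrow> 0 < v \<bullet> (A *v v)"
  by (auto simp: pos_def_def)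

lemma pos_def_nonneg: "pos_def A \<Longrightarrow> 0 \<le> v \<bullet> (A *v v)"
  by (cases "v = 0") (auto simp: pos_def_def less_imp_le)

lemma lambda_min_pos: "pos_def A \<Longrightarrow> 0 < lambda_min A"
  using lambda_min_rayleigh(2)[of A] unfolding pos_def_def by (metis norm_zero zero_neq_one)

lemma pos_defI:
  assumes "transpose A = A" "0 < c" "\<And>v. c * (v \<bullet> v) \<le> v \<bullet> (A *v v)"
  shows "pos_def A"
  unfolding pos_def_def using assms by (meson inner_gt_zero_iff less_le_trans mult_pos_pos)

lemma pos_def_lower_bound:
  assumes "pos_def A"
  obtains c where "0 < c" "\<And>v. c * (v \<bullet> v) \<le> v \<bullet> (A *v v)"
  using assms lambda_min_pos lambda_min_rayleigh(1) pos_defD(1) by metis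

subsection \<open>Inverses\<close>

lemma matrix_inv:
  assumes "invertible (A::real^'n^'n)"
  shows "A ** matrix_inv A = mat 1" "matrix_inv A ** A = mat 1"
  using someI_ex[OF assms[unfolded invertible_def]] unfolding matrix_inv_def by auto

lemma matrix_inv_unique:
  assumes "A ** B = mat 1" shows "matrix_inv (A::real^'n^'n) = B"
proof -
  have "invertible A" using assms invertible_right_inverse by blast
  then have "matrix_inv A ** (A ** B) = B" by (simp add: matrix_mul_assoc matrix_inv)
  then show ?thesis by (simp add: assms)
qed

lemma matrix_inv_transpose: "invertible A \<Longrightarrow> matrix_inv (transpose A) = transpose (matrix_inv (A::real^'n^'n))"
  by (metis matrix_inv(2) matrix_inv_unique matrix_transpose_mul transpose_mat)

lemma matrix_inv_scaleR:
  "c \<noteq> 0 \<Longrightarrow> invertible A \<Longrightarrow> matrix_inv (c *\<^sub>R A) = (1 / c) *\<^sub>R matrix_inv (A::real^'n^'n)"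
  by (rule matrix_inv_unique) (simp add: mat_algebra matrix_inv)

lemma matrix_inv_mult:
  "invertible A \<Longrightarrow> invertible B \<Longrightarrow> matrix_inv (A ** B) = matrix_inv (B::real^'n^'n) ** matrix_inv (A::real^'n^'n)"
proof (rule matrix_inv_unique)
  assume "invertible A" "invertible B"
  have "A ** B ** (matrix_inv B ** matrix_inv A) = A ** (B ** matrix_inv B) ** matrix_inv A"
    by (simp add: matrix_mul_assoc)
  then show "A ** B ** (matrix_inv B ** matrix_inv A) = mat 1"
    by (simp add: matrix_inv \<open>invertible A\<close> \<open>invertible B\<close>)
qed

text \<open>Lax-Milgram in finite dimension: by Cauchy-Schwarz, coercivity gives c |v| \<le> |A v|,
  hence injectivity and the bound on the inverse. Its main use is the random matrix
  \<open>Q_hat\<close>, with a constant that does not depend on the sample.\<close>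

lemma coercive_invertible:
  fixes A :: "real^'n^'n"
  assumes "0 < c" "\<And>v. c * (v \<bullet> v) \<le> v \<bullet> (A *v v)"
  shows "invertible A" "norm (matrix_inv A *v w) \<le> norm w / c" "norm (matrix_inv A) \<le> sqrt CARD('n) / c"
proof -
  have bnd: "c * norm v \<le> norm (A *v v)" for v
  proof (cases "v = 0")
    case False
    have "c * (norm v * norm v) \<le> norm v * norm (A *v v)"
      using assms(2)[of v] norm_cauchy_schwarz[of v "A *v v"]
      by (metis power2_eq_square power2_norm_eq_inner order_trans)
    then show ?thesis using False by (simp add: mult.left_commute)
  qed simp
  have "v = 0" if "A *v v = 0" for v using bnd[of v] that assms(1)
    by (simp add: mult_le_0_iff)
  then show inv: "invertible A" using matrix_left_invertible_ker invertible_left_inverse by metis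
  have *: "norm (matrix_inv A *v w) \<le> norm w / c" for w
    using bnd[of "matrix_inv A *v w"] assms(1)
    by (simp add: matrix_vector_mul_assoc matrix_inv[OF inv] pos_le_divide_eq mult.commute)
  then show "norm (matrix_inv A *v w) \<le> norm w / c" .
  have "norm (matrix_inv A) \<le> sqrt CARD('n) * (1 / c)"
    by (rule norm_le_op_bound) (use * assms(1) in auto)
  then show "norm (matrix_inv A) \<le> sqrt CARD('n) / c" by simp
qed

lemma pos_def_invertible: "pos_def A \<Longrightarrow> invertible A"
  using pos_def_lower_bound coercive_invertible(1) by metis

lemma pos_def_matrix_inv:
  assumes "pos_def A" shows "pos_def (matrix_inv A)"
proof -
  note inv = pos_def_invertible[OF assms]
  have t: "transpose (matrix_inv A) = matrix_inv A"
    using matrix_inv_transpose[OF inv] pos_defD(1)[OF assms] by simp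
  moreover have "0 < v \<bullet> (matrix_inv A *v v)" if "v \<noteq> 0" for v
  proof -
    define w where "w = matrix_inv A *v v"
    have "A *v w = v" by (simp add: w_def matrix_vector_mul_assoc matrix_inv[OF inv])
    with that have "w \<noteq> 0" by auto
    with \<open>A *v w = v\<close> pos_defD(2)[OF assms, of w] show ?thesis
      by (simp add: w_def[symmetric] inner_commute)
  qed
  ultimately show ?thesis by (simp add: pos_def_def)
qed

lemma pos_def_congruence:
  fixes R :: "real^'q^'k"
  assumes "pos_def V" "\<And>v. R *v v = 0 \<Longrightarrow> v = 0"
  shows "pos_def (transpose R ** V ** R)"
proof -
  have "v \<bullet> ((transpose R ** V ** R) *v v) = (R *v v) \<bullet> (V *v (R *v v))" for v
    by (metis matrix_vector_mul_assoc transpose_dot inner_commute)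
  then show ?thesis using assms unfolding pos_def_def
    by (metis matrix_mul_assoc matrix_transpose_mul transpose_transpose)
qed

lemma pos_def_scaleR: "pos_def A \<Longrightarrow> 0 < c \<Longrightarrow> pos_def (c *\<^sub>R A)"
  by (simp add: pos_def_def transpose_scalar scaleR_matrix_vector_assoc[symmetric])


subsection \<open>Square roots of positive definite matrices\<close>

text \<open>The operator-norm bound is stated vector by vector, which exhibits the set as an
  intersection of closed conditions. It is the domain of the fixed-point map for the square
  root.\<close>

definition sym_ball :: "real \<Rightarrow> (real^'n^'n) set" where
  "sym_ball r = {X. transpose X = X \<and> (\<forall>v. norm (X *v v) \<le> r * norm v)}"

lemma continuous_on_mult_vec [continuous_intros]:
  "continuous_on S f \<Longrightarrow> continuous_on S (\<lambda>x. f x *v (v::real^'n))"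
  unfolding matrix_vector_mult_def by (intro continuous_intros)

lemma continuous_on_transpose [continuous_intros]:
  "continuous_on S f \<Longrightarrow> continuous_on S (\<lambda>x. transpose (f x :: real^'n^'m))"
  unfolding transpose_def by (intro continuous_intros)

lemma continuous_on_matrix_mul [continuous_intros]:
  "continuous_on S f \<Longrightarrow> continuous_on S g \<Longrightarrow> continuous_on S (\<lambda>x. f x ** (g x :: real^'n^'m))"
  unfolding matrix_matrix_mult_def by (intro continuous_intros)

lemma closed_sym_ball: "closed (sym_ball r :: (real^'n^'n) set)"
proof -
  have "(sym_ball r :: (real^'n^'n) set) = {X. transpose X = X} \<inter> (\<Inter>v. {X. norm (X *v v) \<le> r * norm v})"
    by (auto simp: sym_ball_def)
  moreover have "closed {X :: real^'n^'n. transpose X = X}"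
    by (intro closed_Collect_eq continuous_intros)
  moreover have "closed {X :: real^'n^'n. norm (X *v v) \<le> r * norm v}" for v
    by (intro closed_Collect_le continuous_intros)
  ultimately show ?thesis by (simp add: closed_INT closed_Int)
qed

lemma norm_matrix_mul_op_le_right:
  fixes A :: "real^'n^'n"
  assumes "transpose B = B" "\<And>v. norm (B *v v) \<le> b * norm v" "0 \<le> b"
  shows "norm (A ** B) \<le> b * norm A"
proof -
  have "norm (A ** B) = norm (B ** transpose A)"
    by (metis assms(1) matrix_transpose_mul norm_transpose)
  also have "\<dots> \<le> b * norm (transpose A)" by (rule norm_matrix_mul_op_le[OF assms(2,3)])
  finally show ?thesis by simp
qed

text \<open>(I - X)^2 = I - T is equivalent to X = (T + X^2)/2, which Banach's fixed point theorem
  solves. The ball is taken in operator norm while distances are Frobenius;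
  \<open>norm_matrix_mul_op_le\<close> mediates between the two.\<close>

lemma sqrt_one_minus_exists:
  fixes T :: "real^'n^'n"
  assumes sym: "transpose T = T" and bnd: "\<And>v. norm (T *v v) \<le> \<rho> * norm v" and rho: "0 \<le> \<rho>" "\<rho> < 1"
  obtains X r where "r < 1" "X \<in> sym_ball r" "(mat 1 - X) ** (mat 1 - X) = mat 1 - T"
proof -
  \<comment> \<open>The smaller root of the scalar equation r = (\<rho> + r^2)/2. It is both a
    radius preserved by the map and its contraction factor.\<close>
  define r where "r = 1 - sqrt (1 - \<rho>)"
  have r: "0 \<le> r" "r < 1" using rho by (auto simp: r_def)
  have "(1 - r)\<^sup>2 = 1 - \<rho>" using rho by (simp add: r_def)
  then have r2: "(\<rho> + r\<^sup>2) / 2 = r" by (simp add: power2_eq_square algebra_simps)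
  define f where "f X = (1/2) *\<^sub>R (T + X ** X)" for X :: "real^'n^'n"
  have maps: "f X \<in> sym_ball r" if X: "X \<in> sym_ball r" for X
  proof -
    have "norm (f X *v v) \<le> r * norm v" for v
    proof -
      have "norm (X *v (X *v v)) \<le> r * (r * norm v)"
      proof -
        have XX: "norm (X *v w) \<le> r * norm w" for w using X by (simp add: sym_ball_def)
        show ?thesis using XX[of "X *v v"] mult_left_mono[OF XX[of v] r(1)] by linarith
      qed
      then have 1: "norm (T *v v + X *v (X *v v)) \<le> \<rho> * norm v + r * (r * norm v)"
        using bnd[of v] norm_triangle_ineq[of "T *v v" "X *v (X *v v)"] by linarith
      have "f X *v v = (1/2) *\<^sub>R (T *v v + X *v (X *v v))"
        by (simp only: f_def scaleR_matrix_vector_assoc[symmetric] matrix_vector_mult_add_rdistrib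
            matrix_vector_mul_assoc)
      then have "norm (f X *v v) = norm (T *v v + X *v (X *v v)) / 2" by simp
      with 1 have "norm (f X *v v) \<le> ((\<rho> + r\<^sup>2) / 2) * norm v"
        by (simp add: power2_eq_square field_simps del: scaleR_add_right)
      then show ?thesis by (simp only: r2)
    qed
    moreover have "transpose (f X) = f X"
      using X sym by (simp add: f_def transpose_scalar transpose_plus matrix_transpose_mul sym_ball_def)
    ultimately show ?thesis by (simp add: sym_ball_def)
  qed
  have contr: "dist (f X) (f Y) \<le> r * dist X Y" if X: "X \<in> sym_ball r" and Y: "Y \<in> sym_ball r" for X Y
  proof -
    have "f X - f Y = (1/2) *\<^sub>R (X ** (X - Y) + (X - Y) ** Y)"
      by (simp add: f_def mat_algebra algebra_simps)
    moreover have "norm (X ** (X - Y)) \<le> r * norm (X - Y)"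
      using X r by (intro norm_matrix_mul_op_le) (auto simp: sym_ball_def)
    moreover have "norm ((X - Y) ** Y) \<le> r * norm (X - Y)"
      using Y r by (intro norm_matrix_mul_op_le_right) (auto simp: sym_ball_def)
    moreover have "norm (X ** (X - Y) + (X - Y) ** Y) \<le> norm (X ** (X - Y)) + norm ((X - Y) ** Y)"
      by (rule norm_triangle_ineq)
    ultimately show ?thesis by (simp add: dist_norm)
  qed
  have "\<exists>!X\<in>sym_ball r. f X = X"
  proof (rule Banach_fix[OF closed_sym_ball[unfolded complete_eq_closed[symmetric]] _ r])
    have "0 \<in> (sym_ball r :: (real^'n^'n) set)" using r by (simp add: sym_ball_def transpose_def vec_eq_iff)
    then show "sym_ball r \<noteq> ({} :: (real^'n^'n) set)" by blast
  qed (use maps contr in auto)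
  then obtain X where X: "X \<in> sym_ball r" "f X = X" by blast
  have "(mat 1 - X) ** (mat 1 - X) = mat 1 - (2 *\<^sub>R X - X ** X)"
    by (simp add: mat_algebra scaleR_2)
  also have "2 *\<^sub>R X - X ** X = 2 *\<^sub>R f X - X ** X" by (simp add: X(2))
  also have "\<dots> = T" by (simp add: f_def)
  finally show thesis using that r(2) X(1) by blast
qed

lemma pos_def_sqrt_exists:
  fixes A :: "real^'n^'n"
  assumes "pos_def A"
  obtains B where "pos_def B" "B ** B = A"
proof -
  obtain l where l: "0 < l" "\<And>v. l * (v \<bullet> v) \<le> v \<bullet> (A *v v)" by (rule pos_def_lower_bound[OF assms]) blast
  \<comment> \<open>A scale for which I - A/c is a strict contraction: |A|^2 \<le> c l bounds the
    quadratic term of |v - A v / c|^2 by (l/c) |v|^2, against the gain 2 (l/c) |v|^2 of the linear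
    term. The summand l^2 makes c at least l.\<close>
  define c where "c = ((norm A)\<^sup>2 + l\<^sup>2) / l"
  have c: "0 < c" unfolding c_def using l(1) by (intro divide_pos_pos add_nonneg_pos) auto
  define \<rho> where "\<rho> = sqrt (max 0 (1 - l / c))"
  have rho: "0 \<le> \<rho>" "\<rho> < 1" using l(1) c by (auto simp: \<rho>_def max_def)
  define T where "T = mat 1 - (1 / c) *\<^sub>R A"
  have symA: "transpose A = A" using assms pos_defD by blast
  have "transpose T = T" by (simp add: T_def transpose_minus transpose_scalar symA)
  moreover have "norm (T *v v) \<le> \<rho> * norm v" for v
  proof -
    have "(norm (T *v v))\<^sup>2 = v \<bullet> v - 2 * (v \<bullet> (A *v v)) / c + (norm (A *v v))\<^sup>2 / c\<^sup>2"
      unfolding power2_norm_eq_inner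
      by (simp add: T_def matrix_vector_mult_diff_rdistrib scaleR_matrix_vector_assoc[symmetric]
          inner_diff_left inner_diff_right inner_commute power2_eq_square)
    also have "\<dots> \<le> v \<bullet> v - 2 * (l * (v \<bullet> v)) / c + (c * l) * (v \<bullet> v) / c\<^sup>2"
    proof -
      have "(norm (A *v v))\<^sup>2 \<le> (norm A)\<^sup>2 * (norm v)\<^sup>2"
        using norm_matrix_vector_mult_le[of A v] by (metis norm_ge_zero power_mono power_mult_distrib)
      also have "\<dots> \<le> (c * l) * (norm v)\<^sup>2"
        by (intro mult_right_mono) (use l(1) in \<open>auto simp: c_def\<close>)
      finally have "(norm (A *v v))\<^sup>2 \<le> (c * l) * (v \<bullet> v)" by (simp add: power2_norm_eq_inner)
      then show ?thesis using l(2)[of v] c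
        by (intro add_mono diff_mono divide_right_mono mult_left_mono) auto
    qed
    also have "\<dots> = (1 - l / c) * (v \<bullet> v)" using c by (simp add: field_simps power2_eq_square)
    also have "\<dots> \<le> (\<rho> * norm v)\<^sup>2"
      by (simp add: \<rho>_def power_mult_distrib power2_norm_eq_inner mult_right_mono)
    finally show ?thesis by (rule power2_le_imp_le) (use rho in simp)
  qed
  ultimately obtain X r where X: "r < 1" "X \<in> sym_ball r" "(mat 1 - X) ** (mat 1 - X) = mat 1 - T"
    using sqrt_one_minus_exists[OF _ _ rho] by metis
  have "pos_def (mat 1 - X)"
  proof (rule pos_defI)
    show "transpose (mat 1 - X) = mat 1 - X" using X by (simp add: transpose_minus sym_ball_def)
    show "0 < 1 - r" using X by simp
    fix v
    have "v \<bullet> (X *v v) \<le> norm v * (r * norm v)"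
      using norm_cauchy_schwarz[of v "X *v v"] X(2) by (smt (verit) mem_Collect_eq mult_left_mono norm_ge_zero sym_ball_def)
    then show "(1 - r) * (v \<bullet> v) \<le> v \<bullet> ((mat 1 - X) *v v)"
      by (simp add: matrix_vector_mult_diff_rdistrib inner_diff_right algebra_simps power2_norm_eq_inner[symmetric] power2_eq_square)
  qed
  then have "pos_def (sqrt c *\<^sub>R (mat 1 - X))" using c by (intro pos_def_scaleR) auto
  moreover have "(sqrt c *\<^sub>R (mat 1 - X)) ** (sqrt c *\<^sub>R (mat 1 - X)) = c *\<^sub>R (mat 1 - T)"
    using X(3) c by (simp add: matrix_mul_scaleR_left matrix_mul_scaleR_right)
  then have "(sqrt c *\<^sub>R (mat 1 - X)) ** (sqrt c *\<^sub>R (mat 1 - X)) = A"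
    using c by (simp add: T_def)
  ultimately show thesis by (rule that)
qed

text \<open>The inner product is the trace of the product of the positive semidefinite \<open>Y' A Y\<close> and \<open>B\<close>.\<close>

lemma inner_sandwich_nonneg:
  fixes A B Y :: "real^'n^'n"
  assumes A: "pos_def A" and B: "pos_def B"
  shows "0 \<le> Y \<bullet> (A ** Y ** B)"
proof -
  obtain C where C: "pos_def C" "C ** C = B" using pos_def_sqrt_exists[OF B] .
  have "Y \<bullet> (A ** Y ** B) = (Y ** C) \<bullet> (A ** (Y ** C))"
    using inner_matrix_mul_right[of Y C "A ** Y ** C"] C pos_defD(1)
    by (metis inner_matrix_mul_right inner_commute matrix_mul_assoc)
  also have "\<dots> = transpose (Y ** C) \<bullet> transpose (A ** (Y ** C))" by (simp add: inner_transpose)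
  also have "\<dots> = (\<Sum>j\<in>UNIV. (transpose (Y ** C) $ j) \<bullet> (A *v (transpose (Y ** C) $ j)))"
  proof -
    have "transpose (A ** Z) $ j = A *v (transpose Z $ j)" for Z :: "real^'n^'n" and j
      by (vector transpose_def matrix_matrix_mult_def matrix_vector_mult_def)
    then show ?thesis by (simp only: inner_vec_def[of "transpose (Y ** C)"])
  qed
  also have "\<dots> \<ge> 0" by (intro sum_nonneg pos_def_nonneg A)
  finally show ?thesis .
qed

text \<open>The bound does not involve the condition number of \<open>A\<close>: this makes the studentization
  by the symmetric square root insensitive to the scaling of the restrictions.\<close>

lemma sqrt_comparison:
  fixes A B :: "real^'n^'n"
  assumes A: "pos_def A" and B: "pos_def B"
  defines "W \<equiv> matrix_inv A ** (B ** B) ** matrix_inv A"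
  shows "norm (mat 1 - matrix_inv A ** B) \<le> norm ((mat 1 - W) ** (A ** matrix_inv B))"
proof -
  note iA = matrix_inv[OF pos_def_invertible[OF A]] and iB = matrix_inv[OF pos_def_invertible[OF B]]
  define Y where "Y = mat 1 - matrix_inv A ** B"
  define Z where "Z = (mat 1 - W) ** (A ** matrix_inv B)"
  have "W ** (A ** matrix_inv B) = matrix_inv A ** B"
  proof -
    have "W ** (A ** matrix_inv B) = matrix_inv A ** B ** (B ** (matrix_inv A ** A) ** matrix_inv B)"
      by (simp add: W_def matrix_mul_assoc)
    then show ?thesis by (simp add: iA iB)
  qed
  then have Z: "Z = A ** matrix_inv B - matrix_inv A ** B"
    by (simp add: Z_def matrix_mul_minus_left)
  have "A ** Y ** matrix_inv B = A ** matrix_inv B - A ** matrix_inv A ** (B ** matrix_inv B)"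
    by (simp add: Y_def mat_algebra)
  then have AY: "A ** Y ** matrix_inv B = Z - Y" by (simp add: iA iB Z Y_def)
  \<comment> \<open>As A Y B^(-1) = Z - Y, positivity says that |Y|^2 is at most the inner product
    of Y and Z, and Cauchy-Schwarz gives the bound with constant 1.\<close>
  have "0 \<le> Y \<bullet> (A ** Y ** matrix_inv B)" by (rule inner_sandwich_nonneg[OF A pos_def_matrix_inv[OF B]])
  then have "Y \<bullet> Y \<le> Y \<bullet> Z" by (simp add: AY inner_diff_right)
  also have "\<dots> \<le> norm Y * norm Z" by (rule norm_cauchy_schwarz)
  finally have "norm Y * norm Y \<le> norm Y * norm Z" by (simp add: power2_norm_eq_inner[symmetric] power2_eq_square)
  then have "norm Y \<le> norm Z" by (cases "Y = 0") auto
  then show ?thesis by (simp add: Y_def Z_def)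
qed

text \<open>If A^2 = B^2 then the matrix \<open>W\<close> of \<open>sqrt_comparison\<close> is the
  identity and the bound there is 0, so A^(-1) B = I.\<close>

lemma pos_def_sqrt_unique:
  fixes A B :: "real^'n^'n"
  assumes "pos_def A" "pos_def B" "A ** A = B ** B"
  shows "A = B"
proof -
  note iA = matrix_inv[OF pos_def_invertible[OF assms(1)]]
  have "matrix_inv A ** (A ** A) ** matrix_inv A = (matrix_inv A ** A) ** (A ** matrix_inv A)"
    by (simp add: matrix_mul_assoc)
  then have "mat 1 - matrix_inv A ** (A ** A) ** matrix_inv A = 0"
    by (simp add: iA)
  then have *: "norm (mat 1 - matrix_inv A ** B) \<le> norm ((0 :: real^'n^'n) ** (A ** matrix_inv B))"
    using sqrt_comparison[OF assms(1,2)] by (simp only: assms(3)[symmetric])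
  have "mat 1 - matrix_inv A ** B = 0"
  proof -
    have "(0 :: real^'n^'n) ** (A ** matrix_inv B) = 0" by (simp add: matrix_matrix_mult_def vec_eq_iff)
    with * show ?thesis by simp
  qed
  then have "matrix_inv A ** B = mat 1" by simp
  then have "A ** (matrix_inv A ** B) = A" by simp
  then show ?thesis by (simp add: matrix_mul_assoc iA)
qed

lemma mat_sqrt:
  assumes "pos_def A"
  shows "pos_def (mat_sqrt A)" "mat_sqrt A ** mat_sqrt A = A"
proof -
  obtain B where B: "pos_def B" "B ** B = A" using pos_def_sqrt_exists[OF assms] .
  have "\<exists>!B. pos_def B \<and> B ** B = A"
    by (rule ex1I[of _ B]) (use B pos_def_sqrt_unique in auto)
  from theI'[OF this] show "pos_def (mat_sqrt A)" "mat_sqrt A ** mat_sqrt A = A"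
    by (auto simp: mat_sqrt_def)
qed

lemma mat_inv_sqrt:
  assumes "pos_def A"
  shows "pos_def (mat_inv_sqrt A)" "mat_inv_sqrt A ** A ** mat_inv_sqrt A = mat 1"
    "mat_inv_sqrt A ** mat_inv_sqrt A = matrix_inv A"
proof -
  note s = mat_sqrt[OF assms] and inv = pos_def_invertible[OF mat_sqrt(1)[OF assms]]
  show "pos_def (mat_inv_sqrt A)" unfolding mat_inv_sqrt_def by (rule pos_def_matrix_inv[OF s(1)])
  have "mat_inv_sqrt A ** A ** mat_inv_sqrt A
      = (mat_inv_sqrt A ** mat_sqrt A) ** (mat_sqrt A ** mat_inv_sqrt A)"
    by (metis s(2) matrix_mul_assoc)
  then show "mat_inv_sqrt A ** A ** mat_inv_sqrt A = mat 1"
    by (simp add: mat_inv_sqrt_def matrix_inv[OF inv])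
  show "mat_inv_sqrt A ** mat_inv_sqrt A = matrix_inv A"
    unfolding mat_inv_sqrt_def by (metis matrix_inv_mult[OF inv inv] s(2))
qed

text \<open>Let A and B be the roots of V and V', and H = B^(-1) A. Then H W H' = I, so W being
  within 1/2 of I bounds H' and then H by sqrt 2 in operator norm. \<open>sqrt_comparison\<close>
  controls I - A^(-1) B by sqrt 2 |W - I|, and H - I = H (I - A^(-1) B).\<close>

lemma inv_sqrt_ratio_bound:
  fixes V V' :: "real^'n^'n"
  assumes V: "pos_def V" and V': "pos_def V'"
  defines "W \<equiv> mat_inv_sqrt V ** V' ** mat_inv_sqrt V"
  assumes W: "norm (W - mat 1) \<le> 1/2"
  shows "norm (mat_inv_sqrt V' ** mat_sqrt V - mat 1) \<le> 2 * sqrt CARD('n) * norm (W - mat 1)"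
proof -
  define A B where "A = mat_sqrt V" and "B = mat_sqrt V'"
  note A = mat_sqrt[OF V, folded A_def] and B = mat_sqrt[OF V', folded B_def]
  have W_def': "W = matrix_inv A ** (B ** B) ** matrix_inv A"
    by (simp add: W_def A_def B(2) mat_inv_sqrt_def)
  note iA = matrix_inv[OF pos_def_invertible[OF A(1)]] and iB = matrix_inv[OF pos_def_invertible[OF B(1)]]
  define H where "H = matrix_inv B ** A"
  have tA: "transpose A = A" "transpose (matrix_inv B) = matrix_inv B"
    using A B pos_def_matrix_inv pos_defD(1) by blast+
  have tH: "A ** matrix_inv B = transpose H"
    by (simp add: H_def matrix_transpose_mul tA)
  have HWH: "H ** W ** transpose H = mat 1"
  proof -
    have "H ** W ** transpose H = matrix_inv B ** ((A ** matrix_inv A) ** B) ** (B ** (matrix_inv A ** A) ** matrix_inv B)"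
      by (simp add: W_def' H_def tA matrix_transpose_mul matrix_mul_assoc)
    then show ?thesis by (simp add: iA iB matrix_mul_assoc)
  qed
  have opHT: "norm (transpose H *v v) \<le> sqrt 2 * norm v" for v
  proof -
    define w where "w = transpose H *v v"
    have "v \<bullet> v = v \<bullet> ((H ** W ** transpose H) *v v)" by (simp add: HWH)
    also have "\<dots> = v \<bullet> (H *v (W *v w))"
      by (simp only: w_def matrix_vector_mul_assoc matrix_mul_assoc)
    also have "\<dots> = w \<bullet> (W *v w)" unfolding w_def by (simp only: transpose_dot)
    also have "W *v w = w + (W - mat 1) *v w" by (simp add: matrix_vector_mult_diff_rdistrib)
    also have "w \<bullet> (w + (W - mat 1) *v w) = w \<bullet> w + w \<bullet> ((W - mat 1) *v w)" by (rule inner_add_right)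
    finally have vv: "v \<bullet> v = w \<bullet> w + w \<bullet> ((W - mat 1) *v w)" .
    have "norm ((W - mat 1) *v w) \<le> (1/2) * norm w"
      using norm_matrix_vector_mult_le[of "W - mat 1" w] W by (meson mult_right_mono norm_ge_zero order_trans)
    then have "\<bar>w \<bullet> ((W - mat 1) *v w)\<bar> \<le> norm w * ((1/2) * norm w)"
      by (meson Cauchy_Schwarz_ineq2 mult_left_mono norm_ge_zero order_trans)
    then have "(1/2) * (w \<bullet> w) \<le> v \<bullet> v" using vv by (simp add: power2_norm_eq_inner[symmetric] power2_eq_square)
    then have "(norm w)\<^sup>2 \<le> (sqrt 2 * norm v)\<^sup>2" by (simp add: power_mult_distrib power2_norm_eq_inner)
    then show ?thesis unfolding w_def by (rule power2_le_imp_le) simp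
  qed
  have nH: "norm H \<le> sqrt CARD('n) * sqrt 2"
    using norm_le_op_bound[OF opHT] by simp
  have "norm (mat 1 - matrix_inv A ** B) \<le> norm ((mat 1 - W) ** transpose H)"
    using sqrt_comparison[OF A(1) B(1)] by (simp add: W_def' tH)
  also have "\<dots> = norm (H ** transpose (mat 1 - W))"
    by (metis matrix_transpose_mul norm_transpose transpose_transpose)
  finally have 1: "norm (mat 1 - matrix_inv A ** B) \<le> norm (H ** transpose (mat 1 - W))" .
  have opH: "norm (H *v v) \<le> sqrt 2 * norm v" for v
  proof -
    have "(norm (H *v v))\<^sup>2 = v \<bullet> (transpose H *v (H *v v))"
      by (metis inner_commute power2_norm_eq_inner transpose_dot)
    also have "\<dots> \<le> norm v * (sqrt 2 * norm (H *v v))"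
      using norm_cauchy_schwarz[of v "transpose H *v (H *v v)"] opHT[of "H *v v"]
      by (meson mult_left_mono norm_ge_zero order_trans)
    finally have "norm (H *v v) * norm (H *v v) \<le> norm (H *v v) * (sqrt 2 * norm v)"
      by (simp add: power2_eq_square mult_ac)
    then show ?thesis by (cases "H *v v = 0") auto
  qed
  have "norm (H ** transpose (mat 1 - W)) \<le> sqrt 2 * norm (transpose (mat 1 - W))"
    by (rule norm_matrix_mul_op_le[OF opH]) simp
  then have 2: "norm (mat 1 - matrix_inv A ** B) \<le> sqrt 2 * norm (W - mat 1)"
    using 1 by (simp add: norm_minus_commute)
  have "H ** (mat 1 - matrix_inv A ** B) = H - matrix_inv B ** (A ** matrix_inv A) ** B"
    by (simp add: H_def mat_algebra)
  then have "H - mat 1 = H ** (mat 1 - matrix_inv A ** B)" by (simp add: iA iB)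
  then have "norm (H - mat 1) \<le> sqrt 2 * norm (mat 1 - matrix_inv A ** B)"
    using norm_matrix_mul_op_le[OF opH] by simp
  also have "\<dots> \<le> sqrt 2 * (sqrt 2 * norm (W - mat 1))" by (intro mult_left_mono 2) simp
  also have "\<dots> = 2 * norm (W - mat 1)" by simp
  also have "\<dots> \<le> 2 * sqrt CARD('n) * norm (W - mat 1)"
    by (intro mult_right_mono) auto
  finally show ?thesis by (simp add: H_def A_def B_def mat_inv_sqrt_def)
qed

text \<open>Continuity serves the measurability of the studentized statistic. By
  \<open>inv_sqrt_ratio_bound\<close>, X^(-1/2) - V^(-1/2) is a small matrix times V^(-1/2) once
  V^(-1/2) X V^(-1/2) is near I.\<close>

lemma continuous_on_mat_inv_sqrt: "continuous_on {A :: real^'n^'n. pos_def A} mat_inv_sqrt"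
proof (unfold continuous_on_def, intro ballI)
  fix V :: "real^'n^'n" assume "V \<in> {A. pos_def A}"
  then have V: "pos_def V" by simp
  let ?F = "at V within {A. pos_def A}"
  define P where "P = mat_inv_sqrt V"
  define W where "W X = P ** X ** P" for X
  have "continuous_on UNIV W" unfolding W_def by (intro continuous_intros)
  then have "(W \<longlongrightarrow> W V) ?F" by (meson continuous_on_def UNIV_I tendsto_within_subset subset_UNIV)
  moreover have WV: "W V = mat 1" by (simp add: W_def P_def mat_inv_sqrt[OF V])
  ultimately have W0: "((\<lambda>X. norm (W X - mat 1)) \<longlongrightarrow> 0) ?F"
    by (simp add: tendsto_norm_zero_iff LIM_zero_iff)
  then have ev: "eventually (\<lambda>X. norm (W X - mat 1) \<le> 1/2) ?F"
    using order_tendstoD(2)[OF W0, of "1/2"] by (auto elim: eventually_mono)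
  have ev2: "eventually (\<lambda>X. pos_def X) ?F"
    by (simp add: eventually_at_filter)
  have bnd: "norm (mat_inv_sqrt X - P) \<le> 2 * sqrt CARD('n) * norm (W X - mat 1) * norm P"
    if "norm (W X - mat 1) \<le> 1/2" "pos_def X" for X
  proof -
    have "mat_sqrt V ** P = mat 1"
      unfolding P_def mat_inv_sqrt_def by (simp add: matrix_inv pos_def_invertible mat_sqrt V)
    then have "mat_inv_sqrt X - P = (mat_inv_sqrt X ** mat_sqrt V - mat 1) ** P"
      by (simp add: matrix_mul_minus_left matrix_mul_assoc[symmetric])
    then have "norm (mat_inv_sqrt X - P) \<le> norm (mat_inv_sqrt X ** mat_sqrt V - mat 1) * norm P"
      by (simp add: norm_matrix_mul_le)
    also have "\<dots> \<le> 2 * sqrt CARD('n) * norm (W X - mat 1) * norm P"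
      using inv_sqrt_ratio_bound[OF V that(2)] that(1) by (intro mult_right_mono) (auto simp: W_def P_def)
    finally show ?thesis .
  qed
  have "((\<lambda>X. 2 * sqrt CARD('n) * norm (W X - mat 1) * norm P) \<longlongrightarrow> 2 * sqrt CARD('n) * 0 * norm P) ?F"
    by (intro tendsto_intros W0)
  then have "((\<lambda>X. 2 * sqrt CARD('n) * norm (W X - mat 1) * norm P) \<longlongrightarrow> 0) ?F" by simp
  then have "((\<lambda>X. mat_inv_sqrt X - P) \<longlongrightarrow> 0) ?F"
    by (rule Lim_null_comparison[rotated]) (use ev ev2 bnd in \<open>auto elim: eventually_elim2\<close>)
  then show "(mat_inv_sqrt \<longlongrightarrow> mat_inv_sqrt V) ?F" by (simp add: P_def LIM_zero_iff)
qed


subsection \<open>Measurability of matrix operations\<close>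

lemma borel_measurable_vec_nth [measurable (raw)]:
  "f \<in> borel_measurable M \<Longrightarrow> (\<lambda>w. f w $ i) \<in> borel_measurable (M :: 'a measure)"
  for f :: "'a \<Rightarrow> 'b::{real_normed_vector} ^ 'n"
  by (rule borel_measurable_continuous_on[of "\<lambda>x. x $ i"]) (intro continuous_intros)

lemma borel_measurable_vecI:
  fixes f :: "'a \<Rightarrow> 'b::euclidean_space ^ 'n"
  assumes "\<And>i. (\<lambda>w. f w $ i) \<in> borel_measurable M"
  shows "f \<in> borel_measurable M"
  by (subst borel_measurable_euclidean_space)
    (auto simp: inner_axis Basis_vec_def intro!: borel_measurable_inner assms)

lemma borel_measurable_matI:
  fixes f :: "'a \<Rightarrow> real ^ 'n ^ 'm"
  assumes "\<And>i j. (\<lambda>w. f w $ i $ j) \<in> borel_measurable M"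
  shows "f \<in> borel_measurable M"
  by (intro borel_measurable_vecI assms)

lemma borel_measurable_mat_mul [measurable (raw)]:
  fixes f :: "'a \<Rightarrow> real ^ 'n ^ 'm" and g :: "'a \<Rightarrow> real ^ 'k ^ 'n"
  assumes [measurable]: "f \<in> borel_measurable M" "g \<in> borel_measurable M"
  shows "(\<lambda>w. f w ** g w) \<in> borel_measurable M"
  by (rule borel_measurable_matI) (simp add: matrix_matrix_mult_def)

lemma borel_measurable_mat_vec [measurable (raw)]:
  fixes f :: "'a \<Rightarrow> real ^ 'n ^ 'm" and g :: "'a \<Rightarrow> real ^ 'n"
  assumes [measurable]: "f \<in> borel_measurable M" "g \<in> borel_measurable M"
  shows "(\<lambda>w. f w *v g w) \<in> borel_measurable M"
  by (rule borel_measurable_vecI) (simp add: matrix_vector_mult_def)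

lemma borel_measurable_outer [measurable (raw)]:
  fixes f :: "'a \<Rightarrow> real ^ 'm" and g :: "'a \<Rightarrow> real ^ 'n"
  assumes [measurable]: "f \<in> borel_measurable M" "g \<in> borel_measurable M"
  shows "(\<lambda>w. outer (f w) (g w)) \<in> borel_measurable M"
  by (rule borel_measurable_matI) (simp add: outer_def)

lemma borel_measurable_det [measurable (raw)]:
  fixes f :: "'a \<Rightarrow> real ^ 'n ^ 'n"
  assumes [measurable]: "f \<in> borel_measurable M"
  shows "(\<lambda>w. det (f w)) \<in> borel_measurable M"
  unfolding det_def by measurable

lemma pred_invertible [measurable (raw)]:
  fixes f :: "'a \<Rightarrow> real ^ 'n ^ 'n"
  assumes [measurable]: "f \<in> borel_measurable M"
  shows "Measurable.pred M (\<lambda>w. invertible (f w))"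
  unfolding invertible_det_nz by measurable

text \<open>Shows the inverse as a quotient of polynomials in the entries, hence measurable where
  the determinant is nonzero.\<close>

lemma matrix_inv_cramer:
  fixes A :: "real ^ 'n ^ 'n"
  assumes "invertible A"
  shows "matrix_inv A $ k $ l = det (\<chi> i j. if j = k then axis l 1 $ i else A $ i $ j) / det A"
proof -
  have "A *v (matrix_inv A *v axis l 1) = axis l 1"
    by (simp add: matrix_vector_mul_assoc matrix_inv[OF assms])
  then have "matrix_inv A *v axis l 1 = (\<chi> k. det (\<chi> i j. if j = k then axis l 1 $ i else A $ i $ j) / det A)"
    by (subst (asm) cramer) (use assms in \<open>auto simp: invertible_det_nz\<close>)
  moreover have "(matrix_inv A *v axis l 1) $ k = matrix_inv A $ k $ l"
    by (simp add: matrix_vector_mult_dot inner_axis)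
  ultimately show ?thesis by (metis (no_types, lifting) vec_lambda_beta)
qed

text \<open>Where \<open>invertible\<close> fails, \<open>matrix_inv\<close> is an unspecified
  choice, so the value 0 is put in its place.\<close>

lemma borel_measurable_matrix_inv:
  fixes f :: "'a \<Rightarrow> real ^ 'n ^ 'n"
  assumes [measurable]: "f \<in> borel_measurable M"
  shows "(\<lambda>w. if invertible (f w) then matrix_inv (f w) else 0) \<in> borel_measurable M"
proof (rule borel_measurable_matI)
  fix k l
  have [measurable]: "(\<lambda>w. \<chi> i j. if j = k then axis l 1 $ i else f w $ i $ j) \<in> borel_measurable M"
    by (rule borel_measurable_matI) simp
  have "(\<lambda>w. (if invertible (f w) then matrix_inv (f w) else 0) $ k $ l) =
    (\<lambda>w. if invertible (f w) then det (\<chi> i j. if j = k then axis l 1 $ i else f w $ i $ j) / det (f w) else 0)"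
    by (auto simp: matrix_inv_cramer fun_eq_iff)
  then show "(\<lambda>w. (if invertible (f w) then matrix_inv (f w) else 0) $ k $ l) \<in> borel_measurable M"
    by simp
qed

text \<open>Strict positivity for uncountably many v is not visibly a Borel condition. Coercivity
  with the constants 1/(n+1) makes the set a countable union of closed sets.\<close>

lemma pos_def_set_borel: "{A :: real^'n^'n. pos_def A} \<in> sets borel"
proof -
  have "{A :: real^'n^'n. pos_def A} = (\<Union>n. {A. transpose A = A} \<inter>
      (\<Inter>v. {A. (1 / real (Suc n)) * (v \<bullet> v) \<le> v \<bullet> (A *v v)}))"
  proof (intro set_eqI iffI)
    fix A :: "real^'n^'n" assume "A \<in> {A. pos_def A}"
    then have A: "pos_def A" by simp
    obtain c where c: "0 < c" "\<And>v. c * (v \<bullet> v) \<le> v \<bullet> (A *v v)" using pos_def_lower_bound[OF A] by blast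
    obtain n where "1 / real (Suc n) < c" using nat_approx_posE[OF c(1)] by auto
    then have "(1 / real (Suc n)) * (v \<bullet> v) \<le> v \<bullet> (A *v v)" for v
      using c(2)[of v] by (meson inner_ge_zero less_imp_le mult_right_mono order_trans)
    with A show "A \<in> (\<Union>n. {A. transpose A = A} \<inter> (\<Inter>v. {A. (1 / real (Suc n)) * (v \<bullet> v) \<le> v \<bullet> (A *v v)}))"
      by (auto simp: pos_defD)
  next
    fix A :: "real^'n^'n"
    assume "A \<in> (\<Union>n. {A. transpose A = A} \<inter> (\<Inter>v. {A. (1 / real (Suc n)) * (v \<bullet> v) \<le> v \<bullet> (A *v v)}))"
    then obtain n where "transpose A = A" "\<And>v. (1 / real (Suc n)) * (v \<bullet> v) \<le> v \<bullet> (A *v v)" by auto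
    then have "pos_def A" by (intro pos_defI[of A "1 / real (Suc n)"]) simp_all
    then show "A \<in> {A. pos_def A}" by simp
  qed
  moreover have "closed ({A :: real^'n^'n. transpose A = A} \<inter>
      (\<Inter>v. {A. (1 / real (Suc n)) * (v \<bullet> v) \<le> v \<bullet> (A *v v)}))" for n
    by (intro closed_Int closed_INT ballI closed_Collect_eq closed_Collect_le continuous_intros)
  ultimately show ?thesis by (simp only:) (intro sets.countable_UN' borel_closed, auto)
qed

lemma pred_pos_def [measurable (raw)]:
  fixes f :: "'a \<Rightarrow> real ^ 'n ^ 'n"
  assumes [measurable]: "f \<in> borel_measurable M"
  shows "Measurable.pred M (\<lambda>w. pos_def (f w))"
  using measurable_sets_Collect[OF assms, of pos_def] pos_def_set_borel by (simp add: pred_def)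

lemma borel_measurable_mat_inv_sqrt:
  fixes f :: "'a \<Rightarrow> real ^ 'n ^ 'n"
  assumes [measurable]: "f \<in> borel_measurable M"
  shows "(\<lambda>w. if pos_def (f w) then mat_inv_sqrt (f w) else 0) \<in> borel_measurable M"
proof -
  have "(\<lambda>A :: real^'n^'n. if A \<in> {A. pos_def A} then mat_inv_sqrt A else 0) \<in> borel_measurable borel"
    by (rule borel_measurable_continuous_on_if) (auto simp: pos_def_set_borel continuous_on_mat_inv_sqrt)
  from measurable_compose[OF assms this] show ?thesis by simp
qed


section \<open>Sums over dependency graphs\<close>

lemma (in prob_space) bounded_integrable:
  fixes f :: "'a \<Rightarrow> real"
  assumes "f \<in> borel_measurable M" "\<And>w. \<bar>f w\<bar> \<le> c"
  shows "integrable M f"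
  by (rule integrable_const_bound[of _ c]) (use assms in auto)

text \<open>Covers non-integrable f too, whose Bochner integral is 0 by convention, so its uses owe
  no measurability proof.\<close>

lemma (in prob_space) abs_expectation_le:
  fixes f :: "'a \<Rightarrow> real"
  assumes "\<And>w. \<bar>f w\<bar> \<le> c"
  shows "\<bar>expectation f\<bar> \<le> c"
proof (cases "integrable M f")
  case True
  have "\<bar>expectation f\<bar> \<le> expectation (\<lambda>w. \<bar>f w\<bar>)" by (rule integral_abs_bound)
  also have "\<dots> \<le> expectation (\<lambda>w. c)"
    by (intro integral_mono) (use True assms in auto)
  finally show ?thesis by (simp add: prob_space)
next
  case False
  then show ?thesis using assms[of undefined] abs_ge_zero order_trans by (simp add: not_integrable_integral_eq)
qed

text \<open>Nonnegativity of the variance of |f|.\<close>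

lemma (in prob_space) expectation_abs_le_sqrt:
  fixes f :: "'a \<Rightarrow> real"
  assumes "f \<in> borel_measurable M" "\<And>w. \<bar>f w\<bar> \<le> c"
  shows "expectation (\<lambda>w. \<bar>f w\<bar>) \<le> sqrt (expectation (\<lambda>w. (f w)\<^sup>2))"
proof (rule real_le_rsqrt)
  have b2: "\<bar>(f w)\<^sup>2\<bar> \<le> c\<^sup>2" for w using assms(2)[of w] by (simp add: abs_le_square_iff[symmetric])
  note [measurable] = assms(1)
  have i2: "integrable M (\<lambda>w. (f w)\<^sup>2)" by (rule bounded_integrable[OF _ b2]) simp
  have i1: "integrable M (\<lambda>w. \<bar>f w\<bar>)" by (rule bounded_integrable[of _ c]) (use assms in auto)
  have "0 \<le> variance (\<lambda>w. \<bar>f w\<bar>)" by simp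
  also have "variance (\<lambda>w. \<bar>f w\<bar>) = expectation (\<lambda>w. (f w)\<^sup>2) - (expectation (\<lambda>w. \<bar>f w\<bar>))\<^sup>2"
    using i1 i2 by (subst variance_eq) auto
  finally show "(expectation (\<lambda>w. \<bar>f w\<bar>))\<^sup>2 \<le> expectation (\<lambda>w. (f w)\<^sup>2)" by simp
qed

text \<open>Independence is between whole families and not just pairs, since a product of a few
  terms has to be separated from the sum over everything far away. By reflexivity each vertex counts
  in its own neighbourhood, and so in D.\<close>

locale dependency_graph = prob_space M for M :: "'a measure" +
  fixes I :: "'i set" and adj :: "'i \<Rightarrow> 'i \<Rightarrow> bool"
    and d :: "'i \<Rightarrow> 'a \<Rightarrow> 'b::second_countable_topology" and D :: real
  assumes finI: "finite I"
    and adj_refl: "n \<in> I \<Longrightarrow> adj n n"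
    and adj_sym: "adj n m \<Longrightarrow> adj m n"
    and degree: "n \<in> I \<Longrightarrow> real (card {m\<in>I. adj n m}) \<le> D"
    and D_nonneg: "0 \<le> D"
    and d_meas: "n \<in> I \<Longrightarrow> d n \<in> borel_measurable M"
    and indep: "S\<^sub>1 \<subseteq> I \<Longrightarrow> S\<^sub>2 \<subseteq> I \<Longrightarrow> (\<And>n m. n \<in> S\<^sub>1 \<Longrightarrow> m \<in> S\<^sub>2 \<Longrightarrow> \<not> adj n m) \<Longrightarrow>
        indep_var (\<Pi>\<^sub>M n\<in>S\<^sub>1. borel) (\<lambda>w. \<lambda>n\<in>S\<^sub>1. d n w) (\<Pi>\<^sub>M n\<in>S\<^sub>2. borel) (\<lambda>w. \<lambda>n\<in>S\<^sub>2. d n w)"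
begin

definition nb :: "'i \<Rightarrow> 'i set" where "nb n = {m\<in>I. adj n m}"

lemma nb: "finite (nb n)" "nb n \<subseteq> I" "n \<in> I \<Longrightarrow> real (card (nb n)) \<le> D"
  using finI degree by (auto simp: nb_def)

lemma data_measurable: "S \<subseteq> I \<Longrightarrow> (\<lambda>w. \<lambda>n\<in>S. d n w) \<in> measurable M (\<Pi>\<^sub>M n\<in>S. borel)"
  by (rule measurable_restrict) (use d_meas in auto)

lemma expectation_mult_indep:
  fixes f g :: "('i \<Rightarrow> 'b) \<Rightarrow> real"
  assumes S: "S\<^sub>1 \<subseteq> I" "S\<^sub>2 \<subseteq> I" "\<And>n m. n \<in> S\<^sub>1 \<Longrightarrow> m \<in> S\<^sub>2 \<Longrightarrow> \<not> adj n m"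
    and f: "f \<in> borel_measurable (\<Pi>\<^sub>M n\<in>S\<^sub>1. borel)" "\<And>z. \<bar>f z\<bar> \<le> a"
    and g: "g \<in> borel_measurable (\<Pi>\<^sub>M n\<in>S\<^sub>2. borel)" "\<And>z. \<bar>g z\<bar> \<le> b"
  shows "expectation (\<lambda>w. f (\<lambda>n\<in>S\<^sub>1. d n w) * g (\<lambda>n\<in>S\<^sub>2. d n w))
    = expectation (\<lambda>w. f (\<lambda>n\<in>S\<^sub>1. d n w)) * expectation (\<lambda>w. g (\<lambda>n\<in>S\<^sub>2. d n w))"
proof (rule indep_var_lebesgue_integral)
  show "indep_var borel (\<lambda>w. f (\<lambda>n\<in>S\<^sub>1. d n w)) borel (\<lambda>w. g (\<lambda>n\<in>S\<^sub>2. d n w))"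
    using indep_var_compose[OF indep[OF S] f(1) g(1)] by (simp add: o_def)
  show "integrable M (\<lambda>w. f (\<lambda>n\<in>S\<^sub>1. d n w))"
    by (rule bounded_integrable[OF measurable_compose[OF data_measurable f(1)]]) (use S f in auto)
  show "integrable M (\<lambda>w. g (\<lambda>n\<in>S\<^sub>2. d n w))"
    by (rule bounded_integrable[OF measurable_compose[OF data_measurable g(1)]]) (use S g in auto)
qed

text \<open>Only pairs j, j' whose supports are linked by an edge have nonzero covariance, and each
  such covariance is at most 2 c^2. A given j has at most r points, each with at most D neighbours,
  each lying in at most E supports.\<close>

lemma sum_variance_bound:
  fixes F :: "'j \<Rightarrow> ('i \<Rightarrow> 'b) \<Rightarrow> real" and supp :: "'j \<Rightarrow> 'i set" and E :: real
  assumes J: "finite J"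
    and supp: "\<And>j. j \<in> J \<Longrightarrow> supp j \<subseteq> I" "\<And>j. j \<in> J \<Longrightarrow> card (supp j) \<le> r"
    and F: "\<And>j. j \<in> J \<Longrightarrow> F j \<in> borel_measurable (\<Pi>\<^sub>M n\<in>supp j. borel)" "\<And>j z. j \<in> J \<Longrightarrow> \<bar>F j z\<bar> \<le> c"
    and E: "0 \<le> E" and fibre: "\<And>i. i \<in> I \<Longrightarrow> real (card {j\<in>J. i \<in> supp j}) \<le> E"
  defines "Y \<equiv> \<lambda>j w. F j (\<lambda>n\<in>supp j. d n w)"
  shows "expectation (\<lambda>w. ((\<Sum>j\<in>J. Y j w) - expectation (\<lambda>w. \<Sum>j\<in>J. Y j w))\<^sup>2)
    \<le> 2 * c\<^sup>2 * (card J * (r * (D * E)))"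
proof -
  define \<mu> where "\<mu> j = expectation (Y j)" for j
  define rel where "rel j = {j'\<in>J. \<exists>i\<in>supp j. \<exists>i'\<in>supp j'. adj i i'}" for j
  have Ym: "Y j \<in> borel_measurable M" and Yb: "\<bar>Y j w\<bar> \<le> c" if "j \<in> J" for j w
    unfolding Y_def using measurable_compose[OF data_measurable[OF supp(1)] F(1)] F(2) that by auto
  have Yi: "integrable M (Y j)" if "j \<in> J" for j using bounded_integrable[OF Ym Yb] that by blast
  have mub: "\<bar>\<mu> j\<bar> \<le> c" if "j \<in> J" for j unfolding \<mu>_def by (rule abs_expectation_le[OF Yb[OF that]])
  have YYb: "\<bar>Y j w * Y j' w\<bar> \<le> c\<^sup>2" if "j \<in> J" "j' \<in> J" for j j' w
    unfolding abs_mult power2_eq_square using Yb[OF that(1)] Yb[OF that(2)]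
    by (meson abs_ge_zero mult_mono order_trans)
  have YYi: "integrable M (\<lambda>w. Y j w * Y j' w)" if "j \<in> J" "j' \<in> J" for j j'
    by (rule bounded_integrable[OF _ YYb[OF that]]) (use Ym that in auto)
  have EYY: "expectation (\<lambda>w. (Y j w - \<mu> j) * (Y j' w - \<mu> j')) = expectation (\<lambda>w. Y j w * Y j' w) - \<mu> j * \<mu> j'"
    if "j \<in> J" "j' \<in> J" for j j'
  proof -
    have "expectation (\<lambda>w. (Y j w - \<mu> j) * (Y j' w - \<mu> j'))
      = expectation (\<lambda>w. Y j w * Y j' w - \<mu> j' * Y j w - \<mu> j * Y j' w + \<mu> j * \<mu> j')"
      by (simp add: algebra_simps)
    also have "\<dots> = expectation (\<lambda>w. Y j w * Y j' w) - \<mu> j' * expectation (Y j) - \<mu> j * expectation (Y j') + \<mu> j * \<mu> j'"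
      using that Yi YYi by (simp add: prob_space)
    finally show ?thesis by (simp add: \<mu>_def)
  qed
  have cov0: "expectation (\<lambda>w. (Y j w - \<mu> j) * (Y j' w - \<mu> j')) = 0" if j: "j \<in> J" "j' \<in> J" "j' \<notin> rel j" for j j'
  proof -
    have "expectation (\<lambda>w. Y j w * Y j' w) = \<mu> j * \<mu> j'"
      unfolding Y_def \<mu>_def
      by (rule expectation_mult_indep) (use j supp F in \<open>auto simp: rel_def\<close>)
    then show ?thesis using EYY[OF j(1,2)] by simp
  qed
  have covb: "expectation (\<lambda>w. (Y j w - \<mu> j) * (Y j' w - \<mu> j')) \<le> 2 * c\<^sup>2" if j: "j \<in> J" "j' \<in> J" for j j'
  proof -
    have "\<bar>expectation (\<lambda>w. Y j w * Y j' w)\<bar> \<le> c\<^sup>2" by (rule abs_expectation_le[OF YYb[OF j]])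
    moreover have "\<bar>\<mu> j * \<mu> j'\<bar> \<le> c\<^sup>2" unfolding abs_mult power2_eq_square
      using mub[OF j(1)] mub[OF j(2)] by (meson abs_ge_zero mult_mono order_trans)
    ultimately show ?thesis using EYY[OF j] by linarith
  qed
  have card_rel: "real (card (rel j)) \<le> r * (D * E)" if j: "j \<in> J" for j
  proof -
    have fins: "finite (supp j)" using supp(1)[OF j] finI finite_subset by blast
    have "rel j = (\<Union>i\<in>supp j. \<Union>i'\<in>nb i. {j'\<in>J. i' \<in> supp j'})"
      using supp(1) by (auto simp: rel_def nb_def)
    then have "card (rel j) \<le> (\<Sum>i\<in>supp j. card (\<Union>i'\<in>nb i. {j'\<in>J. i' \<in> supp j'}))"
      using card_UN_le[OF fins] by simp
    also have "\<dots> \<le> (\<Sum>i\<in>supp j. \<Sum>i'\<in>nb i. card {j'\<in>J. i' \<in> supp j'})"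
      by (intro sum_mono card_UN_le nb)
    finally have "real (card (rel j)) \<le> (\<Sum>i\<in>supp j. \<Sum>i'\<in>nb i. real (card {j'\<in>J. i' \<in> supp j'}))"
      by (metis (mono_tags, lifting) of_nat_le_iff of_nat_sum sum.cong)
    also have "\<dots> \<le> (\<Sum>i\<in>supp j. \<Sum>i'\<in>nb i. E)"
      using nb(2) fibre by (intro sum_mono) blast
    also have "\<dots> = (\<Sum>i\<in>supp j. card (nb i) * E)" by simp
    also have "\<dots> \<le> (\<Sum>i\<in>supp j. D * E)"
      using nb(3) supp(1)[OF j] E by (intro sum_mono mult_right_mono) auto
    also have "\<dots> \<le> r * (D * E)"
      using supp(2)[OF j] D_nonneg E by (simp add: mult_right_mono)
    finally show ?thesis .
  qed
  have ES: "expectation (\<lambda>w. \<Sum>j\<in>J. Y j w) = (\<Sum>j\<in>J. \<mu> j)"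
    using Yi by (simp add: \<mu>_def)
  have "expectation (\<lambda>w. ((\<Sum>j\<in>J. Y j w) - expectation (\<lambda>w. \<Sum>j\<in>J. Y j w))\<^sup>2)
    = expectation (\<lambda>w. \<Sum>j\<in>J. \<Sum>j'\<in>J. (Y j w - \<mu> j) * (Y j' w - \<mu> j'))"
    by (simp add: ES power2_eq_square sum_subtractf[symmetric] sum_product)
  also have "\<dots> = (\<Sum>j\<in>J. \<Sum>j'\<in>J. expectation (\<lambda>w. (Y j w - \<mu> j) * (Y j' w - \<mu> j')))"
  proof -
    have "integrable M (\<lambda>w. (Y j w - \<mu> j) * (Y j' w - \<mu> j'))" if "j \<in> J" "j' \<in> J" for j j'
      using Yi YYi that by (simp add: left_diff_distrib right_diff_distrib)
    then show ?thesis by simp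
  qed
  also have "\<dots> \<le> (\<Sum>j\<in>J. \<Sum>j'\<in>J. if j' \<in> rel j then 2 * c\<^sup>2 else 0)"
    by (intro sum_mono) (use cov0 covb in auto)
  also have "\<dots> = (\<Sum>j\<in>J. card (rel j) * (2 * c\<^sup>2))"
  proof (intro sum.cong refl)
    fix j
    have "J \<inter> rel j = rel j" by (auto simp: rel_def)
    then show "(\<Sum>j'\<in>J. if j' \<in> rel j then 2 * c\<^sup>2 else 0) = card (rel j) * (2 * c\<^sup>2)"
      using J by (simp add: sum.If_cases)
  qed
  also have "\<dots> \<le> (\<Sum>j\<in>J. (r * (D * E)) * (2 * c\<^sup>2))"
    by (intro sum_mono mult_right_mono card_rel) auto
  finally show ?thesis by (simp add: algebra_simps)
qed

text \<open>The terms are indexed by at most |I| D ordered edges. Each uses r = 2 vertices, and a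
  vertex lies on at most E = 2 D of them, as first or as second end. The product |I| D^3 is the
  numerator of the variance condition.\<close>

lemma pair_sum_variance_bound:
  fixes f :: "'i \<Rightarrow> 'i \<Rightarrow> 'b \<Rightarrow> 'b \<Rightarrow> real"
  assumes f: "\<And>n m. (\<lambda>z. f n m (fst z) (snd z)) \<in> borel_measurable (borel \<Otimes>\<^sub>M borel)" "\<And>n m a b. \<bar>f n m a b\<bar> \<le> c"
  defines "T \<equiv> \<lambda>w. \<Sum>n\<in>I. \<Sum>m\<in>nb n. f n m (d n w) (d m w)"
  shows "expectation (\<lambda>w. (T w - expectation T)\<^sup>2) \<le> 8 * c\<^sup>2 * (card I * D ^ 3)"
proof -
  note D0 = D_nonneg
  define J where "J = Sigma I nb"
  define F where "F j z = f (fst j) (snd j) (z (fst j)) (z (snd j))" for j :: "'i \<times> 'i" and z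
  define supp where "supp j = {fst j, snd j}" for j :: "'i \<times> 'i"
  have fJ: "finite J" unfolding J_def using finI nb by auto
  have "real (card J) = (\<Sum>n\<in>I. real (card (nb n)))" unfolding J_def by (subst card_SigmaI) (use finI nb in auto)
  also have "\<dots> \<le> (\<Sum>n\<in>I. D)" by (intro sum_mono nb)
  finally have cJ: "real (card J) \<le> card I * D" by simp
  have fib: "real (card {j\<in>J. i \<in> supp j}) \<le> 2 * D" if "i \<in> I" for i
  proof -
    have "{j\<in>J. i \<in> supp j} \<subseteq> Pair i ` nb i \<union> (\<lambda>m. (m, i)) ` nb i"
      by (auto simp: J_def supp_def nb_def adj_sym)
    then have "card {j\<in>J. i \<in> supp j} \<le> card (Pair i ` nb i \<union> (\<lambda>m. (m, i)) ` nb i)"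
      by (intro card_mono) (use nb in auto)
    also have "\<dots> \<le> card (Pair i ` nb i) + card ((\<lambda>m. (m, i)) ` nb i)" by (rule card_Un_le)
    also have "\<dots> \<le> card (nb i) + card (nb i)" by (intro add_mono card_image_le nb)
    finally show ?thesis using nb(3)[OF that] by linarith
  qed
  have T: "T w = (\<Sum>j\<in>J. F j (\<lambda>n\<in>supp j. d n w))" for w
    unfolding T_def J_def using finI nb
    by (subst sum.Sigma) (auto intro!: sum.cong simp: F_def supp_def)
  have "expectation (\<lambda>w. (T w - expectation T)\<^sup>2) \<le> 2 * c\<^sup>2 * (card J * (real 2 * (D * (2 * D))))"
    unfolding T[abs_def]
  proof (rule sum_variance_bound[OF fJ])
    fix j assume "j \<in> J"
    then show "supp j \<subseteq> I" by (auto simp: supp_def J_def nb_def)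
    show "card (supp j) \<le> 2" by (auto simp: supp_def card_insert_if)
    have "(\<lambda>z. (z (fst j), z (snd j))) \<in> measurable (\<Pi>\<^sub>M n\<in>supp j. borel) (borel \<Otimes>\<^sub>M borel :: ('b \<times> 'b) measure)"
      by (intro measurable_Pair measurable_component_singleton) (auto simp: supp_def)
    from measurable_compose[OF this f(1)]
    show "F j \<in> borel_measurable (\<Pi>\<^sub>M n\<in>supp j. borel)" unfolding F_def by simp
    show "\<bar>F j z\<bar> \<le> c" for z unfolding F_def by (rule f)
  qed (use fib D0 in auto)
  also have "\<dots> \<le> 2 * c\<^sup>2 * ((card I * D) * (real 2 * (D * (2 * D))))"
    using cJ D0 by (intro mult_left_mono mult_right_mono) auto
  also have "\<dots> = 8 * c\<^sup>2 * (card I * D ^ 3)" by (simp add: power3_eq_cube)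
  finally show ?thesis .
qed

lemma single_sum_variance_bound:
  fixes f :: "'i \<Rightarrow> 'b \<Rightarrow> real"
  assumes f: "\<And>n. f n \<in> borel_measurable borel" "\<And>n a. \<bar>f n a\<bar> \<le> c"
  defines "T \<equiv> \<lambda>w. \<Sum>n\<in>I. f n (d n w)"
  shows "expectation (\<lambda>w. (T w - expectation T)\<^sup>2) \<le> 2 * c\<^sup>2 * (card I * D)"
proof -
  have T: "T w = (\<Sum>j\<in>I. (\<lambda>z. f j (z j)) (\<lambda>n\<in>{j}. d n w))" for w by (simp add: T_def)
  have "{j \<in> I. i \<in> {j}} = {i}" if "i \<in> I" for i using that by auto
  then have "expectation (\<lambda>w. (T w - expectation T)\<^sup>2) \<le> 2 * c\<^sup>2 * (card I * (real 1 * (D * 1)))"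
    unfolding T[abs_def]
    by (intro sum_variance_bound[OF finI]) (use f in \<open>auto intro: measurable_compose[OF measurable_component_singleton]\<close>)
  then show ?thesis by simp
qed

end


section \<open>A central limit theorem for dependency graphs\<close>

locale dependent_sum = dependency_graph M I adj d D
  for M :: "'a measure" and I :: "'i set" and adj and d :: "'i \<Rightarrow> 'a \<Rightarrow> 'b::second_countable_topology" and D +
  fixes h :: "'i \<Rightarrow> 'b \<Rightarrow> real" and A :: real
  assumes h_meas: "\<And>n. h n \<in> borel_measurable borel"
    and h_bounded: "\<And>n z. \<bar>h n z\<bar> \<le> A"
    and mean_zero: "\<And>n. n \<in> I \<Longrightarrow> expectation (\<lambda>w. h n (d n w)) = 0"
    and variance_one: "expectation (\<lambda>w. (\<Sum>n\<in>I. h n (d n w))\<^sup>2) = 1"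
begin

definition X :: "'i \<Rightarrow> 'a \<Rightarrow> real" where "X n w = h n (d n w)"
definition W :: "'a \<Rightarrow> real" where "W w = (\<Sum>n\<in>I. X n w)"
definition S :: "'i \<Rightarrow> 'a \<Rightarrow> real" where "S n w = (\<Sum>m\<in>nb n. X m w)"
text \<open>Expanding f(W - S n) at W and weighting by X n produces, up to sign, \<open>T2\<close>
  in front of f'(W) and \<open>T3\<close> in front of f''(W)/2.\<close>

definition T2 :: "'a \<Rightarrow> real" where "T2 w = (\<Sum>n\<in>I. X n w * S n w)"
definition T3 :: "'a \<Rightarrow> real" where "T3 w = (\<Sum>n\<in>I. X n w * (S n w)\<^sup>2)"
definition \<kappa> :: real where "\<kappa> = expectation T3"
text \<open>The common order of the variance of \<open>T2\<close> and of the fourth-order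
  remainder.\<close>

definition \<epsilon> :: real where "\<epsilon> = card I * D ^ 3 * A ^ 4"

lemma A_nonneg: "0 \<le> A"
  using h_bounded abs_ge_zero order_trans by blast

lemma eps_nonneg: "0 \<le> \<epsilon>"
  using D_nonneg by (simp add: \<epsilon>_def)

lemma X_meas: "n \<in> I \<Longrightarrow> X n \<in> borel_measurable M"
  unfolding X_def[abs_def] by (rule measurable_compose[OF d_meas h_meas])

lemma X_bounded: "\<bar>X n w\<bar> \<le> A"
  unfolding X_def by (rule h_bounded)

lemma sum_X_bounded: "\<bar>\<Sum>n\<in>K. X n w\<bar> \<le> card K * A"
  using sum_norm_bound[of K "\<lambda>n. X n w" A] X_bounded by simp

lemma S_bounded:
  assumes "n \<in> I" shows "\<bar>S n w\<bar> \<le> D * A"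
proof -
  have "\<bar>S n w\<bar> \<le> card (nb n) * A" unfolding S_def by (rule sum_X_bounded)
  also have "\<dots> \<le> D * A" by (intro mult_right_mono nb assms A_nonneg)
  finally show ?thesis .
qed

lemma S_meas: "S n \<in> borel_measurable M"
  unfolding S_def[abs_def] by (intro borel_measurable_sum X_meas) (auto simp: nb_def)

lemma W_meas [measurable]: "W \<in> borel_measurable M"
  unfolding W_def[abs_def] by (intro borel_measurable_sum X_meas)

lemma W_bounded: "\<bar>W w\<bar> \<le> card I * A"
  unfolding W_def by (rule sum_X_bounded)

lemma W_integrable: "integrable M W"
  by (rule bounded_integrable[OF W_meas W_bounded])

lemma W_square_integrable: "integrable M (\<lambda>w. (W w)\<^sup>2)"
  by (rule bounded_integrable[of _ "(card I * A)\<^sup>2"]) (use power_mono[OF W_bounded abs_ge_zero, of _ 2] in auto)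

lemma expectation_W: "expectation W = 0"
proof -
  have "expectation W = (\<Sum>n\<in>I. expectation (X n))"
    unfolding W_def[abs_def] by (intro Bochner_Integration.integral_sum bounded_integrable[where c = A] X_meas X_bounded)
  then show ?thesis using mean_zero by (simp add: X_def[abs_def])
qed

lemma expectation_W_sq: "expectation (\<lambda>w. (W w)\<^sup>2) = 1"
  using variance_one by (simp add: W_def X_def)

lemma expectation_abs_W: "expectation (\<lambda>w. \<bar>W w\<bar>) \<le> 1"
  using expectation_abs_le_sqrt[OF W_meas W_bounded] expectation_W_sq by simp

lemma XX_integrable: "n \<in> I \<Longrightarrow> m \<in> I \<Longrightarrow> integrable M (\<lambda>w. X n w * X m w)"
  by (rule bounded_integrable[of _ "A * A"])
    (auto simp: abs_mult intro!: mult_mono X_bounded X_meas A_nonneg borel_measurable_times)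

lemma expectation_XX: 
  assumes "n \<in> I" "m \<in> I" "\<not> adj n m"
  shows "expectation (\<lambda>w. X n w * X m w) = 0"
proof -
  \<comment> \<open>Each factor is written as a function of a restricted family, the form that
    \<open>expectation_mult_indep\<close> matches.\<close>
  have "expectation (\<lambda>w. (\<lambda>z. h n (z n)) (\<lambda>n\<in>{n}. d n w) * (\<lambda>z. h m (z m)) (\<lambda>n\<in>{m}. d n w))
    = expectation (\<lambda>w. (\<lambda>z. h n (z n)) (\<lambda>n\<in>{n}. d n w)) * expectation (\<lambda>w. (\<lambda>z. h m (z m)) (\<lambda>n\<in>{m}. d n w))"
    by (rule expectation_mult_indep[where a = A and b = A])
       (use assms h_bounded in \<open>auto intro!: measurable_compose[OF _ h_meas] measurable_component_singleton\<close>)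
  then show ?thesis using mean_zero assms by (simp add: X_def)
qed

lemma T2_eq: "T2 w = (\<Sum>n\<in>I. \<Sum>m\<in>nb n. X n w * X m w)"
  by (simp add: T2_def S_def sum_distrib_left)

text \<open>Non-neighbours are uncorrelated, so discarding them from the double sum for W^2 does not
  change its mean.\<close>

lemma expectation_T2: "expectation T2 = 1"
proof -
  have nbI: "nb n \<subseteq> I" for n by (rule nb)
  have "expectation T2 = (\<Sum>n\<in>I. \<Sum>m\<in>nb n. expectation (\<lambda>w. X n w * X m w))"
    unfolding T2_eq[abs_def] using XX_integrable nbI
    by (subst Bochner_Integration.integral_sum; force intro!: sum.cong Bochner_Integration.integral_sum Bochner_Integration.integrable_sum)
  also have "\<dots> = (\<Sum>n\<in>I. \<Sum>m\<in>I. expectation (\<lambda>w. X n w * X m w))"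
    by (intro sum.cong refl sum.mono_neutral_left finI nbI ballI expectation_XX) (auto simp: nb_def)
  also have "\<dots> = expectation (\<lambda>w. \<Sum>n\<in>I. \<Sum>m\<in>I. X n w * X m w)"
    using XX_integrable by simp
  also have "\<dots> = expectation (\<lambda>w. (W w)\<^sup>2)" by (simp add: W_def power2_eq_square sum_product)
  finally show ?thesis by (simp add: expectation_W_sq)
qed

lemma T2_meas [measurable]: "T2 \<in> borel_measurable M"
  unfolding T2_def[abs_def] by (intro borel_measurable_sum borel_measurable_times X_meas S_meas)

lemma T2_bounded: "\<bar>T2 w\<bar> \<le> card I * (A * (D * A))"
proof -
  have "\<bar>T2 w\<bar> \<le> (\<Sum>n\<in>I. \<bar>X n w * S n w\<bar>)" unfolding T2_def by (rule sum_abs)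
  also have "\<dots> \<le> (\<Sum>n\<in>I. A * (D * A))"
    unfolding abs_mult by (intro sum_mono mult_mono X_bounded S_bounded) (auto simp: A_nonneg)
  finally show ?thesis by simp
qed

lemma T2_deviation: "expectation (\<lambda>w. \<bar>T2 w - 1\<bar>) \<le> 3 * sqrt \<epsilon>"
proof -
  have "expectation (\<lambda>w. (T2 w - expectation T2)\<^sup>2) \<le> 8 * (A * A)\<^sup>2 * (card I * D ^ 3)"
    unfolding T2_eq[abs_def] X_def
    by (rule pair_sum_variance_bound[of "\<lambda>n m a b. h n a * h m b"])
       (auto intro!: borel_measurable_times measurable_compose[OF _ h_meas] mult_mono h_bounded simp: abs_mult A_nonneg)
  also have "\<dots> = 8 * \<epsilon>" by (simp add: \<epsilon>_def power2_eq_square eval_nat_numeral)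
  \<comment> \<open>Rounded up to a perfect square.\<close>
  also have "\<dots> \<le> 9 * \<epsilon>" using eps_nonneg by simp
  finally have "expectation (\<lambda>w. (T2 w - 1)\<^sup>2) \<le> (3 * sqrt \<epsilon>)\<^sup>2"
    using eps_nonneg by (simp add: expectation_T2 power_mult_distrib)
  then have "sqrt (expectation (\<lambda>w. (T2 w - 1)\<^sup>2)) \<le> 3 * sqrt \<epsilon>"
    by (rule real_le_lsqrt[rotated]) (use eps_nonneg in simp)
  moreover have "\<bar>T2 w - 1\<bar> \<le> card I * (A * (D * A)) + 1" for w using T2_bounded[of w] by linarith
  ultimately show ?thesis using expectation_abs_le_sqrt[of "\<lambda>w. T2 w - 1"] by fastforce
qed

lemma T3_eq: "T3 w = (\<Sum>n\<in>I. \<Sum>m\<in>nb n. \<Sum>l\<in>nb n. X n w * X m w * X l w)"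
  unfolding T3_def S_def power2_eq_square sum_product by (simp add: sum_distrib_left mult.assoc)

lemma XXX_bounded: "\<bar>X n w * X m w * X l w\<bar> \<le> A ^ 3"
  unfolding abs_mult power3_eq_cube by (intro mult_mono X_bounded) (auto simp: A_nonneg)

text \<open>Deleting the neighbourhoods of the three indices from \<open>W\<close> costs \<open>O(D A)\<close> and makes the
  product independent of the rest.\<close>

lemma triple_decoupling:
  assumes n: "n \<in> I" "m \<in> I" "l \<in> I"
    and g: "g \<in> borel_measurable borel" "\<And>x. \<bar>g x\<bar> \<le> B" "\<And>x y. \<bar>g x - g y\<bar> \<le> B * \<bar>x - y\<bar>"
  shows "\<bar>expectation (\<lambda>w. X n w * X m w * X l w * g (W w))
      - expectation (\<lambda>w. X n w * X m w * X l w) * expectation (\<lambda>w. g (W w))\<bar> \<le> 6 * D * A ^ 4 * B"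
proof -
  define K where "K = {n, m, l}"
  define R where "R = {i\<in>I. \<forall>k\<in>K. \<not> adj k i}"
  define V where "V w = (\<Sum>i\<in>R. X i w)" for w
  define Y where "Y w = X n w * X m w * X l w" for w
  have KI: "K \<subseteq> I" "R \<subseteq> I" using n by (auto simp: K_def R_def)
  have B0: "0 \<le> B" using g(2)[of 0] abs_ge_zero order_trans by blast
  note [measurable] = g(1)
  have Ym[measurable]: "Y \<in> borel_measurable M" unfolding Y_def[abs_def] using n by (intro borel_measurable_times X_meas)
  have Yb: "\<bar>Y w\<bar> \<le> A ^ 3" for w unfolding Y_def by (rule XXX_bounded)
  have Vm[measurable]: "V \<in> borel_measurable M" unfolding V_def[abs_def] using KI by (intro borel_measurable_sum X_meas) auto
  have diff: "\<bar>W w - V w\<bar> \<le> 3 * D * A" for w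
  proof -
    have "W w - V w = (\<Sum>i\<in>I - R. X i w)"
      unfolding W_def V_def by (rule sum_diff[OF finI KI(2), symmetric])
    then have "\<bar>W w - V w\<bar> \<le> card (I - R) * A" using sum_X_bounded[where K = "I - R"] by simp
    moreover have "card (I - R) \<le> card (nb n \<union> (nb m \<union> nb l))"
      by (intro card_mono) (auto simp: nb_def R_def K_def finI)
    moreover have "card (nb n \<union> (nb m \<union> nb l)) \<le> card (nb n) + (card (nb m) + card (nb l))"
      by (meson card_Un_le add_left_mono order_trans)
    moreover have "real (card (nb n)) \<le> D" "real (card (nb m)) \<le> D" "real (card (nb l)) \<le> D"
      using n nb(3) by auto
    ultimately have "real (card (I - R)) \<le> 3 * D" by linarith
    then show ?thesis using \<open>\<bar>W w - V w\<bar> \<le> card (I - R) * A\<close> A_nonneg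
      by (meson mult_right_mono order_trans)
  qed
  have gd: "\<bar>g (W w) - g (V w)\<bar> \<le> B * (3 * D * A)" for w
    using g(3)[of "W w" "V w"] mult_left_mono[OF diff[of w] B0] by linarith
  have ind: "expectation (\<lambda>w. Y w * g (V w)) = expectation Y * expectation (\<lambda>w. g (V w))"
  proof -
    have "expectation (\<lambda>w. (\<lambda>z. h n (z n) * h m (z m) * h l (z l)) (\<lambda>n\<in>K. d n w) * (\<lambda>z. g (\<Sum>i\<in>R. h i (z i))) (\<lambda>n\<in>R. d n w))
      = expectation (\<lambda>w. (\<lambda>z. h n (z n) * h m (z m) * h l (z l)) (\<lambda>n\<in>K. d n w)) * expectation (\<lambda>w. (\<lambda>z. g (\<Sum>i\<in>R. h i (z i))) (\<lambda>n\<in>R. d n w))"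
    proof (rule expectation_mult_indep[where a = "A ^ 3" and b = B])
      show "(\<lambda>z. h n (z n) * h m (z m) * h l (z l)) \<in> borel_measurable (\<Pi>\<^sub>M n\<in>K. borel)"
        by (intro borel_measurable_times measurable_compose[OF _ h_meas] measurable_component_singleton) (auto simp: K_def)
      show "(\<lambda>z. g (\<Sum>i\<in>R. h i (z i))) \<in> borel_measurable (\<Pi>\<^sub>M n\<in>R. borel)"
        by (intro measurable_compose[OF _ g(1)] borel_measurable_sum measurable_compose[OF _ h_meas] measurable_component_singleton)
      show "\<bar>h n (z n) * h m (z m) * h l (z l)\<bar> \<le> A ^ 3" for z
        unfolding abs_mult power3_eq_cube by (intro mult_mono h_bounded) (auto simp: A_nonneg)
    qed (use KI g in \<open>auto simp: R_def\<close>)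
    then show ?thesis by (simp add: Y_def[abs_def] V_def[abs_def] X_def K_def)
  qed
  have YgW: "integrable M (\<lambda>w. Y w * g (W w))" and YgV: "integrable M (\<lambda>w. Y w * g (V w))"
    by (rule bounded_integrable[of _ "A ^ 3 * B"]; auto simp: abs_mult intro!: mult_mono Yb g A_nonneg)+
  have gW: "integrable M (\<lambda>w. g (W w))" and gV: "integrable M (\<lambda>w. g (V w))"
    by (rule bounded_integrable[of _ B]; auto intro: g)+
  \<comment> \<open>Y and g(V) are uncorrelated, so only g(W) - g(V) contributes to the covariance:
    two terms, each at most A^3 times B times 3 D A.\<close>
  have "expectation (\<lambda>w. Y w * g (W w)) - expectation Y * expectation (\<lambda>w. g (W w))
    = expectation (\<lambda>w. Y w * (g (W w) - g (V w))) - expectation Y * expectation (\<lambda>w. g (W w) - g (V w))"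
    using YgW YgV gW gV ind by (simp add: right_diff_distrib)
  moreover have "\<bar>expectation (\<lambda>w. Y w * (g (W w) - g (V w)))\<bar> \<le> A ^ 3 * (B * (3 * D * A))"
    by (rule abs_expectation_le) (auto simp: abs_mult intro!: mult_mono Yb gd A_nonneg)
  moreover have "\<bar>expectation Y * expectation (\<lambda>w. g (W w) - g (V w))\<bar> \<le> A ^ 3 * (B * (3 * D * A))"
    unfolding abs_mult by (intro mult_mono abs_expectation_le Yb gd) (auto simp: A_nonneg)
  ultimately have "\<bar>expectation (\<lambda>w. Y w * g (W w)) - expectation Y * expectation (\<lambda>w. g (W w))\<bar> \<le> 2 * (A ^ 3 * (B * (3 * D * A)))"
    by linarith
  also have "\<dots> = 6 * D * A ^ 4 * B" by (simp add: eval_nat_numeral)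
  finally show ?thesis by (simp add: Y_def[abs_def])
qed

text \<open>\<open>T3\<close> is not shown to concentrate; only its covariance with g(W) is bounded.
  There are at most |I| D^2 triples, each contributing 6 D A^4 B, so the total is of order
  \<open>\<epsilon>\<close>.\<close>

lemma T3_decoupling:
  assumes g: "g \<in> borel_measurable borel" "\<And>x. \<bar>g x\<bar> \<le> B" "\<And>x y. \<bar>g x - g y\<bar> \<le> B * \<bar>x - y\<bar>"
  shows "\<bar>expectation (\<lambda>w. T3 w * g (W w)) - \<kappa> * expectation (\<lambda>w. g (W w))\<bar> \<le> 6 * \<epsilon> * B"
proof -
  have B0: "0 \<le> B" using g(2)[of 0] abs_ge_zero order_trans by blast
  have nbI: "m \<in> I" if "m \<in> nb n" for m n using nb(2) that by blast
  note [measurable] = g(1)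
  have i1: "integrable M (\<lambda>w. X n w * X m w * X l w * g (W w))" if "n \<in> I" "m \<in> I" "l \<in> I" for n m l
    by (rule bounded_integrable[of _ "A ^ 3 * B"])
      (use that in \<open>auto simp: abs_mult[of "_ * _ * _"] intro!: mult_mono XXX_bounded g A_nonneg borel_measurable_times X_meas\<close>)
  have i2: "integrable M (\<lambda>w. X n w * X m w * X l w)" if "n \<in> I" "m \<in> I" "l \<in> I" for n m l
    by (rule bounded_integrable[of _ "A ^ 3"])
      (use that in \<open>auto intro!: XXX_bounded borel_measurable_times X_meas\<close>)
  have dec: "\<bar>expectation (\<lambda>w. X n w * X m w * X l w * g (W w))
        - expectation (\<lambda>w. X n w * X m w * X l w) * expectation (\<lambda>w. g (W w))\<bar> \<le> 6 * D * A ^ 4 * B"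
    if "n \<in> I" "m \<in> nb n" "l \<in> nb n" for n m l
    by (rule triple_decoupling[OF that(1) nbI[OF that(2)] nbI[OF that(3)] g])
  have "expectation (\<lambda>w. T3 w * g (W w)) = (\<Sum>n\<in>I. \<Sum>m\<in>nb n. \<Sum>l\<in>nb n. expectation (\<lambda>w. X n w * X m w * X l w * g (W w)))"
    unfolding T3_eq sum_distrib_right using i1 nbI
    by (simp add: Bochner_Integration.integral_sum Bochner_Integration.integrable_sum)
  moreover have "\<kappa> = (\<Sum>n\<in>I. \<Sum>m\<in>nb n. \<Sum>l\<in>nb n. expectation (\<lambda>w. X n w * X m w * X l w))"
    unfolding \<kappa>_def T3_eq[abs_def] using i2 nbI
    by (simp add: Bochner_Integration.integral_sum Bochner_Integration.integrable_sum)
  ultimately have "expectation (\<lambda>w. T3 w * g (W w)) - \<kappa> * expectation (\<lambda>w. g (W w))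
    = (\<Sum>n\<in>I. \<Sum>m\<in>nb n. \<Sum>l\<in>nb n. expectation (\<lambda>w. X n w * X m w * X l w * g (W w))
        - expectation (\<lambda>w. X n w * X m w * X l w) * expectation (\<lambda>w. g (W w)))" (is "?l = ?r")
    by (simp add: sum_distrib_right sum_subtractf)
  then have "\<bar>?l\<bar> = \<bar>?r\<bar>" by (rule arg_cong)
  also have "\<dots> \<le> (\<Sum>n\<in>I. \<Sum>m\<in>nb n. \<Sum>l\<in>nb n. 6 * D * A ^ 4 * B)"
    by (rule order_trans[OF sum_abs], rule sum_mono)+ (rule dec)
  also have "\<dots> = (\<Sum>n\<in>I. (real (card (nb n)))\<^sup>2 * (6 * D * A ^ 4 * B))"
    by (simp add: power2_eq_square mult.assoc)
  also have "\<dots> \<le> (\<Sum>n\<in>I. D\<^sup>2 * (6 * D * A ^ 4 * B))"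
    by (intro sum_mono mult_right_mono power_mono nb) (use D_nonneg A_nonneg B0 in auto)
  also have "\<dots> = 6 * \<epsilon> * B" by (simp add: \<epsilon>_def power2_eq_square power3_eq_cube)
  finally show ?thesis .
qed

lemma T3_meas: "T3 \<in> borel_measurable M"
  unfolding T3_def[abs_def] by (intro borel_measurable_sum borel_measurable_times borel_measurable_power X_meas S_meas)

lemma T3_bounded: "\<bar>T3 w\<bar> \<le> card I * (A * (D * A)\<^sup>2)"
proof -
  have "\<bar>T3 w\<bar> \<le> (\<Sum>n\<in>I. \<bar>X n w * (S n w)\<^sup>2\<bar>)" unfolding T3_def by (rule sum_abs)
  also have "\<dots> \<le> (\<Sum>n\<in>I. A * (D * A)\<^sup>2)"
    unfolding abs_mult power_abs by (intro sum_mono mult_mono power_mono X_bounded S_bounded) (auto simp: A_nonneg)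
  finally show ?thesis by simp
qed

text \<open>Only the order of the remainder matters, so the factor 1/6 is dropped. The case s = 0 is
  apart because \<open>Taylor\<close> needs two distinct points.\<close>

lemma third_order_taylor:
  fixes f f1 f2 f3 :: "real \<Rightarrow> real"
  assumes d: "\<And>x. (f has_real_derivative f1 x) (at x)" "\<And>x. (f1 has_real_derivative f2 x) (at x)"
    "\<And>x. (f2 has_real_derivative f3 x) (at x)" and b: "\<And>x. \<bar>f3 x\<bar> \<le> B"
  shows "\<bar>f (w - s) - (f w - s * f1 w + s\<^sup>2 / 2 * f2 w)\<bar> \<le> B * \<bar>s\<bar> ^ 3"
proof (cases "s = 0")
  case False
  define diff where "diff m = (if m = 0 then f else if m = 1 then f1 else if m = 2 then f2 else f3)" for m :: nat
  have "\<exists>t. (if w - s < w then w - s < t \<and> t < w else w < t \<and> t < w - s) \<and>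
      f (w - s) = (\<Sum>m<3. diff m w / fact m * (w - s - w) ^ m) + diff 3 t / fact 3 * (w - s - w) ^ 3"
  proof (rule Taylor[where a = "min w (w - s)" and b = "max w (w - s)"])
    show "\<forall>m t. m < 3 \<and> min w (w - s) \<le> t \<and> t \<le> max w (w - s) \<longrightarrow> (diff m has_real_derivative diff (Suc m) t) (at t)"
      using d by (auto simp: diff_def less_Suc_eq numeral_3_eq_3)
  qed (use False in \<open>auto simp: diff_def\<close>)
  then obtain t where "f (w - s) = (\<Sum>m<3. diff m w / fact m * (- s) ^ m) + f3 t / fact 3 * (- s) ^ 3"
    by (auto simp: diff_def)
  then have "f (w - s) - (f w - s * f1 w + s\<^sup>2 / 2 * f2 w) = f3 t / 6 * (- s) ^ 3"
    by (simp add: diff_def eval_nat_numeral)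
  then have "\<bar>f (w - s) - (f w - s * f1 w + s\<^sup>2 / 2 * f2 w)\<bar> = \<bar>f3 t\<bar> * \<bar>s\<bar> ^ 3 / 6"
    by (simp add: abs_mult power_abs)
  also have "\<dots> \<le> B * \<bar>s\<bar> ^ 3 / 6" by (intro divide_right_mono mult_right_mono b) auto
  also have "\<dots> \<le> B * \<bar>s\<bar> ^ 3" using order_trans[OF abs_ge_zero b[of 0]] by simp
  finally show ?thesis .
qed simp

text \<open>The third cumulant \<open>\<kappa>\<close> is retained, because the variance condition controls only the error
  terms of fourth order.\<close>

lemma stein_identity:
  fixes f f1 f2 f3 :: "real \<Rightarrow> real"
  assumes d: "\<And>x. (f has_real_derivative f1 x) (at x)" "\<And>x. (f1 has_real_derivative f2 x) (at x)"
    "\<And>x. (f2 has_real_derivative f3 x) (at x)"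
    and b: "\<And>x. \<bar>f x\<bar> \<le> B" "\<And>x. \<bar>f1 x\<bar> \<le> B" "\<And>x. \<bar>f2 x\<bar> \<le> B" "\<And>x. \<bar>f3 x\<bar> \<le> B"
  shows "\<bar>expectation (\<lambda>w. W w * f (W w)) - expectation (\<lambda>w. f1 (W w)) + \<kappa> / 2 * expectation (\<lambda>w. f2 (W w))\<bar>
    \<le> B * (3 * sqrt \<epsilon> + 4 * \<epsilon>)"
proof -
  have cont: "continuous_on UNIV f" "continuous_on UNIV f1" "continuous_on UNIV f2"
    by (rule DERIV_continuous_on, rule d)+
  have m[measurable]: "f \<in> borel_measurable borel" "f1 \<in> borel_measurable borel" "f2 \<in> borel_measurable borel"
    using cont by (auto intro: borel_measurable_continuous_onI)
  note [measurable] = T3_meas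
  have B0: "0 \<le> B" using b(1)[of 0] by linarith
  have lip: "\<bar>f2 x - f2 y\<bar> \<le> B * \<bar>x - y\<bar>" for x y
    using field_differentiable_bound[of UNIV f2 f3 B x y] d(3) b(4) by auto
  define V where "V n w = (\<Sum>m\<in>I - nb n. X m w)" for n w
  have V: "V n w = W w - S n w" for n w
    unfolding V_def W_def S_def by (rule sum_diff[OF finI nb(2)])
  have Vm[measurable]: "V n \<in> borel_measurable M" for n
    unfolding V_def[abs_def] by (intro borel_measurable_sum X_meas) auto
  \<comment> \<open>X n has mean zero, and \<open>V n\<close> omits every neighbour of n.\<close>
  have ind: "expectation (\<lambda>w. X n w * f (V n w)) = 0" if n: "n \<in> I" for n
  proof -
    have "expectation (\<lambda>w. (\<lambda>z. h n (z n)) (\<lambda>n\<in>{n}. d n w) * (\<lambda>z. f (\<Sum>m\<in>I - nb n. h m (z m))) (\<lambda>n\<in>I - nb n. d n w))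
      = expectation (\<lambda>w. (\<lambda>z. h n (z n)) (\<lambda>n\<in>{n}. d n w)) * expectation (\<lambda>w. (\<lambda>z. f (\<Sum>m\<in>I - nb n. h m (z m))) (\<lambda>n\<in>I - nb n. d n w))"
    proof (rule expectation_mult_indep[where a = A and b = B])
      show "(\<lambda>z. h n (z n)) \<in> borel_measurable (\<Pi>\<^sub>M n\<in>{n}. borel)"
        by (intro measurable_compose[OF _ h_meas] measurable_component_singleton) auto
      show "(\<lambda>z. f (\<Sum>m\<in>I - nb n. h m (z m))) \<in> borel_measurable (\<Pi>\<^sub>M n\<in>I - nb n. borel)"
        by (intro measurable_compose[OF _ m(1)] borel_measurable_sum measurable_compose[OF _ h_meas] measurable_component_singleton)
    qed (use n b h_bounded in \<open>auto simp: nb_def\<close>)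
    then show ?thesis using mean_zero[OF n] by (simp add: X_def V_def[abs_def])
  qed
  \<comment> \<open>The sum of the Taylor remainders. Taking expectations removes the sum over
    \<open>V n\<close> by \<open>ind\<close>; it then remains to replace \<open>T2\<close> by its
    mean and to decouple \<open>T3\<close> from W.\<close>
  define r where "r w = W w * f (W w) - (\<Sum>n\<in>I. X n w * f (V n w)) - T2 w * f1 (W w) + T3 w / 2 * f2 (W w)" for w
  have r: "\<bar>r w\<bar> \<le> \<epsilon> * B" for w
  proof -
    have "r w = (\<Sum>n\<in>I. - X n w * (f (W w - S n w) - (f (W w) - S n w * f1 (W w) + (S n w)\<^sup>2 / 2 * f2 (W w))))" (is "_ = ?r")
    proof -
      have 1: "W w * f (W w) = (\<Sum>n\<in>I. X n w * f (W w))"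
        unfolding sum_distrib_right[symmetric] by (simp add: W_def)
      have 2: "T2 w * f1 (W w) = (\<Sum>n\<in>I. X n w * S n w * f1 (W w))"
        unfolding sum_distrib_right[symmetric] by (simp add: T2_def)
      have 3: "T3 w / 2 * f2 (W w) = (\<Sum>n\<in>I. X n w * (S n w)\<^sup>2 / 2 * f2 (W w))"
        unfolding sum_distrib_right[symmetric] sum_divide_distrib[symmetric] by (simp add: T3_def)
      show ?thesis unfolding r_def 1 2 3 V sum_subtractf[symmetric] sum.distrib[symmetric]
        by (rule sum.cong) (simp_all add: algebra_simps)
    qed
    then have "\<bar>r w\<bar> = \<bar>?r\<bar>" by (rule arg_cong)
    also have "\<dots> \<le> (\<Sum>n\<in>I. A * (B * (D * A) ^ 3))"
    proof (rule order_trans[OF sum_abs], rule sum_mono)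
      fix n assume n: "n \<in> I"
      have "B * \<bar>S n w\<bar> ^ 3 \<le> B * (D * A) ^ 3"
        by (intro mult_left_mono power_mono S_bounded n B0) auto
      then have "\<bar>f (W w - S n w) - (f (W w) - S n w * f1 (W w) + (S n w)\<^sup>2 / 2 * f2 (W w))\<bar> \<le> B * (D * A) ^ 3"
        using third_order_taylor[OF d b(4), of "W w" "S n w"] by linarith
      then show "\<bar>- X n w * (f (W w - S n w) - (f (W w) - S n w * f1 (W w) + (S n w)\<^sup>2 / 2 * f2 (W w)))\<bar> \<le> A * (B * (D * A) ^ 3)"
        unfolding abs_mult abs_minus_cancel by (intro mult_mono X_bounded) (auto simp: A_nonneg)
    qed
    also have "\<dots> = \<epsilon> * B" by (simp add: \<epsilon>_def eval_nat_numeral)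
    finally show ?thesis .
  qed
  have iW: "integrable M (\<lambda>w. W w * f (W w))"
    by (rule bounded_integrable[of _ "card I * A * B"]) (auto simp: abs_mult intro!: mult_mono mult_nonneg_nonneg b W_bounded A_nonneg)
  have iV: "integrable M (\<lambda>w. X n w * f (V n w))" if "n \<in> I" for n
    by (rule bounded_integrable[of _ "A * B"]) (use X_meas[OF that] in \<open>auto simp: abs_mult intro!: mult_mono b X_bounded A_nonneg\<close>)
  have iT2: "integrable M (\<lambda>w. T2 w * f1 (W w))"
    by (rule bounded_integrable[of _ "card I * (A * (D * A)) * B"])
      (auto simp: abs_mult A_nonneg D_nonneg intro!: mult_mono b T2_bounded mult_nonneg_nonneg)
  have iT3: "integrable M (\<lambda>w. T3 w * f2 (W w))"
    by (rule bounded_integrable[of _ "card I * (A * (D * A)\<^sup>2) * B"])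
      (auto simp: abs_mult A_nonneg D_nonneg intro!: mult_mono b T3_bounded mult_nonneg_nonneg)
  have if1: "integrable M (\<lambda>w. f1 (W w))" by (rule bounded_integrable[of _ B]) (auto intro: b)
  have "expectation r = expectation (\<lambda>w. W w * f (W w)) - (\<Sum>n\<in>I. expectation (\<lambda>w. X n w * f (V n w)))
      - expectation (\<lambda>w. T2 w * f1 (W w)) + expectation (\<lambda>w. T3 w * f2 (W w)) / 2"
  proof -
    have "expectation r = expectation (\<lambda>w. W w * f (W w) - (\<Sum>n\<in>I. X n w * f (V n w)) - T2 w * f1 (W w) + (T3 w * f2 (W w)) / 2)"
      unfolding r_def[abs_def] by simp
    then show ?thesis using iW iV iT2 iT3 by simp
  qed
  then have Er: "expectation (\<lambda>w. W w * f (W w)) = expectation r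
      + expectation (\<lambda>w. T2 w * f1 (W w)) - expectation (\<lambda>w. T3 w * f2 (W w)) / 2"
    using ind by simp
  have "expectation (\<lambda>w. T2 w * f1 (W w)) - expectation (\<lambda>w. f1 (W w)) = expectation (\<lambda>w. (T2 w - 1) * f1 (W w))" (is "?l = ?r")
    using iT2 if1 by (simp add: left_diff_distrib)
  then have "\<bar>?l\<bar> = \<bar>?r\<bar>" by (rule arg_cong)
  also have "\<dots> \<le> expectation (\<lambda>w. \<bar>(T2 w - 1) * f1 (W w)\<bar>)" by (rule integral_abs_bound)
  also have "\<dots> \<le> expectation (\<lambda>w. \<bar>T2 w - 1\<bar> * B)"
  proof (rule integral_mono)
    have iT: "integrable M T2" by (rule bounded_integrable[OF T2_meas T2_bounded])
    show "integrable M (\<lambda>w. \<bar>(T2 w - 1) * f1 (W w)\<bar>)"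
      using iT2 if1 by (auto simp: left_diff_distrib)
    show "integrable M (\<lambda>w. \<bar>T2 w - 1\<bar> * B)" using iT by auto
  qed (auto simp: abs_mult intro!: mult_left_mono b)
  also have "\<dots> \<le> 3 * sqrt \<epsilon> * B" using mult_right_mono[OF T2_deviation B0] by simp
  finally have T2: "\<bar>expectation (\<lambda>w. T2 w * f1 (W w)) - expectation (\<lambda>w. f1 (W w))\<bar> \<le> 3 * sqrt \<epsilon> * B" .
  have T3: "\<bar>expectation (\<lambda>w. T3 w * f2 (W w)) - \<kappa> * expectation (\<lambda>w. f2 (W w))\<bar> \<le> 6 * \<epsilon> * B"
    by (rule T3_decoupling[OF m(3) b(3) lip])
  have Er': "\<bar>expectation r\<bar> \<le> \<epsilon> * B" by (rule abs_expectation_le[OF r])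
  have "expectation (\<lambda>w. W w * f (W w)) - expectation (\<lambda>w. f1 (W w)) + \<kappa> / 2 * expectation (\<lambda>w. f2 (W w))
     = expectation r + (expectation (\<lambda>w. T2 w * f1 (W w)) - expectation (\<lambda>w. f1 (W w)))
       - (expectation (\<lambda>w. T3 w * f2 (W w)) - \<kappa> * expectation (\<lambda>w. f2 (W w))) / 2"
    by (simp add: Er field_simps)
  \<comment> \<open>The contributions of the Taylor remainder, of \<open>T2\<close> and of
    \<open>T3\<close>, the last one halved.\<close>
  moreover have "B * (3 * sqrt \<epsilon> + 4 * \<epsilon>) = \<epsilon> * B + 3 * sqrt \<epsilon> * B + (6 * \<epsilon> * B) / 2"
    by (simp add: algebra_simps)
  moreover have "\<bar>r + t - s / 2\<bar> \<le> a + b + c / 2" if "\<bar>t\<bar> \<le> b" "\<bar>s\<bar> \<le> c" "\<bar>r\<bar> \<le> a" for r t s a b c :: real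
    using that by linarith
  note this[OF T2 T3 Er']
  ultimately show ?thesis by (simp only:)
qed

section \<open>Elimination of the third-order coefficient\<close>

definition \<rho> :: real where "\<rho> = 3 * sqrt \<epsilon> + 4 * \<epsilon>"

lemma rho_nonneg: "0 \<le> \<rho>"
  using eps_nonneg by (simp add: \<rho>_def)

text \<open>With the test function cos, the factor of \<open>\<kappa>\<close>/2 is -E cos W, and E
  cos W \<ge> 1/2 because cos t \<ge> 1 - t^2/2 and E W^2 = 1. This a priori bound decides where the
  bump of \<open>kappa_small\<close> is placed.\<close>

lemma kappa_bounded: "\<bar>\<kappa>\<bar> \<le> 8 + 4 * \<rho>"
proof -
  have "\<bar>expectation (\<lambda>w. W w * cos (W w)) - expectation (\<lambda>w. - sin (W w)) + \<kappa> / 2 * expectation (\<lambda>w. - cos (W w))\<bar>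
    \<le> 1 * (3 * sqrt \<epsilon> + 4 * \<epsilon>)"
    by (rule stein_identity[where ?f3.0 = sin]) (auto intro!: derivative_eq_intros)
  then have 1: "\<bar>expectation (\<lambda>w. W w * cos (W w)) + expectation (\<lambda>w. sin (W w)) - \<kappa> / 2 * expectation (\<lambda>w. cos (W w))\<bar> \<le> \<rho>"
    by (simp add: \<rho>_def)
  have "\<bar>expectation (\<lambda>w. W w * cos (W w))\<bar> \<le> expectation (\<lambda>w. \<bar>W w * cos (W w)\<bar>)" by (rule integral_abs_bound)
  also have "\<dots> \<le> expectation (\<lambda>w. \<bar>W w\<bar>)"
  proof (rule integral_mono)
    show "integrable M (\<lambda>w. \<bar>W w * cos (W w)\<bar>)"
      by (rule bounded_integrable[of _ "card I * A * 1"]) (auto simp: abs_mult simp del: mult_1_right intro!: mult_mono mult_nonneg_nonneg W_bounded A_nonneg)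
    show "integrable M (\<lambda>w. \<bar>W w\<bar>)" using W_integrable by auto
    show "\<bar>W w * cos (W w)\<bar> \<le> \<bar>W w\<bar>" for w
      unfolding abs_mult using mult_left_mono[OF abs_cos_le_one abs_ge_zero, of "W w" "W w"] by simp
  qed
  also have "\<dots> \<le> 1" by (rule expectation_abs_W)
  finally have 2: "\<bar>expectation (\<lambda>w. W w * cos (W w))\<bar> \<le> 1" .
  have 3: "\<bar>expectation (\<lambda>w. sin (W w))\<bar> \<le> 1" by (rule abs_expectation_le) simp
  have icos: "integrable M (\<lambda>w. cos (W w))" by (rule bounded_integrable[of _ 1]) auto
  have "1 - (W w)\<^sup>2 / 2 \<le> cos (W w)" for w
  proof -
    have "(sin (W w / 2))\<^sup>2 \<le> (W w / 2)\<^sup>2" using abs_sin_x_le_abs_x[of "W w / 2"] using power_mono[of "\<bar>sin (W w / 2)\<bar>" "\<bar>W w / 2\<bar>" 2] unfolding power2_abs by simp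
    moreover have "cos (W w) = 1 - 2 * (sin (W w / 2))\<^sup>2" using cos_double_sin[of "W w / 2"] by simp
    ultimately show ?thesis by (simp add: power2_eq_square)
  qed
  then have "expectation (\<lambda>w. 1 - (W w)\<^sup>2 / 2) \<le> expectation (\<lambda>w. cos (W w))"
    by (intro integral_mono icos) (use W_square_integrable in auto)
  then have 4: "1/2 \<le> expectation (\<lambda>w. cos (W w))"
    using W_square_integrable expectation_W_sq by (simp add: prob_space)
  have "\<bar>\<kappa>\<bar> / 2 * (1/2) \<le> \<bar>\<kappa>\<bar> / 2 * expectation (\<lambda>w. cos (W w))"
    by (intro mult_left_mono 4) simp
  also have "\<dots> = \<bar>\<kappa> / 2 * expectation (\<lambda>w. cos (W w))\<bar>" using 4 by (simp add: abs_mult)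
  also have "\<dots> \<le> 2 + \<rho>" using 1 2 3 by linarith
  finally show ?thesis by linarith
qed

text \<open>From exp t \<ge> 1 + t at t = y^2, and for the cubic bound from its square at t = y^2/2.
  They bound the derivatives of the bump in \<open>kappa_small\<close> uniformly in its
  centre.\<close>

lemma gaussian_bump_bounds:
  fixes y :: real
  shows "\<bar>y\<bar> * exp (- y\<^sup>2) \<le> 1" "y\<^sup>2 * exp (- y\<^sup>2) \<le> 1" "\<bar>y\<bar> ^ 3 * exp (- y\<^sup>2) \<le> 2"
proof -
  define e where "e = exp (- y\<^sup>2)"
  have e: "0 < e" "e \<le> 1" by (auto simp: e_def)
  have ee: "exp (y\<^sup>2) * e = 1" by (simp add: e_def exp_minus_inverse)
  have x1: "1 + y\<^sup>2 \<le> exp (y\<^sup>2)" by (rule exp_ge_add_one_self)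
  have "exp (y\<^sup>2) = exp (y\<^sup>2 / 2) * exp (y\<^sup>2 / 2)" by (simp add: exp_add[symmetric])
  moreover have "1 + y\<^sup>2 / 2 \<le> exp (y\<^sup>2 / 2)" by (rule exp_ge_add_one_self)
  ultimately have x2: "(1 + y\<^sup>2 / 2) * (1 + y\<^sup>2 / 2) \<le> exp (y\<^sup>2)"
    by (simp add: mult_mono)
  have "2 * \<bar>y\<bar> \<le> 1 + y\<^sup>2" using zero_le_power2[of "\<bar>y\<bar> - 1"] by (simp add: power2_eq_square algebra_simps)
  then have "\<bar>y\<bar> \<le> exp (y\<^sup>2)" using x1 by linarith
  then show "\<bar>y\<bar> * exp (- y\<^sup>2) \<le> 1" using mult_right_mono[of "\<bar>y\<bar>" "exp (y\<^sup>2)" e] ee e unfolding e_def by linarith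
  have "y\<^sup>2 \<le> exp (y\<^sup>2)" using x1 by linarith
  then show "y\<^sup>2 * exp (- y\<^sup>2) \<le> 1" using mult_right_mono[of "y\<^sup>2" "exp (y\<^sup>2)" e] ee e unfolding e_def by linarith
  have "\<bar>y\<bar> ^ 3 \<le> 2 * ((1 + y\<^sup>2 / 2) * (1 + y\<^sup>2 / 2))"
  proof -
    have "2 * \<bar>y\<bar> \<le> 2 * (1 + y\<^sup>2 / 2)" using \<open>2 * \<bar>y\<bar> \<le> 1 + y\<^sup>2\<close> by (simp add: algebra_simps)
    then have "\<bar>y\<bar> * y\<^sup>2 \<le> (1 + y\<^sup>2 / 2) * (2 * (1 + y\<^sup>2 / 2))"
      by (intro mult_mono) auto
    moreover have "\<bar>y\<bar> * y\<^sup>2 = \<bar>y\<bar> ^ 3" by (simp add: power3_eq_cube power2_eq_square)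
    ultimately show ?thesis by (simp only: mult.left_commute)
  qed
  then have "\<bar>y\<bar> ^ 3 \<le> 2 * exp (y\<^sup>2)" using x2 by linarith
  then have "\<bar>y\<bar> ^ 3 * e \<le> 2 * exp (y\<^sup>2) * e" by (rule mult_right_mono) (use e in simp)
  then show "\<bar>y\<bar> ^ 3 * exp (- y\<^sup>2) \<le> 2" unfolding mult.assoc ee unfolding e_def by simp
qed

text \<open>The third cumulant vanishes because \<open>L f = x f - f' + (\<kappa>/2) f''\<close> is positive everywhere
  when \<open>f\<close> is \<open>sgn \<kappa>\<close> times a Gaussian bump centred far enough on the side of the sign of \<open>\<kappa>\<close>,
  whereas \<open>E (L f)(W)\<close> is small for every fixed \<open>f\<close>.\<close>

lemma kappa_small:
  assumes eta: "0 < \<eta>" and small: "\<rho> \<le> 1" "\<rho> * 40 < exp (- 1 - (14 + 2 / \<eta>)\<^sup>2)"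
  shows "\<bar>\<kappa>\<bar> < \<eta>"
proof (rule ccontr)
  assume "\<not> \<bar>\<kappa>\<bar> < \<eta>"
  then have k: "\<eta> \<le> \<bar>\<kappa>\<bar>" by simp
  define k where "k = \<bar>\<kappa>\<bar>"
  define \<sigma> where "\<sigma> = sgn \<kappa>"
  have k0: "0 < k" "\<eta> \<le> k" "k \<le> 12" using k eta kappa_bounded small(1) by (auto simp: k_def)
  have sig: "\<sigma> * \<sigma> = 1" "\<kappa> = \<sigma> * k" "\<bar>\<sigma>\<bar> = 1"
    using k0 by (auto simp: \<sigma>_def k_def sgn_if abs_if split: if_splits)
  \<comment> \<open>14 exceeds by 2 the bound 12 on k, which comes from \<open>kappa_bounded\<close>
    with \<rho> \<le> 1, and 2/\<eta> pays for completing the square in \<open>L\<close>.\<close>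
  define a where "a = 14 + 2 / \<eta>"
  define e where "e x = exp (- (x - \<sigma> * a)\<^sup>2)" for x
  define f where "f x = \<sigma> * e x" for x
  define f1 where "f1 x = - 2 * \<sigma> * (x - \<sigma> * a) * e x" for x
  define f2 where "f2 x = \<sigma> * (4 * (x - \<sigma> * a)\<^sup>2 - 2) * e x" for x
  define f3 where "f3 x = \<sigma> * (12 * (x - \<sigma> * a) - 8 * (x - \<sigma> * a) ^ 3) * e x" for x
  have de: "(e has_real_derivative - 2 * (x - \<sigma> * a) * e x) (at x)" for x
    unfolding e_def[abs_def] by (auto intro!: derivative_eq_intros)
  have d1: "(f has_real_derivative f1 x) (at x)" for x
    unfolding f_def[abs_def] f1_def
    by (rule derivative_eq_intros de refl)+ (simp add: algebra_simps)
  have d2: "(f1 has_real_derivative f2 x) (at x)" for x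
    unfolding f1_def[abs_def] f2_def
    by (rule derivative_eq_intros de refl)+ (simp add: power2_eq_square algebra_simps)
  have d3: "(f2 has_real_derivative f3 x) (at x)" for x
    unfolding f2_def[abs_def] f3_def
    by (rule derivative_eq_intros de refl)+ (simp add: power2_eq_square power3_eq_cube algebra_simps)
  have e01: "0 < e x" "e x \<le> 1" for x by (auto simp: e_def)
  have eb: "\<bar>x - \<sigma> * a\<bar> * e x \<le> 1" "(x - \<sigma> * a)\<^sup>2 * e x \<le> 1" "\<bar>x - \<sigma> * a\<bar> ^ 3 * e x \<le> 2" for x
    unfolding e_def by (rule gaussian_bump_bounds)+
  \<comment> \<open>One constant serves f and its three derivatives; the largest is
    \<open>f3\<close>, at most 12 + 16 = 28.\<close>
  have b0: "\<bar>f x\<bar> \<le> 40" for x using e01[of x] by (simp add: f_def abs_mult sig)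
  have b1: "\<bar>f1 x\<bar> \<le> 40" for x 
  proof -
    have "\<bar>f1 x\<bar> = 2 * (\<bar>x - \<sigma> * a\<bar> * e x)" using e01[of x] by (simp add: f1_def abs_mult sig)
    then show ?thesis using eb(1)[of x] by linarith
  qed
  have b2: "\<bar>f2 x\<bar> \<le> 40" for x
  proof -
    have "\<bar>f2 x\<bar> = \<bar>4 * ((x - \<sigma> * a)\<^sup>2 * e x) - 2 * e x\<bar>"
    proof -
      have "\<bar>f2 x\<bar> = \<bar>(4 * (x - \<sigma> * a)\<^sup>2 - 2) * e x\<bar>" by (simp add: f2_def abs_mult sig)
      then show ?thesis by (simp add: left_diff_distrib mult.assoc)
    qed
    moreover have "0 \<le> (x - \<sigma> * a)\<^sup>2 * e x" using e01[of x] by simp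
    ultimately show ?thesis using eb(2)[of x] e01[of x] by linarith
  qed
  have b3: "\<bar>f3 x\<bar> \<le> 40" for x
  proof -
    have "\<bar>f3 x\<bar> = \<bar>12 * ((x - \<sigma> * a) * e x) - 8 * ((x - \<sigma> * a) ^ 3 * e x)\<bar>"
    proof -
      have "\<bar>f3 x\<bar> = \<bar>(12 * (x - \<sigma> * a) - 8 * (x - \<sigma> * a) ^ 3) * e x\<bar>" by (simp add: f3_def abs_mult sig)
      then show ?thesis by (simp add: left_diff_distrib mult.assoc)
    qed
    moreover have "\<bar>(x - \<sigma> * a) * e x\<bar> \<le> 1" "\<bar>(x - \<sigma> * a) ^ 3 * e x\<bar> \<le> 2"
      using eb(1,3)[of x] e01[of x] by (auto simp: abs_mult power_abs)
    ultimately show ?thesis by linarith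
  qed
  have L: "e x \<le> x * f x - f1 x + \<kappa> / 2 * f2 x" for x
  proof -
    define y where "y = x - \<sigma> * a"
    have x: "x = y + \<sigma> * a" by (simp add: y_def)
    have "x * f x - f1 x + \<kappa> / 2 * f2 x = (\<sigma> * y + (\<sigma> * \<sigma>) * a + 2 * \<sigma> * y + (\<sigma> * \<sigma>) * k * (2 * y\<^sup>2 - 1)) * e x"
      unfolding f_def f1_def f2_def y_def[symmetric] sig(2)
      by (subst (1) x) (simp add: algebra_simps)
    also have "\<dots> = (3 * (\<sigma> * y) + a + k * (2 * y\<^sup>2 - 1)) * e x" by (simp add: sig)
    finally have eq: "x * f x - f1 x + \<kappa> / 2 * f2 x = (3 * (\<sigma> * y) + a + k * (2 * y\<^sup>2 - 1)) * e x" .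
    have "\<bar>\<sigma> * y\<bar> = \<bar>y\<bar>" by (simp add: abs_mult sig)
    then have "- \<bar>y\<bar> \<le> \<sigma> * y" by linarith
    \<comment> \<open>Completing the square: the growth 2 k y^2 of the f'' term absorbs 3 |y|, of
      which one part comes from x f and two from f'.\<close>
    moreover have "3 * \<bar>y\<bar> \<le> 2 * k * y\<^sup>2 + 9 / (8 * k)"
    proof -
      have "0 \<le> 2 * k * (\<bar>y\<bar> - 3 / (4 * k))\<^sup>2" using k0 by simp
      also have "\<dots> = 2 * k * y\<^sup>2 - 3 * \<bar>y\<bar> + 9 / (8 * k)"
        using k0 by (simp add: power2_eq_square field_simps)
      finally show ?thesis by simp
    qed
    moreover have "9 / (8 * k) \<le> 2 / \<eta>" using k0 eta by (simp add: field_simps)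
    ultimately have "1 \<le> 3 * (\<sigma> * y) + a + k * (2 * y\<^sup>2 - 1)"
      using k0 by (simp add: a_def algebra_simps)
    then show ?thesis unfolding eq using mult_right_mono[of 1 _ "e x"] e01[of x] by simp
  qed
  have m[measurable]: "f \<in> borel_measurable borel" "f1 \<in> borel_measurable borel" "f2 \<in> borel_measurable borel" "e \<in> borel_measurable borel"
    unfolding f_def[abs_def] f1_def[abs_def] f2_def[abs_def] e_def[abs_def] by measurable
  have iWf: "integrable M (\<lambda>w. W w * f (W w))"
    by (rule bounded_integrable[of _ "card I * A * 40"]) (auto simp: abs_mult intro!: mult_mono mult_nonneg_nonneg b0 W_bounded A_nonneg)
  have i1: "integrable M (\<lambda>w. f1 (W w))" and i2: "integrable M (\<lambda>w. f2 (W w))"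
    by (rule bounded_integrable[of _ 40]; auto intro: b1 b2)+
  have ie: "integrable M (\<lambda>w. e (W w))"
    by (rule bounded_integrable[of _ 1]) (use e01 in \<open>auto simp: abs_of_pos\<close>)
  have "expectation (\<lambda>w. e (W w)) \<le> expectation (\<lambda>w. W w * f (W w) - f1 (W w) + \<kappa> / 2 * f2 (W w))"
    by (intro integral_mono ie L) (use iWf i1 i2 in auto)
  also have "\<dots> = expectation (\<lambda>w. W w * f (W w)) - expectation (\<lambda>w. f1 (W w)) + \<kappa> / 2 * expectation (\<lambda>w. f2 (W w))"
    using iWf i1 i2 by simp
  also have "\<dots> \<le> 40 * \<rho>"
    unfolding \<rho>_def using stein_identity[OF d1 d2 d3 b0 b1 b2 b3] by linarith
  finally have upper: "expectation (\<lambda>w. e (W w)) \<le> 40 * \<rho>" .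
  \<comment> \<open>m is the mean of (W - \<sigma> a)^2 for any W with mean 0 and variance 1.
    Jensen's inequality for exp(-t), carried out through the tangent at m, bounds E e(W) below by
    exp(-m); this is the threshold in the hypothesis.\<close>
  define m where "m = 1 + a\<^sup>2"
  have tangent: "exp (- m) * (1 + m - (W w - \<sigma> * a)\<^sup>2) \<le> e (W w)" for w
  proof -
    have "1 + m - (W w - \<sigma> * a)\<^sup>2 \<le> exp (m - (W w - \<sigma> * a)\<^sup>2)"
      using exp_ge_add_one_self[of "m - (W w - \<sigma> * a)\<^sup>2"] by linarith
    then have "exp (- m) * (1 + m - (W w - \<sigma> * a)\<^sup>2) \<le> exp (- m) * exp (m - (W w - \<sigma> * a)\<^sup>2)"
      by (intro mult_left_mono) auto
    also have "\<dots> = e (W w)" by (simp add: e_def exp_add[symmetric])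
    finally show ?thesis .
  qed
  have sq: "(W w - \<sigma> * a)\<^sup>2 = (W w)\<^sup>2 - 2 * \<sigma> * a * W w + a\<^sup>2" for w
    using sig(1) by (simp add: power2_eq_square algebra_simps)
  have iq: "integrable M (\<lambda>w. (W w - \<sigma> * a)\<^sup>2)" and Eq: "expectation (\<lambda>w. (W w - \<sigma> * a)\<^sup>2) = m"
    unfolding sq using W_integrable W_square_integrable expectation_W expectation_W_sq
    by (auto simp: prob_space m_def)
  have "exp (- m) = expectation (\<lambda>w. exp (- m) * (1 + m - (W w - \<sigma> * a)\<^sup>2))"
    using iq Eq by (simp add: prob_space)
  also have "\<dots> \<le> expectation (\<lambda>w. e (W w))"
    by (intro integral_mono ie tangent) (use iq in auto)
  finally have "exp (- m) \<le> 40 * \<rho>" using upper by linarith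
  with small(2) show False by (simp add: m_def a_def)
qed

section \<open>Differential inequality for the characteristic function\<close>

text \<open>The phase \<theta> lets one real function carry both parts of the characteristic
  function. Differentiation under the expectation rests on the second-order error t^2 W^2, whose
  mean is t^2.\<close>

lemma expectation_cos_derivative:
  "((\<lambda>s. expectation (\<lambda>w. cos (s * W w + \<theta>))) has_real_derivative - expectation (\<lambda>w. W w * sin (s * W w + \<theta>))) (at s)"
proof -
  define F where "F s = expectation (\<lambda>w. cos (s * W w + \<theta>))" for s
  define G where "G = - expectation (\<lambda>w. W w * sin (s * W w + \<theta>))"
  have bnd: "\<bar>cos (x + t) - cos x + t * sin x\<bar> \<le> t\<^sup>2" for x t :: real
  proof -
    have "\<bar>cos (x + t) - (cos x + t * - sin x)\<bar> \<le> t\<^sup>2"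
    proof (cases "t = 0")
      case False
      have "\<exists>r. (if x + t < x then x + t < r \<and> r < x else x < r \<and> r < x + t) \<and>
          cos (x + t) = (\<Sum>m<2. (if m = 0 then cos else if m = 1 then (\<lambda>x. - sin x) else (\<lambda>x. - cos x)) x / fact m * (x + t - x) ^ m)
            + (if (2::nat) = 0 then cos else if (2::nat) = 1 then (\<lambda>x. - sin x) else (\<lambda>x. - cos x)) r / fact 2 * (x + t - x) ^ 2"
        by (rule Taylor[where a = "min x (x + t)" and b = "max x (x + t)"])
          (use False in \<open>auto simp: less_Suc_eq numeral_2_eq_2 intro!: derivative_eq_intros\<close>)
      then obtain r where "cos (x + t) = cos x + t * - sin x - cos r / 2 * t\<^sup>2"
        by (auto simp: numeral_2_eq_2 algebra_simps)
      then have "\<bar>cos (x + t) - (cos x + t * - sin x)\<bar> = \<bar>cos r\<bar> * t\<^sup>2 / 2" by (simp add: abs_mult)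
      also have "\<dots> \<le> 1 * t\<^sup>2 / 2" by (intro divide_right_mono mult_right_mono) auto
      also have "\<dots> \<le> t\<^sup>2" by simp
      finally show ?thesis .
    qed simp
    then show ?thesis by (simp add: algebra_simps)
  qed
  have ic: "integrable M (\<lambda>w. cos (s * W w + \<theta>))" for s by (rule bounded_integrable[of _ 1]) auto
  have isn: "integrable M (\<lambda>w. W w * sin (s * W w + \<theta>))"
    by (rule bounded_integrable[of _ "card I * A * 1"]) (auto simp: abs_mult simp del: mult_1_right intro!: mult_mono mult_nonneg_nonneg W_bounded A_nonneg)
  have est: "\<bar>(F (s + t) - F s) / t - G\<bar> \<le> \<bar>t\<bar>" if "t \<noteq> 0" for t
  proof -
    have "F (s + t) - F s - t * G = expectation (\<lambda>w. cos (s * W w + \<theta> + t * W w) - cos (s * W w + \<theta>) + (t * W w) * sin (s * W w + \<theta>))" (is "?l = ?r")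
      using ic[of "s + t"] ic[of s] isn by (simp add: F_def G_def algebra_simps)
    then have "\<bar>?l\<bar> = \<bar>?r\<bar>" by (rule arg_cong)
    also have "\<dots> \<le> expectation (\<lambda>w. \<bar>cos (s * W w + \<theta> + t * W w) - cos (s * W w + \<theta>) + (t * W w) * sin (s * W w + \<theta>)\<bar>)"
      by (rule integral_abs_bound)
    also have "\<dots> \<le> expectation (\<lambda>w. t\<^sup>2 * (W w)\<^sup>2)"
    proof (rule integral_mono)
      show "integrable M (\<lambda>w. \<bar>cos (s * W w + \<theta> + t * W w) - cos (s * W w + \<theta>) + (t * W w) * sin (s * W w + \<theta>)\<bar>)"
        using ic[of "s + t"] ic[of s] isn by (auto simp: algebra_simps)
      show "integrable M (\<lambda>w. t\<^sup>2 * (W w)\<^sup>2)" using W_square_integrable by simp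
    qed (use bnd in \<open>auto simp: power_mult_distrib[symmetric]\<close>)
    also have "\<dots> = t\<^sup>2" by (simp add: expectation_W_sq)
    finally have "\<bar>F (s + t) - F s - t * G\<bar> / \<bar>t\<bar> \<le> t\<^sup>2 / \<bar>t\<bar>" by (rule divide_right_mono) simp
    moreover have "(F (s + t) - F s) / t - G = (F (s + t) - F s - t * G) / t" using that by (simp add: field_simps)
    moreover have "t\<^sup>2 / \<bar>t\<bar> = \<bar>t\<bar>" using that by (simp add: power2_eq_square abs_if)
    ultimately show ?thesis by (simp add: abs_divide)
  qed
  have "((\<lambda>t. (F (s + t) - F s) / t - G) \<longlongrightarrow> 0) (at 0)"
  proof (rule Lim_null_comparison)
    show "eventually (\<lambda>t. norm ((F (s + t) - F s) / t - G) \<le> \<bar>t\<bar>) (at 0)"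
      using est by (auto simp: eventually_at_filter)
    show "((\<lambda>t::real. \<bar>t\<bar>) \<longlongrightarrow> 0) (at 0)" by (auto intro!: tendsto_eq_intros)
  qed
  then have "((\<lambda>t. (F (s + t) - F s) / t) \<longlongrightarrow> G) (at 0)" by (simp add: LIM_zero_iff)
  then show ?thesis unfolding F_def G_def by (simp add: DERIV_def)
qed

text \<open>For the test function sin(r x + \<theta>) the Stein identity becomes |F'(r) + r F(r)|
  \<le> Q on [0, s]. The integrating factor exp(r^2/2) reduces this to a mean value
  estimate.\<close>

lemma cos_expectation_bound:
  assumes s: "0 \<le> s"
  shows "\<bar>expectation (\<lambda>w. cos (s * W w + \<theta>)) - cos \<theta> * exp (- s\<^sup>2 / 2)\<bar> \<le> s * (\<bar>\<kappa>\<bar> * s\<^sup>2 + (1 + s) ^ 3 * \<rho>)"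
proof (cases "s = 0")
  case False
  then have s0: "0 < s" using s by simp
  define F where "F r = expectation (\<lambda>w. cos (r * W w + \<theta>))" for r
  define G where "G r = - expectation (\<lambda>w. W w * sin (r * W w + \<theta>))" for r
  define Q where "Q = \<bar>\<kappa>\<bar> * s\<^sup>2 + (1 + s) ^ 3 * \<rho>"
  have Q0: "0 \<le> Q" using rho_nonneg s by (simp add: Q_def)
  have dF: "(F has_real_derivative G r) (at r)" for r
    unfolding F_def[abs_def] G_def by (rule expectation_cos_derivative)
  have GF: "\<bar>G r + r * F r\<bar> \<le> Q" if r: "0 \<le> r" "r \<le> s" for r
  proof -
    \<comment> \<open>A single bound for the powers r^0, ..., r^3 brought in by the test function
      and its derivatives.\<close>
    have pw: "r ^ j \<le> (1 + s) ^ 3" if "j \<le> 3" for j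
    proof -
      have "r ^ j \<le> (1 + s) ^ j" using r by (intro power_mono) auto
      also have "\<dots> \<le> (1 + s) ^ 3" using r that by (intro power_increasing) auto
      finally show ?thesis .
    qed
    have "\<bar>expectation (\<lambda>w. W w * sin (r * W w + \<theta>)) - expectation (\<lambda>w. r * cos (r * W w + \<theta>))
        + \<kappa> / 2 * expectation (\<lambda>w. - (r\<^sup>2) * sin (r * W w + \<theta>))\<bar> \<le> (1 + s) ^ 3 * (3 * sqrt \<epsilon> + 4 * \<epsilon>)"
    proof (rule stein_identity[where ?f3.0 = "\<lambda>x. - (r ^ 3) * cos (r * x + \<theta>)"])
      show "((\<lambda>x. sin (r * x + \<theta>)) has_real_derivative r * cos (r * x + \<theta>)) (at x)" for x
        by (auto intro!: derivative_eq_intros)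
      show "((\<lambda>x. r * cos (r * x + \<theta>)) has_real_derivative - (r\<^sup>2) * sin (r * x + \<theta>)) (at x)" for x
        by (auto intro!: derivative_eq_intros simp: power2_eq_square)
      show "((\<lambda>x. - (r\<^sup>2) * sin (r * x + \<theta>)) has_real_derivative - (r ^ 3) * cos (r * x + \<theta>)) (at x)" for x
        by (auto intro!: derivative_eq_intros simp: power2_eq_square power3_eq_cube)
      have m: "r ^ j * \<bar>t\<bar> \<le> (1 + s) ^ 3" if "j \<le> 3" "\<bar>t\<bar> \<le> 1" for j t
        using mult_mono[OF pw[OF that(1)] that(2)] r by simp
      show "\<bar>sin (r * x + \<theta>)\<bar> \<le> (1 + s) ^ 3" for x using m[of 0 "sin (r * x + \<theta>)"] by simp
      show "\<bar>r * cos (r * x + \<theta>)\<bar> \<le> (1 + s) ^ 3" for x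
        using m[of 1 "cos (r * x + \<theta>)"] r by (simp add: abs_mult)
      show "\<bar>- (r\<^sup>2) * sin (r * x + \<theta>)\<bar> \<le> (1 + s) ^ 3" for x
        using m[of 2 "sin (r * x + \<theta>)"] r by (simp add: abs_mult)
      show "\<bar>- (r ^ 3) * cos (r * x + \<theta>)\<bar> \<le> (1 + s) ^ 3" for x
        using m[of 3 "cos (r * x + \<theta>)"] r by (simp add: abs_mult)
    qed
    then have 1: "\<bar>G r + r * F r + \<kappa> / 2 * (r\<^sup>2 * expectation (\<lambda>w. sin (r * W w + \<theta>)))\<bar> \<le> (1 + s) ^ 3 * \<rho>"
      by (simp add: G_def F_def \<rho>_def)
    have "\<bar>\<kappa> / 2 * (r\<^sup>2 * expectation (\<lambda>w. sin (r * W w + \<theta>)))\<bar> \<le> \<bar>\<kappa>\<bar> * (s\<^sup>2 * 1)"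
      unfolding abs_mult using r
      by (intro mult_mono abs_expectation_le) auto
    then show ?thesis using 1 by (simp add: Q_def)
  qed
  define H where "H r = exp (r\<^sup>2 / 2) * F r" for r
  have dH: "(H has_real_derivative exp (r\<^sup>2 / 2) * (G r + r * F r)) (at r)" for r
  proof -
    have "((\<lambda>r. exp (r\<^sup>2 / 2)) has_real_derivative r * exp (r\<^sup>2 / 2)) (at r)"
      by (auto intro!: derivative_eq_intros)
    from DERIV_mult[OF this dF] show ?thesis unfolding H_def[abs_def] by (simp add: algebra_simps)
  qed
  have "\<bar>H s - H 0\<bar> \<le> exp (s\<^sup>2 / 2) * Q * \<bar>s - 0\<bar>"
  proof -
    have "norm (H s - H 0) \<le> (exp (s\<^sup>2 / 2) * Q) * norm (s - 0)"
    proof (rule field_differentiable_bound[of "{0..s}" H "\<lambda>r. exp (r\<^sup>2 / 2) * (G r + r * F r)"])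
      show "(H has_field_derivative exp (z\<^sup>2 / 2) * (G z + z * F z)) (at z within {0..s})" for z
        by (rule has_field_derivative_at_within[OF dH])
      show "norm (exp (z\<^sup>2 / 2) * (G z + z * F z)) \<le> exp (s\<^sup>2 / 2) * Q" if "z \<in> {0..s}" for z
        using GF[of z] that unfolding norm_mult
        by (intro mult_mono) (auto intro: power_mono)
    qed (use s in auto)
    then show ?thesis by simp
  qed
  then have "\<bar>exp (s\<^sup>2 / 2) * F s - cos \<theta>\<bar> \<le> exp (s\<^sup>2 / 2) * Q * s"
    using s by (simp add: H_def F_def prob_space)
  then have le: "exp (- s\<^sup>2 / 2) * \<bar>exp (s\<^sup>2 / 2) * F s - cos \<theta>\<bar> \<le> exp (- s\<^sup>2 / 2) * (exp (s\<^sup>2 / 2) * Q * s)"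
    by (intro mult_left_mono) auto
  have E: "exp (- s\<^sup>2 / 2) * exp (s\<^sup>2 / 2) = 1" by (simp add: exp_add[symmetric])
  have eq: "exp (- s\<^sup>2 / 2) * (exp (s\<^sup>2 / 2) * F s - cos \<theta>) = F s - cos \<theta> * exp (- s\<^sup>2 / 2)"
    "exp (- s\<^sup>2 / 2) * (exp (s\<^sup>2 / 2) * Q * s) = s * Q"
    using arg_cong[OF E, of "\<lambda>x. x * F s"] arg_cong[OF E, of "\<lambda>x. x * (s * Q)"]
    by (simp_all only: right_diff_distrib mult.assoc mult_1_left) (simp_all only: mult_ac)
  have "\<bar>F s - cos \<theta> * exp (- s\<^sup>2 / 2)\<bar> = exp (- s\<^sup>2 / 2) * \<bar>exp (s\<^sup>2 / 2) * F s - cos \<theta>\<bar>"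
    unfolding eq(1)[symmetric] abs_mult by simp
  also have "\<dots> \<le> s * Q" using le unfolding eq(2) .
  finally show ?thesis by (simp add: F_def Q_def)
qed (simp add: prob_space)

end


section \<open>Convergence in distribution to the standard normal law\<close>

lemma vec_lambda_measurable: "(\<lambda>z. \<chi> i. z i) \<in> borel_measurable (\<Pi>\<^sub>M i\<in>(UNIV :: 'q::finite set). (std_normal_distribution :: real measure))"
  by (rule borel_measurable_vecI) (simp add: measurable_component_singleton)

interpretation std_normal: prob_space std_normal_distribution
  by (simp add: real_distribution.axioms(1) real_dist_normal_dist)

lemma prob_space_std_normal_vec: "prob_space (std_normal_vec :: (real^'q) measure)"
  unfolding std_normal_vec_def
  by (intro prob_space.prob_space_distr prob_space_PiM vec_lambda_measurable) (simp add: std_normal.prob_space_axioms)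

lemma sets_std_normal_vec [measurable_cong, simp]: "sets std_normal_vec = sets borel"
  by (simp add: std_normal_vec_def)

lemma space_std_normal_vec [simp]: "space std_normal_vec = UNIV"
  by (simp add: std_normal_vec_def)

text \<open>Fubini over the coordinates, then the real part after multiplication by exp(i
  \<theta>).\<close>

lemma std_normal_vec_char:
  fixes t :: "real^'q"
  shows "(\<integral>z. cos (t \<bullet> z + \<theta>) \<partial>std_normal_vec) = cos \<theta> * exp (- (norm t)\<^sup>2 / 2)"
proof -
  interpret P: product_prob_space "\<lambda>_::'q. std_normal_distribution" UNIV
    by unfold_locales
  note m = vec_lambda_measurable[where 'q = 'q]
  let ?PM = "\<Pi>\<^sub>M i\<in>(UNIV :: 'q set). std_normal_distribution"
  have int1: "integrable std_normal_distribution (\<lambda>x. iexp (t $ i * x))" for i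
    by (rule std_normal.integrable_const_bound[of _ 1]) auto
  have char1: "(\<integral>x. iexp (t $ i * x) \<partial>std_normal_distribution) = of_real (exp (- (t $ i)\<^sup>2 / 2))" for i
    using char_std_normal_distribution unfolding char_def by (metis (no_types))
  have iexp_prod: "iexp (t \<bullet> (\<chi> i. z i)) = (\<Prod>i\<in>UNIV. iexp (t $ i * z i))" for z :: "'q \<Rightarrow> real"
    by (simp add: inner_vec_def sum_distrib_left exp_sum)
  have E: "(\<integral>z. iexp (t \<bullet> (\<chi> i. z i)) \<partial>?PM) = of_real (exp (- (norm t)\<^sup>2 / 2))"
  proof -
    have "(\<integral>z. iexp (t \<bullet> (\<chi> i. z i)) \<partial>?PM) = (\<Prod>i\<in>UNIV. \<integral>x. iexp (t $ i * x) \<partial>std_normal_distribution)"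
      unfolding iexp_prod by (rule P.product_integral_prod) (use int1 in auto)
    also have "\<dots> = of_real (\<Prod>i\<in>UNIV. exp (- (t $ i)\<^sup>2 / 2))" unfolding char1 by simp
    also have "(\<Prod>i\<in>UNIV. exp (- (t $ i)\<^sup>2 / 2)) = exp (- (norm t)\<^sup>2 / 2)"
    proof -
      have "(norm t)\<^sup>2 = (\<Sum>i\<in>UNIV. (t $ i)\<^sup>2)" by (simp only: power2_norm_eq_inner inner_vec_def) (simp add: power2_eq_square)
      then show ?thesis by (simp add: exp_sum[symmetric] sum_divide_distrib[symmetric] sum_negf)
    qed
    finally show ?thesis .
  qed
  have mi: "(\<lambda>z. iexp (t \<bullet> (\<chi> i. z i))) \<in> borel_measurable ?PM"
    using m by (intro borel_measurable_continuous_on[of "\<lambda>x. iexp x"]) (auto intro!: continuous_intros borel_measurable_inner)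
  have int: "integrable ?PM (\<lambda>z. iexp (t \<bullet> (\<chi> i. z i)))"
    by (rule P.P.integrable_const_bound[of _ 1]) (use mi in auto)
  have "(\<integral>z. cos (t \<bullet> z + \<theta>) \<partial>std_normal_vec) = (\<integral>z. cos (t \<bullet> (\<chi> i. z i) + \<theta>) \<partial>?PM)"
    unfolding std_normal_vec_def by (rule integral_distr[OF m]) simp
  also have "\<dots> = (\<integral>z. Re (iexp \<theta> * iexp (t \<bullet> (\<chi> i. z i))) \<partial>?PM)"
    by (simp add: exp_add[symmetric] cos_add Re_exp Im_exp mult.commute add.commute)
  also have "\<dots> = Re (iexp \<theta> * of_real (exp (- (norm t)\<^sup>2 / 2)))"
    using int E by (subst integral_Re) auto
  also have "\<dots> = cos \<theta> * exp (- (norm t)\<^sup>2 / 2)" by (simp add: Re_exp)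
  finally show ?thesis .
qed

section \<open>Trigonometric approximation and the continuity theorem\<close>

text \<open>The functions whose expectations are determined by the characteristic function. Phases
  bring in the sines, and arbitrary frequency vectors make the class closed under products.\<close>

inductive trig_poly :: "((real^'q) \<Rightarrow> real) \<Rightarrow> bool" where
  cos: "trig_poly (\<lambda>x. c * cos (t \<bullet> x + \<theta>))"
| add: "trig_poly f \<Longrightarrow> trig_poly g \<Longrightarrow> trig_poly (\<lambda>x. f x + g x)"

lemma trig_poly_const: "trig_poly (\<lambda>x. c)"
  using trig_poly.cos[of c 0 0] by simp

lemma trig_poly_sum: "finite I \<Longrightarrow> (\<And>i. i \<in> I \<Longrightarrow> trig_poly (f i)) \<Longrightarrow> trig_poly (\<lambda>x. \<Sum>i\<in>I. f i x)"
  by (induction I rule: finite_induct) (auto intro: trig_poly_const trig_poly.add)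

lemma trig_poly_mult:
  assumes "trig_poly f" "trig_poly g" shows "trig_poly (\<lambda>x. f x * g x)"
  using assms
proof (induction f rule: trig_poly.induct)
  case (cos c t \<theta>)
  from cos show ?case
  proof (induction g rule: trig_poly.induct)
    case (cos c' t' \<theta>')
    have "(\<lambda>x. c * cos (t \<bullet> x + \<theta>) * (c' * cos (t' \<bullet> x + \<theta>')))
      = (\<lambda>x. (c * c' / 2) * cos ((t - t') \<bullet> x + (\<theta> - \<theta>')) + (c * c' / 2) * cos ((t + t') \<bullet> x + (\<theta> + \<theta>')))"
    proof
      fix x
      have "cos ((t - t') \<bullet> x + (\<theta> - \<theta>')) = cos ((t \<bullet> x + \<theta>) - (t' \<bullet> x + \<theta>'))"
        "cos ((t + t') \<bullet> x + (\<theta> + \<theta>')) = cos ((t \<bullet> x + \<theta>) + (t' \<bullet> x + \<theta>'))"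
        by (simp_all add: inner_diff_left inner_add_left algebra_simps)
      moreover have "c * cos A * (c' * cos B) = (c * c' / 2) * cos (A - B) + (c * c' / 2) * cos (A + B)" for A B
        by (simp add: cos_diff cos_add algebra_simps)
      ultimately show "c * cos (t \<bullet> x + \<theta>) * (c' * cos (t' \<bullet> x + \<theta>')) = (c * c' / 2) * cos ((t - t') \<bullet> x + (\<theta> - \<theta>')) + (c * c' / 2) * cos ((t + t') \<bullet> x + (\<theta> + \<theta>'))"
        by (simp only:)
    qed
    then show ?case by (simp only:) (intro trig_poly.intros)
  next
    case (add f g) then show ?case by (simp add: distrib_left trig_poly.add)
  qed
next
  case (add f g) then show ?case by (simp add: distrib_right trig_poly.add)
qed

text \<open>sin is cos with phase -pi/2, so each sin(a x_i) belongs to the class, and sums and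
  products stay in it.\<close>

lemma trig_poly_of_polynomial:
  fixes P :: "real^'q \<Rightarrow> real"
  assumes "real_polynomial_function P"
  shows "trig_poly (\<lambda>x. P (\<chi> i. sin (a * x $ i)))"
  using assms
proof (induction P rule: real_polynomial_function.induct)
  case (linear f)
  interpret f: bounded_linear f by (rule linear)
  have "f (\<chi> i. sin (a * x $ i)) = (\<Sum>i\<in>UNIV. f (axis i 1) * cos ((a *\<^sub>R axis i 1) \<bullet> x + (- (pi / 2))))" for x :: "real^'q"
  proof -
    have "(\<chi> i. sin (a * x $ i)) = (\<Sum>i\<in>UNIV. sin (a * x $ i) *\<^sub>R axis i 1)"
      by (simp add: vec_eq_iff axis_def if_distrib cong: if_cong)
    moreover have "cos ((a *\<^sub>R axis i 1) \<bullet> x + (- (pi / 2))) = sin (a * x $ i)" for i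
      by (simp add: cos_diff inner_axis' )
    ultimately show ?thesis by (simp add: f.sum f.scaleR mult.commute)
  qed
  then show ?case by (simp only:) (intro trig_poly_sum trig_poly.cos, simp)
qed (auto intro: trig_poly_const trig_poly.add trig_poly_mult)

lemma trig_poly_continuous: "trig_poly f \<Longrightarrow> continuous_on UNIV f"
  by (induction rule: trig_poly.induct) (auto intro!: continuous_intros)

lemma trig_poly_bounded: "trig_poly f \<Longrightarrow> \<exists>B. \<forall>x. \<bar>f x\<bar> \<le> B"
proof (induction rule: trig_poly.induct)
  case (cos c t \<theta>)
  have "\<bar>c * cos (t \<bullet> x + \<theta>)\<bar> \<le> \<bar>c\<bar>" for x
    using mult_left_mono[OF abs_cos_le_one abs_ge_zero, of c "t \<bullet> x + \<theta>"] by (simp add: abs_mult)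
  then show ?case by blast
next
  case (add f g)
  then obtain B B' where "\<forall>x. \<bar>f x\<bar> \<le> B" "\<forall>x. \<bar>g x\<bar> \<le> B'" by blast
  then have "\<bar>f x + g x\<bar> \<le> B + B'" for x by (meson abs_triangle_ineq add_mono order_trans)
  then show ?case by blast
qed

lemma trig_poly_integrable:
  assumes f: "trig_poly f" and "prob_space N" "X \<in> borel_measurable N"
  shows "integrable N (\<lambda>w. f (X w))"
proof -
  interpret prob_space N by fact
  obtain B where "\<forall>x. \<bar>f x\<bar> \<le> B" using trig_poly_bounded[OF f] by blast
  moreover have [measurable]: "f \<in> borel_measurable borel"
    by (rule borel_measurable_continuous_onI[OF trig_poly_continuous[OF f]])
  ultimately show ?thesis using assms(3) by (intro integrable_const_bound[of _ B]) auto
qed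

text \<open>Composing with \<open>arcsin \<circ> sin\<close> in each coordinate makes a polynomial approximation on a
  cube globally bounded.\<close>

lemma trig_poly_approximation:
  fixes f :: "real^'q \<Rightarrow> real"
  assumes f: "continuous_on UNIV f" "\<And>x. \<bar>f x\<bar> \<le> K" and "0 < \<epsilon>" "0 < L"
  obtains p where "trig_poly p" "\<And>x. \<bar>p x\<bar> \<le> K + \<epsilon>" "\<And>x. norm x \<le> L \<Longrightarrow> \<bar>f x - p x\<bar> \<le> \<epsilon>"
proof -
  \<comment> \<open>For |x| \<le> L every a x_i lies in [-pi/2, pi/2], where arcsin inverts
    sin.\<close>
  define a where "a = pi / (2 * L)"
  have a: "0 < a" "a * L = pi / 2" using \<open>0 < L\<close> by (auto simp: a_def)
  define C :: "(real^'q) set" where "C = cbox (\<chi> i. - 1) (\<chi> i. 1)"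
  have C: "v \<in> C \<longleftrightarrow> (\<forall>i. - 1 \<le> v $ i \<and> v $ i \<le> 1)" for v :: "real^'q" by (simp add: C_def mem_box_cart)
  \<comment> \<open>f transported to the cube. At the vector of the sin(a x_i) it equals f(x) when
    |x| \<le> L, and it is bounded by K on the whole cube, so the polynomial composed with sin is
    bounded by K + \<epsilon> everywhere.\<close>
  define F where "F v = f (\<chi> i. arcsin (v $ i) / a)" for v
  have "continuous_on C F"
    unfolding F_def
    by (rule continuous_on_compose2[OF f(1)]) (use a C in \<open>auto intro!: continuous_intros\<close>)
  moreover have "compact C" by (simp add: C_def)
  ultimately obtain P where P: "real_polynomial_function P" "\<And>v. v \<in> C \<Longrightarrow> \<bar>F v - P v\<bar> < \<epsilon>"
    using Stone_Weierstrass_real_polynomial_function[of C F \<epsilon>] \<open>0 < \<epsilon>\<close> by blast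
  define p where "p x = P (\<chi> i. sin (a * x $ i))" for x :: "real^'q"
  have inC: "(\<chi> i. sin (a * x $ i)) \<in> C" for x :: "real^'q" by (simp add: C)
  show thesis
  proof
    show "trig_poly p" unfolding p_def[abs_def] by (rule trig_poly_of_polynomial[OF P(1)])
    show "\<bar>p x\<bar> \<le> K + \<epsilon>" for x
      using P(2)[OF inC[of x]] f(2)[of "\<chi> i. arcsin ((\<chi> i. sin (a * x $ i)) $ i) / a"] unfolding p_def F_def by linarith
    fix x :: "real^'q" assume x: "norm x \<le> L"
    have "arcsin (sin (a * x $ i)) / a = x $ i" for i
    proof -
      have "\<bar>x $ i\<bar> \<le> L" using x component_le_norm_cart[of x i] by linarith
      then have "a * \<bar>x $ i\<bar> \<le> a * L" using a by (intro mult_left_mono) auto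
      then have "\<bar>a * x $ i\<bar> \<le> pi / 2" using a by (simp add: abs_mult)
      then have "arcsin (sin (a * x $ i)) = a * x $ i" by (intro arcsin_sin) (auto simp: abs_le_iff)
      then show ?thesis using a by simp
    qed
    then have "F (\<chi> i. sin (a * x $ i)) = f x" unfolding F_def by (simp add: vec_lambda_eta)
    then show "\<bar>f x - p x\<bar> \<le> \<epsilon>" using P(2)[OF inC[of x]] unfolding p_def by linarith
  qed
qed

text \<open>On the ball the two functions are \<epsilon>-close; outside it they differ by at most K
  + K', on an event of probability at most \<delta>.\<close>

lemma (in prob_space) truncation_error:
  fixes Y :: "'a \<Rightarrow> 'b::{real_normed_vector,second_countable_topology}" and f p :: "'b \<Rightarrow> real"
  assumes [measurable]: "Y \<in> borel_measurable M" "f \<in> borel_measurable borel" "p \<in> borel_measurable borel"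
    and b: "\<And>x. \<bar>f x\<bar> \<le> K" "\<And>x. \<bar>p x\<bar> \<le> K'" "\<And>x. norm x \<le> L \<Longrightarrow> \<bar>f x - p x\<bar> \<le> \<epsilon>"
    and e: "0 \<le> \<epsilon>" "prob {w \<in> space M. L < norm (Y w)} \<le> \<delta>"
  shows "\<bar>expectation (\<lambda>w. f (Y w)) - expectation (\<lambda>w. p (Y w))\<bar> \<le> \<epsilon> + (K + K') * \<delta>"
proof -
  let ?A = "{w \<in> space M. L < norm (Y w)}"
  have K0: "0 \<le> K + K'" using b(1,2)[of 0] by linarith
  have int: "integrable M (\<lambda>w. f (Y w))" "integrable M (\<lambda>w. p (Y w))"
    by (rule integrable_const_bound[of _ K] integrable_const_bound[of _ K']; use b in auto)+
  have iA: "integrable M (\<lambda>w. \<epsilon> + (K + K') * indicator ?A w)" by (simp add: emeasure_eq_measure)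
  have "\<bar>expectation (\<lambda>w. f (Y w)) - expectation (\<lambda>w. p (Y w))\<bar> = \<bar>expectation (\<lambda>w. f (Y w) - p (Y w))\<bar>"
    using int by simp
  also have "\<dots> \<le> expectation (\<lambda>w. \<bar>f (Y w) - p (Y w)\<bar>)" by (rule integral_abs_bound)
  also have "\<dots> \<le> expectation (\<lambda>w. \<epsilon> + (K + K') * indicator ?A w)"
  proof (rule integral_mono)
    fix w assume w: "w \<in> space M"
    show "\<bar>f (Y w) - p (Y w)\<bar> \<le> \<epsilon> + (K + K') * indicator ?A w"
    proof (cases "L < norm (Y w)")
      case True
      have "\<bar>f (Y w) - p (Y w)\<bar> \<le> K + K'" using b(1,2)[of "Y w"] by linarith
      then show ?thesis using True w e by simp
    qed (use b(3)[of "Y w"] in simp)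
  qed (use int iA in auto)
  also have "\<dots> = \<epsilon> + (K + K') * prob ?A" by (simp add: prob_space emeasure_eq_measure)
  also have "\<dots> \<le> \<epsilon> + (K + K') * \<delta>" using K0 e by (simp add: mult_left_mono)
  finally show ?thesis .
qed

definition tight_seq :: "(nat \<Rightarrow> 'a measure) \<Rightarrow> (nat \<Rightarrow> 'a \<Rightarrow> 'b::real_normed_vector) \<Rightarrow> bool" where
  "tight_seq M Y \<longleftrightarrow> (\<forall>\<epsilon>>0. \<exists>L>0. \<forall>\<^sub>F G in sequentially. measure (M G) {w \<in> space (M G). L < norm (Y G w)} \<le> \<epsilon>)"

lemma (in prob_space) tail_small:
  fixes Y :: "'a \<Rightarrow> 'b::{real_normed_vector,second_countable_topology}"
  assumes [measurable]: "Y \<in> borel_measurable M" and "0 < \<epsilon>"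
  shows "\<exists>L0. \<forall>L\<ge>L0. prob {w \<in> space M. L < norm (Y w)} \<le> \<epsilon>"
proof -
  have "(\<lambda>n. prob {w \<in> space M. real n < norm (Y w)}) \<longlonglongrightarrow> prob (\<Inter>n. {w \<in> space M. real n < norm (Y w)})"
    by (rule finite_Lim_measure_decseq) (auto simp: decseq_def)
  moreover have "(\<Inter>n. {w \<in> space M. real n < norm (Y w)}) = {}"
  proof (rule equals0I)
    fix w assume w: "w \<in> (\<Inter>n. {w \<in> space M. real n < norm (Y w)})"
    obtain n where "norm (Y w) < real n" using reals_Archimedean2 by blast
    moreover have "real n < norm (Y w)" using w by blast
    ultimately show False by simp
  qed
  ultimately have "(\<lambda>n. prob {w \<in> space M. real n < norm (Y w)}) \<longlonglongrightarrow> 0" by simp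
  then have "\<forall>\<^sub>F n in sequentially. prob {w \<in> space M. real n < norm (Y w)} < \<epsilon>"
    using \<open>0 < \<epsilon>\<close> by (rule order_tendstoD)
  then obtain n where n: "prob {w \<in> space M. real n < norm (Y w)} < \<epsilon>"
    unfolding eventually_sequentially by blast
  have "prob {w \<in> space M. L < norm (Y w)} \<le> \<epsilon>" if "real n \<le> L" for L
  proof -
    have "prob {w \<in> space M. L < norm (Y w)} \<le> prob {w \<in> space M. real n < norm (Y w)}"
      by (intro finite_measure_mono) (use that in auto)
    with n show ?thesis by linarith
  qed
  then show ?thesis by blast
qed

text \<open>Levy's continuity theorem for the limit N(0, I) in several dimensions. Tightness is a
  hypothesis because second moments supply it here; it lets an approximation that is good on one
  ball act on the whole space.\<close>

theorem converges_in_distribution_of_char: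
  fixes Y :: "nat \<Rightarrow> 'a \<Rightarrow> real^'q"
  assumes prob: "\<forall>\<^sub>F G in sequentially. prob_space (M G)"
    and meas: "\<forall>\<^sub>F G in sequentially. Y G \<in> borel_measurable (M G)"
    and tight: "tight_seq M Y"
    and char: "\<And>t \<theta>. (\<lambda>G. \<integral>w. cos (t \<bullet> Y G w + \<theta>) \<partial>M G) \<longlonglongrightarrow> cos \<theta> * exp (- (norm t)\<^sup>2 / 2)"
  shows "converges_in_distribution M Y std_normal_vec"
proof -
  let ?Z = "std_normal_vec :: (real^'q) measure"
  interpret Z: prob_space ?Z by (rule prob_space_std_normal_vec)
  have trig: "(\<lambda>G. \<integral>w. p (Y G w) \<partial>M G) \<longlonglongrightarrow> (\<integral>z. p z \<partial>?Z)" if "trig_poly p" for p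
    using that
  proof (induction rule: trig_poly.induct)
    case (cos c t \<theta>)
    show ?case using tendsto_mult_left[OF char, of c t \<theta>] by (simp add: std_normal_vec_char)
  next
    case (add f g)
    note int = trig_poly_integrable[OF add.hyps(1)] trig_poly_integrable[OF add.hyps(2)]
    have "\<forall>\<^sub>F G in sequentially. (\<integral>w. f (Y G w) \<partial>M G) + (\<integral>w. g (Y G w) \<partial>M G) = (\<integral>w. f (Y G w) + g (Y G w) \<partial>M G)"
      using prob meas by eventually_elim (rule Bochner_Integration.integral_add[symmetric]; rule int; assumption)
    moreover have "integrable ?Z f" "integrable ?Z g"
      using trig_poly_integrable[OF _ Z.prob_space_axioms, of _ "\<lambda>x. x"] add by simp_all
    ultimately show ?case using tendsto_add[OF add.IH] by (simp add: filterlim_cong[OF refl refl])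
  qed
  have "(\<lambda>G. \<integral>w. f (Y G w) \<partial>M G) \<longlonglongrightarrow> (\<integral>z. f z \<partial>?Z)"
    if f: "continuous_on UNIV f" "bounded (range f)" for f :: "real^'q \<Rightarrow> real"
  proof (rule tendstoI)
    fix e :: real assume e: "0 < e"
    obtain K where K: "\<And>x. \<bar>f x\<bar> \<le> K" "0 < K"
      using f(2) unfolding bounded_pos by auto
    \<comment> \<open>Makes each of the two truncation errors at most e/4; with less than e/4 from
      the trigonometric polynomial the total stays below e.\<close>
    define \<epsilon> where "\<epsilon> = min 1 (e / (4 * (2 * K + 2)))"
    have eps: "0 < \<epsilon>" "\<epsilon> \<le> 1" "\<epsilon> + (K + (K + \<epsilon>)) * \<epsilon> \<le> e / 4"
    proof -
      show "0 < \<epsilon>" "\<epsilon> \<le> 1" using e K by (auto simp: \<epsilon>_def)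
      have "\<epsilon> + (K + (K + \<epsilon>)) * \<epsilon> \<le> (2 * K + 2) * \<epsilon>"
        using \<open>0 < \<epsilon>\<close> \<open>\<epsilon> \<le> 1\<close> mult_right_mono[of \<epsilon> 1 \<epsilon>] by (simp add: algebra_simps)
      also have "\<dots> \<le> (2 * K + 2) * (e / (4 * (2 * K + 2)))"
        using K by (intro mult_left_mono) (auto simp: \<epsilon>_def)
      also have "\<dots> = e / 4" using K by (simp add: field_simps)
      finally show "\<epsilon> + (K + (K + \<epsilon>)) * \<epsilon> \<le> e / 4" .
    qed
    obtain L1 where L1: "0 < L1" "\<forall>\<^sub>F G in sequentially. measure (M G) {w \<in> space (M G). L1 < norm (Y G w)} \<le> \<epsilon>"
      using tight eps(1) unfolding tight_seq_def by blast
    obtain L2 where L2: "\<And>L. L2 \<le> L \<Longrightarrow> measure ?Z {z \<in> space ?Z. L < norm z} \<le> \<epsilon>"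
      using Z.tail_small[of "\<lambda>z. z" \<epsilon>] eps(1) by auto
    define L where "L = max L1 L2"
    have L: "0 < L" using L1 by (simp add: L_def)
    obtain p where p: "trig_poly p" "\<And>x. \<bar>p x\<bar> \<le> K + \<epsilon>" "\<And>x. norm x \<le> L \<Longrightarrow> \<bar>f x - p x\<bar> \<le> \<epsilon>"
      using trig_poly_approximation[OF f(1) K(1) eps(1) L] by metis
    have [measurable]: "f \<in> borel_measurable borel" "p \<in> borel_measurable borel"
      using f(1) trig_poly_continuous[OF p(1)] by (auto intro: borel_measurable_continuous_onI)
    have Zb: "\<bar>(\<integral>z. f z \<partial>?Z) - (\<integral>z. p z \<partial>?Z)\<bar> \<le> e / 4"
      using Z.truncation_error[of "\<lambda>z. z" f p K "K + \<epsilon>" L \<epsilon> \<epsilon>] K(1) p L2[of L] eps by (simp add: L_def)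
    have "\<forall>\<^sub>F G in sequentially. dist (\<integral>w. p (Y G w) \<partial>M G) (\<integral>z. p z \<partial>?Z) < e / 4"
      using tendstoD[OF trig[OF p(1)], of "e / 4"] e by simp
    then show "\<forall>\<^sub>F G in sequentially. dist (\<integral>w. f (Y G w) \<partial>M G) (\<integral>z. f z \<partial>?Z) < e"
      using prob meas L1(2)
    proof eventually_elim
      case (elim G)
      interpret MG: prob_space "M G" by fact
      note [measurable] = \<open>Y G \<in> borel_measurable (M G)\<close>
      have "measure (M G) {w \<in> space (M G). L < norm (Y G w)} \<le> measure (M G) {w \<in> space (M G). L1 < norm (Y G w)}"
        by (intro MG.finite_measure_mono) (auto simp: L_def)
      then have "\<bar>(\<integral>w. f (Y G w) \<partial>M G) - (\<integral>w. p (Y G w) \<partial>M G)\<bar> \<le> e / 4"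
        using MG.truncation_error[of "Y G" f p K "K + \<epsilon>" L \<epsilon> \<epsilon>] K(1) p eps elim by simp
      then show ?case using Zb elim e unfolding dist_real_def by linarith
    qed
  qed
  then show ?thesis using meas by (simp add: converges_in_distribution_def)
qed


section \<open>The dyadic sample\<close>

lemma (in prob_space) bounded_vec_integrable:
  fixes f :: "'a \<Rightarrow> 'v::{banach,second_countable_topology}"
  assumes "f \<in> borel_measurable M" "\<And>w. norm (f w) \<le> c"
  shows "integrable M f"
  by (rule integrable_const_bound[of _ c]) (use assms in auto)

lemma integral_vec_nth:
  fixes f :: "'a \<Rightarrow> 'v::euclidean_space ^ 'n"
  assumes "integrable M f" shows "(\<integral>w. f w \<partial>M) $ i = (\<integral>w. f w $ i \<partial>M)"
  using integral_bounded_linear[OF bounded_linear_vec_nth assms] by simp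

lemma vec_norm_sq: "(norm (v :: real^'n))\<^sup>2 = (\<Sum>i\<in>UNIV. (v $ i)\<^sup>2)"
  by (simp only: power2_norm_eq_inner inner_vec_def) (simp add: power2_eq_square)

lemma mat_norm_sq: "(norm (A :: real^'n^'m))\<^sup>2 = (\<Sum>i\<in>UNIV. \<Sum>j\<in>UNIV. (A $ i $ j)\<^sup>2)"
  by (simp only: norm_matrix_sq_rows vec_norm_sq)

text \<open>Truncation turns the almost sure bounds into sure ones and, being applied to each observation,
  preserves the dependence structure.\<close>

definition trunc_x :: "real \<Rightarrow> (real^'k) \<times> real \<Rightarrow> real^'k" where
  "trunc_x C z = (if norm (fst z) \<le> C then fst z else 0)"
definition trunc_u :: "real \<Rightarrow> (real^'k) \<times> real \<Rightarrow> real" where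
  "trunc_u C z = (if \<bar>snd z\<bar> \<le> C then snd z else 0)"

lemma trunc_measurable [measurable]: "trunc_x C \<in> borel_measurable borel" "trunc_u C \<in> borel_measurable borel"
  unfolding trunc_x_def[abs_def] trunc_u_def[abs_def]
  by (auto simp: borel_prod[symmetric])

text \<open>One fixed G, so that all bounds become explicit in N, C, D and
  \<open>lambda_min \<Omega>\<close>.\<close>

locale dyadic_sample = prob_space M for M :: "'a measure" +
  fixes N :: nat and \<psi> :: "nat \<Rightarrow> nat set"
    and x :: "nat \<Rightarrow> 'a \<Rightarrow> real ^ 'k" and u :: "nat \<Rightarrow> 'a \<Rightarrow> real"
    and C D :: real
  assumes x_meas: "\<And>n. n \<in> {1..N} \<Longrightarrow> x n \<in> borel_measurable M"
    and u_meas: "\<And>n. n \<in> {1..N} \<Longrightarrow> u n \<in> borel_measurable M"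
    and nonempty: "\<And>n. n \<in> {1..N} \<Longrightarrow> \<psi> n \<noteq> {}"
    and degree_le: "\<And>n. n \<in> {1..N} \<Longrightarrow> real (card {m\<in>{1..N}. \<psi> n \<inter> \<psi> m \<noteq> {}}) \<le> D"
    and D_ge: "0 \<le> D" and N_pos: "0 < N" and C_nonneg: "0 \<le> C"
    and dyadic_dependence:
      "\<And>S\<^sub>1 S\<^sub>2. \<lbrakk>S\<^sub>1 \<subseteq> {1..N}; S\<^sub>2 \<subseteq> {1..N}; S\<^sub>1 \<inter> S\<^sub>2 = {};
                   \<forall>n\<in>S\<^sub>1. \<forall>m\<in>S\<^sub>2. \<psi> n \<inter> \<psi> m = {}\<rbrakk>
         \<Longrightarrow> indep_var
               (\<Pi>\<^sub>M n\<in>S\<^sub>1. borel) (\<lambda>\<omega>. \<lambda>n\<in>S\<^sub>1. (x n \<omega>, u n \<omega>))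
               (\<Pi>\<^sub>M n\<in>S\<^sub>2. borel) (\<lambda>\<omega>. \<lambda>n\<in>S\<^sub>2. (x n \<omega>, u n \<omega>))"
    and bounded_x: "\<And>n. n \<in> {1..N} \<Longrightarrow> AE w in M. norm (x n w) \<le> C"
    and bounded_u: "\<And>n. n \<in> {1..N} \<Longrightarrow> AE w in M. \<bar>u n w\<bar> \<le> C"
    and exogeneity: "\<And>n. n \<in> {1..N} \<Longrightarrow> (\<integral>w. u n w *\<^sub>R x n w \<partial>M) = 0"
begin

definition data where "data n w = (x n w, u n w)"
definition xt where "xt n w = trunc_x C (data n w)"
definition ut where "ut n w = trunc_u C (data n w)"

sublocale dependency_graph M "{1..N}" "\<lambda>n m. \<psi> n \<inter> \<psi> m \<noteq> {}" data D
proof (unfold_locales)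
  show "data n \<in> borel_measurable M" if "n \<in> {1..N}" for n
    unfolding data_def[abs_def] using x_meas[OF that] u_meas[OF that] by measurable
  show "indep_var (\<Pi>\<^sub>M n\<in>S\<^sub>1. borel) (\<lambda>w. \<lambda>n\<in>S\<^sub>1. data n w) (\<Pi>\<^sub>M n\<in>S\<^sub>2. borel) (\<lambda>w. \<lambda>n\<in>S\<^sub>2. data n w)"
    if S: "S\<^sub>1 \<subseteq> {1..N}" "S\<^sub>2 \<subseteq> {1..N}" "\<And>n m. n \<in> S\<^sub>1 \<Longrightarrow> m \<in> S\<^sub>2 \<Longrightarrow> \<not> \<psi> n \<inter> \<psi> m \<noteq> {}" for S\<^sub>1 S\<^sub>2
  proof -
    have "S\<^sub>1 \<inter> S\<^sub>2 = {}" using S nonempty by blast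
    \<comment> \<open>A nonempty dyad meets itself, so families without edges between them are
      disjoint, as the dyadic dependence condition asks.\<close>
    then show ?thesis unfolding data_def using S by (intro dyadic_dependence) auto
  qed
qed (use nonempty degree_le D_ge in auto)

lemma nb_iff: "m \<in> nb n \<longleftrightarrow> m \<in> {1..N} \<and> \<psi> n \<inter> \<psi> m \<noteq> {}"
  unfolding nb_def by blast

lemma trunc_AE: "AE w in M. \<forall>n\<in>{1..N}. x n w = xt n w \<and> u n w = ut n w"
proof (rule AE_finite_allI)
  fix n assume n: "n \<in> {1..N}"
  show "AE w in M. x n w = xt n w \<and> u n w = ut n w"
    using bounded_x[OF n] bounded_u[OF n]
    by eventually_elim (auto simp: xt_def ut_def data_def trunc_x_def trunc_u_def)
qed simp

lemma xt_bounded: "norm (xt n w) \<le> C" and ut_bounded: "\<bar>ut n w\<bar> \<le> C"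
  using C_nonneg by (auto simp: xt_def ut_def trunc_x_def trunc_u_def)

lemma trunc_bounded: "norm (trunc_x C z) \<le> C" "\<bar>trunc_u C z\<bar> \<le> C" "\<bar>trunc_x C z $ i\<bar> \<le> C"
proof -
  show "norm (trunc_x C z) \<le> C" "\<bar>trunc_u C z\<bar> \<le> C"
    using C_nonneg by (auto simp: trunc_x_def trunc_u_def)
  then show "\<bar>trunc_x C z $ i\<bar> \<le> C" using component_le_norm_cart order_trans by blast
qed

lemma xt_meas [measurable]: "n \<in> {1..N} \<Longrightarrow> xt n \<in> borel_measurable M"
  and ut_meas [measurable]: "n \<in> {1..N} \<Longrightarrow> ut n \<in> borel_measurable M"
  unfolding xt_def[abs_def] ut_def[abs_def]
  by (rule measurable_compose[OF d_meas trunc_measurable(1)] measurable_compose[OF d_meas trunc_measurable(2)]; simp)+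

lemma xt_nth_meas [measurable]: "n \<in> {1..N} \<Longrightarrow> (\<lambda>w. xt n w $ i) \<in> borel_measurable M"
  by (rule borel_measurable_vec_nth[OF xt_meas])

section \<open>Moments of the truncated sample\<close>

definition S where "S w = (\<Sum>n=1..N. ut n w *\<^sub>R xt n w)"
definition Qt where "Qt w = (1 / real N) *\<^sub>R (\<Sum>n=1..N. outer (xt n w) (xt n w))"
text \<open>The infeasible covariance estimator, with the true errors in place of the residuals;
  unbiased for \<open>\<Omega>\<close> by \<open>Omega_nth_mean\<close>.\<close>

definition \<Omega>t where "\<Omega>t w = (\<Sum>n=1..N. \<Sum>m\<in>nb n. (ut n w * ut m w) *\<^sub>R outer (xt n w) (xt m w))"
abbreviation "Q \<equiv> Q_pop M N x"
abbreviation "\<Omega> \<equiv> Omega_pop M N x u"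

lemma S_meas [measurable]: "S \<in> borel_measurable M"
  unfolding S_def[abs_def] by (intro borel_measurable_sum borel_measurable_scaleR ut_meas xt_meas)

lemma S_bounded: "norm (S w) \<le> real N * (C * C)"
proof -
  have "norm (S w) \<le> (\<Sum>n=1..N. norm (ut n w *\<^sub>R xt n w))" unfolding S_def by (rule norm_sum)
  also have "\<dots> \<le> (\<Sum>n=1..N. C * C)"
    unfolding norm_scaleR by (intro sum_mono mult_mono xt_bounded ut_bounded) (auto simp: C_nonneg)
  finally show ?thesis by simp
qed

lemma S_nth: "S w $ i = (\<Sum>n=1..N. ut n w * xt n w $ i)"
  by (simp add: S_def)

lemma ux_mean_zero: 
  assumes n: "n \<in> {1..N}" shows "expectation (\<lambda>w. ut n w * xt n w $ i) = 0"
proof -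
  have b: "norm (ut n w *\<^sub>R xt n w) \<le> C * C" for w
    unfolding norm_scaleR by (intro mult_mono xt_bounded ut_bounded) (auto simp: C_nonneg)
  have "(\<integral>w. ut n w *\<^sub>R xt n w \<partial>M) = (\<integral>w. u n w *\<^sub>R x n w \<partial>M)"
    using trunc_AE n x_meas[OF n] u_meas[OF n] xt_meas[OF n] ut_meas[OF n]
    by (intro integral_cong_AE) (auto elim: eventually_mono)
  then have "(\<integral>w. ut n w *\<^sub>R xt n w \<partial>M) $ i = 0" using exogeneity[OF n] by simp
  moreover have "integrable M (\<lambda>w. ut n w *\<^sub>R xt n w)"
    by (rule bounded_vec_integrable[OF _ b]) (use n in measurable)
  ultimately show ?thesis by (simp add: integral_vec_nth)
qed

lemma ux_single_integrable: "n \<in> {1..N} \<Longrightarrow> integrable M (\<lambda>w. ut n w * xt n w $ i)"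
proof (rule bounded_integrable[of _ "C * C"])
  show "\<bar>ut n w * xt n w $ i\<bar> \<le> C * C" for w
    unfolding abs_mult ut_def xt_def by (intro mult_mono trunc_bounded C_nonneg) simp
qed (intro borel_measurable_times ut_meas xt_nth_meas)

lemma S_mean_zero: "expectation (\<lambda>w. S w $ i) = 0"
proof -
  show ?thesis unfolding S_nth using ux_single_integrable by (simp add: ux_mean_zero)
qed

lemma score_sum_AE: "AE w in M. score_sum N x u w = S w"
  using trunc_AE by eventually_elim (auto simp: score_sum_def S_def)

lemma Omega_nth: "\<Omega> $ i $ j = expectation (\<lambda>w. S w $ i * S w $ j)"
proof -
  have m: "score_sum N x u \<in> borel_measurable M"
    unfolding score_sum_def[abs_def] by (intro borel_measurable_sum borel_measurable_scaleR u_meas x_meas)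
  have iS: "integrable M S" by (rule bounded_vec_integrable[OF S_meas S_bounded])
  have "(\<integral>w. score_sum N x u w \<partial>M) = (\<integral>w. S w \<partial>M)"
    by (rule integral_cong_AE[OF m S_meas score_sum_AE])
  also have "\<dots> = 0" using S_mean_zero by (simp add: vec_eq_iff integral_vec_nth[OF iS])
  finally have "\<Omega> = (\<integral>w. outer (score_sum N x u w) (score_sum N x u w) \<partial>M)"
    by (simp add: Omega_pop_def covariance_matrix_def)
  also have "\<dots> = (\<integral>w. outer (S w) (S w) \<partial>M)"
    using score_sum_AE m by (intro integral_cong_AE borel_measurable_outer S_meas) (auto elim: eventually_mono)
  finally have O: "\<Omega> = (\<integral>w. outer (S w) (S w) \<partial>M)" .
  have iO: "integrable M (\<lambda>w. outer (S w) (S w))"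
    by (rule bounded_vec_integrable[of _ "(real N * (C * C)) * (real N * (C * C))"])
       (auto simp: norm_outer intro!: borel_measurable_outer mult_mono S_bounded mult_nonneg_nonneg C_nonneg)
  then have iO1: "integrable M (\<lambda>w. outer (S w) (S w) $ i)"
    using integrable_bounded_linear[OF bounded_linear_vec_nth] by blast
  show ?thesis unfolding O by (simp add: integral_vec_nth[OF iO] integral_vec_nth[OF iO1]) (simp add: outer_def)
qed

lemma S_prod_integrable: "integrable M (\<lambda>w. S w $ i * S w $ j)"
proof (rule bounded_integrable[of _ "(real N * (C * C)) * (real N * (C * C))"])
  have "\<bar>S w $ i\<bar> \<le> real N * (C * C)" for w i using component_le_norm_cart[of "S w" i] S_bounded[of w] by linarith
  then show "\<bar>S w $ i * S w $ j\<bar> \<le> real N * (C * C) * (real N * (C * C))" for w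
    unfolding abs_mult by (intro mult_mono) (auto simp: C_nonneg)
qed (intro borel_measurable_times borel_measurable_vec_nth S_meas)

lemma Omega_quadratic_form: "v \<bullet> (\<Omega> *v v) = expectation (\<lambda>w. (v \<bullet> S w)\<^sup>2)"
proof -
  have "(v \<bullet> S w)\<^sup>2 = (\<Sum>i\<in>UNIV. \<Sum>j\<in>UNIV. (v $ i * v $ j) * (S w $ i * S w $ j))" for w
    by (simp add: inner_vec_def power2_eq_square sum_product mult_ac)
  then have "expectation (\<lambda>w. (v \<bullet> S w)\<^sup>2) = (\<Sum>i\<in>UNIV. \<Sum>j\<in>UNIV. (v $ i * v $ j) * \<Omega> $ i $ j)"
    using S_prod_integrable by (simp add: Omega_nth)
  then show ?thesis
    by (simp add: inner_vec_def matrix_vector_mult_def sum_distrib_left mult_ac)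
qed

lemma S_second_moment: "expectation (\<lambda>w. (norm (S w))\<^sup>2) \<le> CARD('k) * (2 * (C * C)\<^sup>2 * (N * D))"
proof -
  have "expectation (\<lambda>w. (S w $ i * S w $ i)) \<le> 2 * (C * C)\<^sup>2 * (N * D)" for i
  proof -
    have "expectation (\<lambda>w. ((\<Sum>n=1..N. trunc_u C (data n w) * trunc_x C (data n w) $ i)
        - expectation (\<lambda>w. \<Sum>n=1..N. trunc_u C (data n w) * trunc_x C (data n w) $ i))\<^sup>2) \<le> 2 * (C * C)\<^sup>2 * (card {1..N} * D)"
      by (rule single_sum_variance_bound[where f = "\<lambda>n z. trunc_u C z * trunc_x C z $ i"])
         (auto simp: abs_mult intro!: mult_mono trunc_bounded borel_measurable_times borel_measurable_vec_nth trunc_measurable C_nonneg)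
    then show ?thesis using S_mean_zero[of i] unfolding S_nth ut_def xt_def by (simp add: power2_eq_square)
  qed
  then have "(\<Sum>i\<in>UNIV. expectation (\<lambda>w. (S w $ i * S w $ i))) \<le> (\<Sum>i\<in>(UNIV :: 'k set). 2 * (C * C)\<^sup>2 * (N * D))"
    by (intro sum_mono)
  moreover have "expectation (\<lambda>w. (norm (S w))\<^sup>2) = (\<Sum>i\<in>UNIV. expectation (\<lambda>w. (S w $ i * S w $ i)))"
    using S_prod_integrable by (simp add: vec_norm_sq) (simp add: power2_eq_square)
  ultimately show ?thesis by simp
qed

text \<open>This upper bound of order N D converts smallness of N D^3 / \<lambda>^2 into smallness
  of D/N, hence into consistency of the Gram matrix.\<close>

lemma lambda_min_le_second_moment:
  assumes "pos_def \<Omega>"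
  shows "lambda_min \<Omega> \<le> CARD('k) * (2 * (C * C)\<^sup>2 * (N * D))"
proof -
  obtain v where v: "norm v = 1" "v \<bullet> (\<Omega> *v v) = lambda_min \<Omega>"
    using lambda_min_rayleigh(2)[OF pos_defD(1)[OF assms]] by blast
  have "lambda_min \<Omega> = expectation (\<lambda>w. (v \<bullet> S w)\<^sup>2)" using v Omega_quadratic_form by simp
  also have "\<dots> \<le> expectation (\<lambda>w. (norm (S w))\<^sup>2)"
  proof (rule integral_mono)
    have b: "(norm (S w))\<^sup>2 \<le> (real N * (C * C))\<^sup>2" for w by (intro power_mono S_bounded) auto
    have b': "(v \<bullet> S w)\<^sup>2 \<le> (norm (S w))\<^sup>2" for w
      using Cauchy_Schwarz_ineq2[of v "S w"] v(1) power_mono[of "\<bar>v \<bullet> S w\<bar>" "norm (S w)" 2] by simp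
    then show "(v \<bullet> S w)\<^sup>2 \<le> (norm (S w))\<^sup>2" for w .
    show "integrable M (\<lambda>w. (norm (S w))\<^sup>2)" by (rule bounded_integrable[of _ "(real N * (C * C))\<^sup>2"]) (use b in auto)
    show "integrable M (\<lambda>w. (v \<bullet> S w)\<^sup>2)"
      by (rule bounded_integrable[of _ "(real N * (C * C))\<^sup>2"]) (use order_trans[OF b' b] in auto)
  qed
  also have "\<dots> \<le> CARD('k) * (2 * (C * C)\<^sup>2 * (N * D))" by (rule S_second_moment)
  finally show ?thesis .
qed

lemma Q_nth: "Q $ i $ j = expectation (\<lambda>w. Qt w $ i $ j)"
proof -
  have m: "(\<lambda>w. outer (xt n w) (xt n w)) \<in> borel_measurable M" if "n \<in> {1..N}" for n
    using that by (intro borel_measurable_outer xt_meas)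
  have io: "integrable M (\<lambda>w. outer (xt n w) (xt n w))" if "n \<in> {1..N}" for n
    by (rule bounded_vec_integrable[OF m[OF that], of "C * C"])
       (auto simp: norm_outer intro!: mult_mono xt_bounded C_nonneg)
  have "(\<integral>w. outer (x n w) (x n w) \<partial>M) = (\<integral>w. outer (xt n w) (xt n w) \<partial>M)" if "n \<in> {1..N}" for n
    using trunc_AE that x_meas[OF that] m[OF that]
    by (intro integral_cong_AE borel_measurable_outer) (auto elim: eventually_mono)
  then have "Q = (1 / real N) *\<^sub>R (\<Sum>n=1..N. \<integral>w. outer (xt n w) (xt n w) \<partial>M)"
    by (simp add: Q_pop_def)
  also have "\<dots> = (\<integral>w. Qt w \<partial>M)" unfolding Qt_def using io by simp
  finally have Q: "Q = (\<integral>w. Qt w \<partial>M)" .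
  have iQ: "integrable M Qt" unfolding Qt_def[abs_def]
    by (intro integrable_scaleR_right Bochner_Integration.integrable_sum io)
  then have iQ1: "integrable M (\<lambda>w. Qt w $ i)"
    using integrable_bounded_linear[OF bounded_linear_vec_nth] by blast
  show ?thesis unfolding Q by (simp add: integral_vec_nth[OF iQ] integral_vec_nth[OF iQ1])
qed

lemma Qt_nth: "Qt w $ i $ j = (\<Sum>n=1..N. xt n w $ i * xt n w $ j) / real N"
  by (simp add: Qt_def outer_def)

lemma Qt_nth_bounded: "\<bar>Qt w $ i $ j\<bar> \<le> C * C"
proof -
  have "\<bar>\<Sum>n=1..N. xt n w $ i * xt n w $ j\<bar> \<le> (\<Sum>n=1..N. C * C)"
    unfolding xt_def
    by (rule order_trans[OF sum_abs sum_mono]) (auto simp: abs_mult intro!: mult_mono trunc_bounded C_nonneg)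
  then show ?thesis using N_pos by (simp add: Qt_nth divide_le_eq mult.commute)
qed

lemma Qt_meas [measurable]: "Qt \<in> borel_measurable M"
  unfolding Qt_def[abs_def] by (intro borel_measurable_scaleR borel_measurable_const borel_measurable_sum borel_measurable_outer xt_meas)

text \<open>Entry by entry, a sum of N bounded terms has variance of order N D, and division by N^2
  leaves D/N.\<close>

lemma Q_variance: "expectation (\<lambda>w. (norm (Qt w - Q))\<^sup>2) \<le> (CARD('k))\<^sup>2 * (2 * (C * C)\<^sup>2 * (D / N))"
proof -
  have e: "expectation (\<lambda>w. (Qt w $ i $ j - Q $ i $ j)\<^sup>2) \<le> 2 * (C * C)\<^sup>2 * (D / N)" for i j
  proof -
    define T where "T w = (\<Sum>n=1..N. trunc_x C (data n w) $ i * trunc_x C (data n w) $ j)" for w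
    have "expectation (\<lambda>w. (T w - expectation T)\<^sup>2) \<le> 2 * (C * C)\<^sup>2 * (card {1..N} * D)"
      unfolding T_def
      by (rule single_sum_variance_bound[where f = "\<lambda>n z. trunc_x C z $ i * trunc_x C z $ j"])
         (auto simp: abs_mult intro!: mult_mono trunc_bounded borel_measurable_times borel_measurable_vec_nth trunc_measurable C_nonneg)
    then have 1: "expectation (\<lambda>w. (T w - expectation T)\<^sup>2) \<le> 2 * (C * C)\<^sup>2 * (N * D)" by simp
    have T: "Qt w $ i $ j = T w / N" for w by (simp add: Qt_nth T_def xt_def)
    have "expectation (\<lambda>w. (Qt w $ i $ j - Q $ i $ j)\<^sup>2) = expectation (\<lambda>w. (T w - expectation T)\<^sup>2 / (real N)\<^sup>2)"
      by (simp add: Q_nth T diff_divide_distrib[symmetric] power_divide)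
    also have "\<dots> = expectation (\<lambda>w. (T w - expectation T)\<^sup>2) / (real N)\<^sup>2" by simp
    also have "\<dots> \<le> 2 * (C * C)\<^sup>2 * (N * D) / (real N)\<^sup>2" by (rule divide_right_mono[OF 1]) simp
    also have "\<dots> = 2 * (C * C)\<^sup>2 * (D / N)" by (simp add: power2_eq_square)
    finally show ?thesis .
  qed
  have i: "integrable M (\<lambda>w. (Qt w $ i $ j - Q $ i $ j)\<^sup>2)" for i j
  proof (rule bounded_integrable[of _ "(C * C + \<bar>Q $ i $ j\<bar>)\<^sup>2"])
    have "\<bar>Qt w $ i $ j - Q $ i $ j\<bar> \<le> C * C + \<bar>Q $ i $ j\<bar>" for w using Qt_nth_bounded[of w i j] by linarith
    then show "\<bar>(Qt w $ i $ j - Q $ i $ j)\<^sup>2\<bar> \<le> (C * C + \<bar>Q $ i $ j\<bar>)\<^sup>2" for w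
      using power_mono[OF _ abs_ge_zero, of "Qt w $ i $ j - Q $ i $ j" _ 2] by simp
  qed (intro borel_measurable_power borel_measurable_diff borel_measurable_vec_nth Qt_meas borel_measurable_const)
  have "expectation (\<lambda>w. (norm (Qt w - Q))\<^sup>2) = (\<Sum>i\<in>UNIV. \<Sum>j\<in>UNIV. expectation (\<lambda>w. (Qt w $ i $ j - Q $ i $ j)\<^sup>2))"
    unfolding mat_norm_sq using i by simp
  also have "\<dots> \<le> (\<Sum>i\<in>(UNIV :: 'k set). \<Sum>j\<in>(UNIV :: 'k set). 2 * (C * C)\<^sup>2 * (D / N))"
    by (intro sum_mono e)
  finally show ?thesis by (simp add: power2_eq_square)
qed

lemma Omegat_nth: "\<Omega>t w $ i $ j = (\<Sum>n=1..N. \<Sum>m\<in>nb n. (ut n w * xt n w $ i) * (ut m w * xt m w $ j))"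
  by (simp add: \<Omega>t_def outer_def mult_ac)

lemma Omegat_meas [measurable]: "\<Omega>t \<in> borel_measurable M"
proof -
  have "m \<in> {1..N}" if "m \<in> nb n" for n m using that nb_iff by blast
  then show ?thesis
    unfolding \<Omega>t_def[abs_def]
    by (intro borel_measurable_scaleR borel_measurable_sum borel_measurable_outer xt_meas borel_measurable_times ut_meas; blast)
qed

lemma ux_bounded: "\<bar>(ut n w * xt n w $ i) * (ut m w * xt m w $ j)\<bar> \<le> C * C * (C * C)"
  unfolding abs_mult xt_def ut_def by (intro mult_mono trunc_bounded mult_nonneg_nonneg C_nonneg) auto

lemma ux_integrable: "n \<in> {1..N} \<Longrightarrow> m \<in> {1..N} \<Longrightarrow> integrable M (\<lambda>w. (ut n w * xt n w $ i) * (ut m w * xt m w $ j))"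
  by (rule bounded_integrable[OF _ ux_bounded])
    (intro borel_measurable_times ut_meas xt_nth_meas; assumption)

lemma ux_uncorrelated:
  assumes "n \<in> {1..N}" "m \<in> {1..N}" "m \<notin> nb n"
  shows "expectation (\<lambda>w. (ut n w * xt n w $ i) * (ut m w * xt m w $ j)) = 0"
proof -
  have "expectation (\<lambda>w. (\<lambda>z. trunc_u C (z n) * trunc_x C (z n) $ i) (\<lambda>n\<in>{n}. data n w) * (\<lambda>z. trunc_u C (z m) * trunc_x C (z m) $ j) (\<lambda>n\<in>{m}. data n w))
    = expectation (\<lambda>w. (\<lambda>z. trunc_u C (z n) * trunc_x C (z n) $ i) (\<lambda>n\<in>{n}. data n w)) * expectation (\<lambda>w. (\<lambda>z. trunc_u C (z m) * trunc_x C (z m) $ j) (\<lambda>n\<in>{m}. data n w))"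
    by (rule expectation_mult_indep[where a = "C * C" and b = "C * C"])
       (use assms[unfolded nb_iff] in \<open>auto simp: abs_mult intro!: mult_mono trunc_bounded C_nonneg borel_measurable_times borel_measurable_vec_nth
          measurable_compose[OF _ trunc_measurable(1)] measurable_compose[OF _ trunc_measurable(2)] measurable_component_singleton\<close>)
  then show ?thesis using ux_mean_zero[OF assms(1)] by (simp add: xt_def ut_def)
qed

text \<open>As for \<open>expectation_T2\<close>: the omitted pairs are independent with mean
  zero.\<close>

lemma Omega_nth_mean: "expectation (\<lambda>w. \<Omega>t w $ i $ j) = \<Omega> $ i $ j"
proof -
  have nbI: "nb n \<subseteq> {1..N}" for n by (rule nb)
  have "expectation (\<lambda>w. \<Omega>t w $ i $ j) = (\<Sum>n=1..N. \<Sum>m\<in>nb n. expectation (\<lambda>w. (ut n w * xt n w $ i) * (ut m w * xt m w $ j)))"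
  proof -
    have "m \<in> {1..N}" if "m \<in> nb n" for n m using that nb_iff by blast
    then show ?thesis unfolding Omegat_nth using ux_integrable
      by (simp add: Bochner_Integration.integral_sum Bochner_Integration.integrable_sum del: atLeastAtMost_iff)
  qed
  also have "\<dots> = (\<Sum>n=1..N. \<Sum>m=1..N. expectation (\<lambda>w. (ut n w * xt n w $ i) * (ut m w * xt m w $ j)))"
    by (intro sum.cong refl sum.mono_neutral_left nbI ballI ux_uncorrelated) auto
  also have "\<dots> = expectation (\<lambda>w. \<Sum>n=1..N. \<Sum>m=1..N. (ut n w * xt n w $ i) * (ut m w * xt m w $ j))"
    using ux_integrable
    by (simp add: Bochner_Integration.integral_sum Bochner_Integration.integrable_sum del: atLeastAtMost_iff One_nat_def)
  also have "\<dots> = expectation (\<lambda>w. S w $ i * S w $ j)" by (simp add: S_nth sum_product)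
  finally show ?thesis by (simp add: Omega_nth)
qed

lemma Omega_variance: "expectation (\<lambda>w. (norm (\<Omega>t w - \<Omega>))\<^sup>2) \<le> (CARD('k))\<^sup>2 * (8 * (C ^ 4)\<^sup>2 * (N * D ^ 3))"
proof -
  have C4: "C * C * (C * C) = C ^ 4" by (simp add: eval_nat_numeral)
  have e: "expectation (\<lambda>w. (\<Omega>t w $ i $ j - \<Omega> $ i $ j)\<^sup>2) \<le> 8 * (C ^ 4)\<^sup>2 * (N * D ^ 3)" for i j
  proof -
    have "expectation (\<lambda>w. (\<Omega>t w $ i $ j - expectation (\<lambda>w. \<Omega>t w $ i $ j))\<^sup>2) \<le> 8 * (C ^ 4)\<^sup>2 * (card {1..N} * D ^ 3)"
      unfolding Omegat_nth ut_def xt_def C4[symmetric]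
      by (rule pair_sum_variance_bound[where f = "\<lambda>n m a b. (trunc_u C a * trunc_x C a $ i) * (trunc_u C b * trunc_x C b $ j)"])
         (auto simp: abs_mult intro!: mult_mono trunc_bounded mult_nonneg_nonneg borel_measurable_times borel_measurable_vec_nth
          measurable_compose[OF _ trunc_measurable(1)] measurable_compose[OF _ trunc_measurable(2)] C_nonneg)
    then show ?thesis by (simp add: Omega_nth_mean)
  qed
  have bnd: "\<bar>\<Omega>t w $ i $ j\<bar> \<le> (\<Sum>n=1..N. \<Sum>m\<in>nb n. C * C * (C * C))" for w i j
    unfolding Omegat_nth
    by (rule order_trans[OF sum_abs], rule sum_mono)+ (rule ux_bounded)
  have i: "integrable M (\<lambda>w. (\<Omega>t w $ i $ j - \<Omega> $ i $ j)\<^sup>2)" for i j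
  proof (rule bounded_integrable)
    let ?B = "(\<Sum>n=1..N. \<Sum>m\<in>nb n. C * C * (C * C)) + \<bar>\<Omega> $ i $ j\<bar>"
    have "\<bar>\<Omega>t w $ i $ j - \<Omega> $ i $ j\<bar> \<le> ?B" for w using bnd[of w i j] by linarith
    then show "\<bar>(\<Omega>t w $ i $ j - \<Omega> $ i $ j)\<^sup>2\<bar> \<le> ?B\<^sup>2" for w
      using power_mono[OF _ abs_ge_zero, of "\<Omega>t w $ i $ j - \<Omega> $ i $ j" ?B 2] by simp
  qed (intro borel_measurable_power borel_measurable_diff borel_measurable_vec_nth Omegat_meas borel_measurable_const)
  have "expectation (\<lambda>w. (norm (\<Omega>t w - \<Omega>))\<^sup>2) = (\<Sum>i\<in>UNIV. \<Sum>j\<in>UNIV. expectation (\<lambda>w. (\<Omega>t w $ i $ j - \<Omega> $ i $ j)\<^sup>2))"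
    unfolding mat_norm_sq using i by simp
  also have "\<dots> \<le> (\<Sum>i\<in>(UNIV :: 'k set). \<Sum>j\<in>(UNIV :: 'k set). 8 * (C ^ 4)\<^sup>2 * (N * D ^ 3))"
    by (intro sum_mono e)
  finally show ?thesis by (simp add: power2_eq_square)
qed

text \<open>The summands are normalised to u (a . x) / s, of size at most C^2 |a| / s. Since s^2 = a
  . \<Omega> a \<ge> \<lambda> |a|^2, this is at most C^2 / sqrt \<lambda>, so the
  \<open>\<epsilon>\<close> of the central limit theorem is at most e in every direction a. The
  uniformity matters because a will depend on R.\<close>

lemma score_char_bound:
  fixes a :: "real^'k"
  assumes pd: "pos_def \<Omega>" and s: "0 < s" "a \<bullet> (\<Omega> *v a) = s\<^sup>2"
  defines "e \<equiv> C ^ 8 * (N * D ^ 3 / (lambda_min \<Omega>)\<^sup>2)"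
  defines "r \<equiv> 3 * sqrt e + 4 * e"
  assumes eta: "0 < \<eta>" "r \<le> 1" "r * 40 < exp (- 1 - (14 + 2 / \<eta>)\<^sup>2)"
  shows "\<bar>expectation (\<lambda>w. cos (a \<bullet> S w + \<theta>)) - cos \<theta> * exp (- s\<^sup>2 / 2)\<bar> \<le> s * (\<eta> * s\<^sup>2 + (1 + s) ^ 3 * r)"
proof -
  define h where "h n z = (trunc_u C z * (a \<bullet> trunc_x C z)) / s" for n :: nat and z :: "(real^'k) \<times> real"
  define A where "A = norm a * (C * C) / s"
  have sum_h: "(\<Sum>n=1..N. h n (data n w)) = (a \<bullet> S w) / s" for w
    by (simp add: h_def S_def inner_sum_right sum_divide_distrib xt_def ut_def)
  interpret clt: dependent_sum M "{1..N}" "\<lambda>n m. \<psi> n \<inter> \<psi> m \<noteq> {}" data D h A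
  proof unfold_locales
    show "h n \<in> borel_measurable borel" for n
      unfolding h_def[abs_def] by (intro borel_measurable_divide borel_measurable_times borel_measurable_inner trunc_measurable borel_measurable_const)
    show "\<bar>h n z\<bar> \<le> A" for n z
    proof -
      have "\<bar>a \<bullet> trunc_x C z\<bar> \<le> norm a * C"
        using Cauchy_Schwarz_ineq2[of a "trunc_x C z"] trunc_bounded(1)[of z] by (meson mult_left_mono norm_ge_zero order_trans)
      then have "\<bar>trunc_u C z\<bar> * \<bar>a \<bullet> trunc_x C z\<bar> \<le> C * (norm a * C)"
        by (intro mult_mono trunc_bounded) (auto simp: C_nonneg)
      then show ?thesis using s(1) by (simp add: h_def A_def abs_mult divide_right_mono mult_ac)
    qed
    fix n assume n: "n \<in> {1..N}"
    have "expectation (\<lambda>w. h n (data n w)) = expectation (\<lambda>w. \<Sum>i\<in>UNIV. (a $ i / s) * (ut n w * xt n w $ i))"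
      by (simp add: h_def inner_vec_def xt_def ut_def sum_distrib_left sum_divide_distrib mult_ac)
    also have "\<dots> = (\<Sum>i\<in>UNIV. (a $ i / s) * expectation (\<lambda>w. ut n w * xt n w $ i))"
      using ux_single_integrable[OF n] by simp
    finally show "expectation (\<lambda>w. h n (data n w)) = 0" using ux_mean_zero[OF n] by simp
  next
    have "expectation (\<lambda>w. (\<Sum>n=1..N. h n (data n w))\<^sup>2) = expectation (\<lambda>w. (a \<bullet> S w)\<^sup>2 / s\<^sup>2)"
      unfolding sum_h power_divide ..
    then show "expectation (\<lambda>w. (\<Sum>n=1..N. h n (data n w))\<^sup>2) = 1"
      using s Omega_quadratic_form[of a] by simp
  qed
  have W: "clt.W w = (a \<bullet> S w) / s" for w unfolding clt.W_def clt.X_def sum_h ..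
  have lpos: "0 < lambda_min \<Omega>" by (rule lambda_min_pos[OF pd])
  have "lambda_min \<Omega> * (norm a)\<^sup>2 \<le> s\<^sup>2"
    using lambda_min_rayleigh(1)[OF pos_defD(1)[OF pd], of a] s by (simp add: power2_norm_eq_inner)
  then have "(norm a / s)\<^sup>2 \<le> 1 / lambda_min \<Omega>"
    using s lpos by (simp add: power_divide field_simps)
  then have "((norm a / s)\<^sup>2)\<^sup>2 \<le> (1 / lambda_min \<Omega>)\<^sup>2" by (intro power_mono) auto
  then have na: "(norm a / s) ^ 4 \<le> 1 / (lambda_min \<Omega>)\<^sup>2" by (simp add: power_divide)
  have "clt.\<epsilon> = C ^ 8 * (N * D ^ 3) * (norm a / s) ^ 4"
    unfolding clt.\<epsilon>_def unfolding A_def by (simp add: power_mult_distrib power_divide eval_nat_numeral)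
  also have "\<dots> \<le> C ^ 8 * (N * D ^ 3) * (1 / (lambda_min \<Omega>)\<^sup>2)"
    using na C_nonneg D_nonneg by (intro mult_left_mono) auto
  finally have eps: "clt.\<epsilon> \<le> e" by (simp add: e_def)
  have "sqrt clt.\<epsilon> \<le> sqrt e" by (rule real_sqrt_le_mono[OF eps])
  then have rho: "clt.\<rho> \<le> r" unfolding clt.\<rho>_def r_def using eps by linarith
  have "\<bar>clt.\<kappa>\<bar> < \<eta>" using clt.kappa_small[OF eta(1)] rho eta(2,3) by linarith
  have "\<bar>expectation (\<lambda>w. cos (s * clt.W w + \<theta>)) - cos \<theta> * exp (- s\<^sup>2 / 2)\<bar> \<le> s * (\<bar>clt.\<kappa>\<bar> * s\<^sup>2 + (1 + s) ^ 3 * clt.\<rho>)"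
    by (rule clt.cos_expectation_bound) (use s in simp)
  also have "\<dots> \<le> s * (\<eta> * s\<^sup>2 + (1 + s) ^ 3 * r)"
    using \<open>\<bar>clt.\<kappa>\<bar> < \<eta>\<close> rho s by (intro mult_left_mono add_mono mult_right_mono) auto
  also have "(\<lambda>w. cos (s * clt.W w + \<theta>)) = (\<lambda>w. cos (a \<bullet> S w + \<theta>))" unfolding W using s(1) by simp
  finally show ?thesis .
qed

end


section \<open>Perturbation of the sandwich estimator\<close>

lemma transpose_gram: "transpose (gram N xs) = gram N xs"
  by (simp add: gram_def vec_eq_iff transpose_def outer_def mult.commute)

lemma gram_mult_vec: "gram N xs *v b = (\<Sum>n=1..N. (b \<bullet> xs n) *\<^sub>R xs n)"
  unfolding gram_def
  by (induction N) (simp_all add: matrix_vector_mult_add_rdistrib outer_mult_vec inner_commute)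

lemma beta_hat_error:
  assumes inv: "invertible (gram N xs)" and y: "\<And>n. n \<in> {1..N} \<Longrightarrow> ys n = \<beta> \<bullet> xs n + us n"
  shows "beta_hat N xs ys - \<beta> = matrix_inv (gram N xs) *v (\<Sum>n=1..N. us n *\<^sub>R xs n)"
proof -
  have "(\<Sum>n=1..N. ys n *\<^sub>R xs n) = gram N xs *v \<beta> + (\<Sum>n=1..N. us n *\<^sub>R xs n)"
    unfolding gram_mult_vec sum.distrib[symmetric] by (intro sum.cong refl) (simp add: y scaleR_left_distrib)
  then have "beta_hat N xs ys = (matrix_inv (gram N xs) ** gram N xs) *v \<beta> + matrix_inv (gram N xs) *v (\<Sum>n=1..N. us n *\<^sub>R xs n)"
    using inv by (simp add: beta_hat_def matrix_vector_right_distrib matrix_vector_mul_assoc)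
  then show ?thesis by (simp add: matrix_inv[OF inv])
qed

lemma residual_eq:
  assumes "ys n = \<beta> \<bullet> xs n + us n"
  shows "residual N xs ys n = us n - (beta_hat N xs ys - \<beta>) \<bullet> xs n"
  using assms by (simp add: residual_def inner_diff_left)

lemma transpose_Omega_hat: "transpose (Omega_hat N \<psi> xs ys) = Omega_hat N \<psi> xs ys"
proof -
  have "Omega_hat N \<psi> xs ys $ j $ i = Omega_hat N \<psi> xs ys $ i $ j" for i j
    unfolding Omega_hat_def
    by (simp add: outer_def) (subst sum.swap, simp add: Int_commute mult_ac)
  then show ?thesis by (simp add: vec_eq_iff transpose_def)
qed

text \<open>Pathwise analysis: xs, us and ys are one realised sample, for which the bounds hold
  surely.\<close>

locale sample_bounds =
  fixes N :: nat and \<psi> :: "nat \<Rightarrow> nat set" and xs :: "nat \<Rightarrow> real^'k" and us ys :: "nat \<Rightarrow> real"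
    and \<beta> :: "real^'k" and C D :: real
  assumes xb: "\<And>n. n \<in> {1..N} \<Longrightarrow> norm (xs n) \<le> C" and ub: "\<And>n. n \<in> {1..N} \<Longrightarrow> \<bar>us n\<bar> \<le> C"
    and y: "\<And>n. n \<in> {1..N} \<Longrightarrow> ys n = \<beta> \<bullet> xs n + us n"
    and deg: "\<And>n. n \<in> {1..N} \<Longrightarrow> real (card {m\<in>{1..N}. \<psi> n \<inter> \<psi> m \<noteq> {}}) \<le> D"
    and C1: "1 \<le> C" and D0: "0 \<le> D" and N0: "0 < N"
begin

definition nbs where "nbs n = {m\<in>{1..N}. \<psi> n \<inter> \<psi> m \<noteq> {}}"
definition err where "err = beta_hat N xs ys - \<beta>"
definition score where "score = (\<Sum>n=1..N. us n *\<^sub>R xs n)"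
definition Omega_true where "Omega_true = (\<Sum>n=1..N. \<Sum>m\<in>nbs n. (us n * us m) *\<^sub>R outer (xs n) (xs m))"

lemma Omega_hat_nbs:
  "Omega_hat N \<psi> xs ys = (\<Sum>n=1..N. \<Sum>m\<in>nbs n. (residual N xs ys n * residual N xs ys m) *\<^sub>R outer (xs n) (xs m))"
  unfolding Omega_hat_def
proof (rule sum.cong[OF refl])
  fix n
  show "(\<Sum>m=1..N. (of_bool (\<psi> n \<inter> \<psi> m \<noteq> {}) * residual N xs ys n * residual N xs ys m) *\<^sub>R outer (xs n) (xs m))
    = (\<Sum>m\<in>nbs n. (residual N xs ys n * residual N xs ys m) *\<^sub>R outer (xs n) (xs m))"
    unfolding nbs_def by (rule sum.mono_neutral_cong_right) auto
qed

lemma neighbour_sum_bound: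
  fixes F :: "nat \<Rightarrow> nat \<Rightarrow> 'v::real_normed_vector"
  assumes "\<And>n m. n \<in> {1..N} \<Longrightarrow> m \<in> {1..N} \<Longrightarrow> norm (F n m) \<le> c" "0 \<le> c"
  shows "norm (\<Sum>n=1..N. \<Sum>m\<in>nbs n. F n m) \<le> N * D * c"
proof -
  have "norm (\<Sum>n=1..N. \<Sum>m\<in>nbs n. F n m) \<le> (\<Sum>n=1..N. D * c)"
  proof (rule order_trans[OF norm_sum sum_mono])
    fix n assume n: "n \<in> {1..N}"
    have "norm (\<Sum>m\<in>nbs n. F n m) \<le> (\<Sum>m\<in>nbs n. c)"
      by (rule order_trans[OF norm_sum sum_mono]) (use n assms in \<open>auto simp: nbs_def\<close>)
    also have "\<dots> \<le> D * c" using deg[OF n] assms(2) by (simp add: nbs_def mult_right_mono)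
    finally show "norm (\<Sum>m\<in>nbs n. F n m) \<le> D * c" .
  qed
  then show ?thesis by simp
qed

lemma err_inner_bound: "n \<in> {1..N} \<Longrightarrow> \<bar>err \<bullet> xs n\<bar> \<le> norm err * C"
  using Cauchy_Schwarz_ineq2[of err "xs n"] xb[of n] by (meson mult_left_mono norm_ge_zero order_trans)

lemma outer_bound: "n \<in> {1..N} \<Longrightarrow> m \<in> {1..N} \<Longrightarrow> norm (outer (xs n) (xs m)) \<le> C * C"
  unfolding norm_outer using xb[of n] xb[of m] C1 by (intro mult_mono) auto

text \<open>With a = err . x_n and b = err . x_m, the product of residuals differs from u_n u_m by
  -u_n b - u_m a + a b. Since |err| \<le> 1, the quadratic term obeys the same bound as the linear
  ones, whence the factor 3.\<close>

lemma Omega_hat_deviation: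
  assumes "norm err \<le> 1"
  shows "norm (Omega_hat N \<psi> xs ys - Omega_true) \<le> N * D * (3 * C ^ 4 * norm err)"
proof -
  have "norm (((residual N xs ys n * residual N xs ys m) - us n * us m) *\<^sub>R outer (xs n) (xs m)) \<le> 3 * C ^ 4 * norm err"
    if n: "n \<in> {1..N}" "m \<in> {1..N}" for n m
  proof -
    define a b where "a = err \<bullet> xs n" and "b = err \<bullet> xs m"
    have ab: "\<bar>a\<bar> \<le> norm err * C" "\<bar>b\<bar> \<le> norm err * C" using err_inner_bound n by (auto simp: a_def b_def)
    have C0: "0 \<le> C" using C1 by simp
    have "norm err * C * (norm err * C) = norm err * (norm err * (C * C))" by simp
    also have "\<dots> \<le> norm err * (1 * (C * C))" using assms by (intro mult_left_mono mult_right_mono) auto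
    finally have "\<bar>a * b\<bar> \<le> norm err * (C * C)"
      using mult_mono[OF ab] C0 by (simp add: abs_mult)
    moreover have "\<bar>us n * b\<bar> \<le> C * (norm err * C)" "\<bar>us m * a\<bar> \<le> C * (norm err * C)"
      unfolding abs_mult using ub n ab C0 by (intro mult_mono; auto)+
    moreover have "residual N xs ys n * residual N xs ys m - us n * us m = - (us n * b) - us m * a + a * b"
      unfolding residual_eq[of ys n \<beta> xs us, OF y[OF n(1)]] residual_eq[of ys m \<beta> xs us, OF y[OF n(2)]] err_def[symmetric] a_def[symmetric] b_def[symmetric]
      by (simp add: algebra_simps)
    ultimately have "\<bar>residual N xs ys n * residual N xs ys m - us n * us m\<bar> \<le> 3 * (norm err * (C * C))"
      by (simp add: mult_ac)
    then have "\<bar>residual N xs ys n * residual N xs ys m - us n * us m\<bar> * norm (outer (xs n) (xs m)) \<le> 3 * (norm err * (C * C)) * (C * C)"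
      by (intro mult_mono outer_bound n) auto
    then show ?thesis by (simp add: eval_nat_numeral mult_ac)
  qed
  then have "norm (\<Sum>n=1..N. \<Sum>m\<in>nbs n. ((residual N xs ys n * residual N xs ys m) - us n * us m) *\<^sub>R outer (xs n) (xs m)) \<le> N * D * (3 * C ^ 4 * norm err)"
    using C1 by (intro neighbour_sum_bound) auto
  moreover have "Omega_hat N \<psi> xs ys - Omega_true = (\<Sum>n=1..N. \<Sum>m\<in>nbs n. ((residual N xs ys n * residual N xs ys m) - us n * us m) *\<^sub>R outer (xs n) (xs m))"
    unfolding Omega_hat_nbs Omega_true_def by (simp only: sum_subtractf[symmetric] scaleR_left_diff_distrib)
  ultimately show ?thesis by simp
qed

text \<open>The crude order N D is enough: it will be multiplied by the error of
  \<open>Q_hat\<close>, of order sqrt(D/N), and sqrt(D/N) N D = sqrt(N D^3).\<close>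

lemma Omega_hat_bound:
  assumes "norm err \<le> 1"
  shows "norm (Omega_hat N \<psi> xs ys) \<le> N * D * (4 * C ^ 4)"
  unfolding Omega_hat_nbs
proof (rule neighbour_sum_bound)
  have r: "\<bar>residual N xs ys n\<bar> \<le> 2 * C" if n: "n \<in> {1..N}" for n
  proof -
    have "norm err * C \<le> 1 * C" using assms C1 by (intro mult_right_mono) auto
    then have "\<bar>err \<bullet> xs n\<bar> \<le> C" using err_inner_bound[OF n] by linarith
    then show ?thesis using residual_eq[of ys n \<beta> xs us N, OF y[OF n]] ub[OF n] unfolding err_def by linarith
  qed
  fix n m assume n: "n \<in> {1..N}" "m \<in> {1..N}"
  have "\<bar>residual N xs ys n\<bar> * \<bar>residual N xs ys m\<bar> * norm (outer (xs n) (xs m)) \<le> (2 * C) * (2 * C) * (C * C)"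
    using C1 by (intro mult_mono r n outer_bound mult_nonneg_nonneg) auto
  then show "norm ((residual N xs ys n * residual N xs ys m) *\<^sub>R outer (xs n) (xs m)) \<le> 4 * C ^ 4"
    by (simp add: abs_mult eval_nat_numeral mult_ac)
qed (use C1 in simp)

end

text \<open>In the notation of the sample: \<open>A = V\<^sup>-\<^sup>1\<^sup>/\<^sup>2 R' Q\<^sup>-\<^sup>1 / N\<close> is an isometry for \<open>\<Omega>\<close>, and replacing \<open>Q\<close> by its
  estimate replaces \<open>A\<close> by \<open>A + A (Q - Qhat) Qhat\<^sup>-\<^sup>1\<close>.\<close>

locale sandwich_perturbation = sample_bounds N \<psi> xs us ys \<beta> C D
  for N :: nat and \<psi> :: "nat \<Rightarrow> nat set" and xs :: "nat \<Rightarrow> real^'k" and us ys :: "nat \<Rightarrow> real"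
    and \<beta> :: "real^'k" and C D :: real +
  fixes Q \<Omega> :: "real^'k^'k" and R :: "real^'q^'k" and c\<^sub>Q l :: real
  assumes Q: "pos_def Q" "0 < c\<^sub>Q" "\<And>v. c\<^sub>Q * (v \<bullet> v) \<le> v \<bullet> (Q *v v)"
    and Omega: "pos_def \<Omega>" "0 < l" "\<And>v. l * (v \<bullet> v) \<le> v \<bullet> (\<Omega> *v v)"
    and R: "\<And>v. R *v v = 0 \<Longrightarrow> v = 0"
begin

abbreviation "V \<equiv> (1 / (real N)\<^sup>2) *\<^sub>R (matrix_inv Q ** \<Omega> ** matrix_inv Q)"
definition P where "P = mat_inv_sqrt (sandwich R V)"
definition A where "A = (1 / real N) *\<^sub>R (P ** transpose R ** matrix_inv Q)"
abbreviation "Qh \<equiv> Q_hat N xs"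
definition Ah where "Ah = (1 / real N) *\<^sub>R (P ** transpose R ** matrix_inv Qh)"

lemma pos_def_V: "pos_def (sandwich R V)"
proof -
  note inv = pos_def_invertible[OF Q(1)]
  have "v = 0" if "matrix_inv Q *v v = 0" for v
    by (metis that inv matrix_inv(1) matrix_vector_mul_assoc matrix_vector_mul_lid matrix_vector_mult_0_right)
  then have "pos_def (transpose (matrix_inv Q) ** \<Omega> ** matrix_inv Q)"
    by (intro pos_def_congruence Omega)
  then have "pos_def V" using N0 pos_defD(1)[OF pos_def_matrix_inv[OF Q(1)]] by (intro pos_def_scaleR) auto
  then show ?thesis unfolding sandwich_def by (rule pos_def_congruence[OF _ R])
qed

lemma P: "pos_def P" "transpose P = P" "P ** sandwich R V ** P = mat 1"
  using mat_inv_sqrt[OF pos_def_V] pos_defD(1) by (auto simp: P_def)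

lemma A_isometry: "A ** \<Omega> ** transpose A = mat 1"
proof -
  have tQ: "transpose (matrix_inv Q) = matrix_inv Q" using pos_defD(1)[OF pos_def_matrix_inv[OF Q(1)]] .
  have "A ** \<Omega> ** transpose A = P ** sandwich R V ** P"
    by (simp add: A_def sandwich_def transpose_scalar matrix_transpose_mul tQ P(2) mat_algebra power2_eq_square)
  then show ?thesis using P by simp
qed

text \<open>By \<open>A_isometry\<close> the transpose of A carries the Euclidean norm to the
  quadratic form of \<Omega>, which dominates l |v|^2. Hence the bound is free of R.\<close>

lemma norm_A: "norm A \<le> sqrt CARD('q) / sqrt l"
proof -
  have "norm (transpose A *v v) \<le> 1 / sqrt l * norm v" for v
  proof -
    have "l * ((transpose A *v v) \<bullet> (transpose A *v v)) \<le> (transpose A *v v) \<bullet> (\<Omega> *v (transpose A *v v))" by (rule Omega)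
    also have "\<dots> = v \<bullet> ((A ** \<Omega> ** transpose A) *v v)"
      by (simp only: transpose_dot matrix_vector_mul_assoc matrix_mul_assoc)
    also have "\<dots> = v \<bullet> v" by (simp add: A_isometry)
    finally have "(sqrt l * norm (transpose A *v v))\<^sup>2 \<le> (norm v)\<^sup>2"
      using Omega(2) by (simp only: power_mult_distrib power2_norm_eq_inner) simp
    then have "sqrt l * norm (transpose A *v v) \<le> norm v" by (rule power2_le_imp_le) simp
    then show ?thesis using Omega(2) by (simp add: field_simps del: transpose_matrix_vector)
  qed
  then have "norm (transpose A) \<le> sqrt CARD('q) * (1 / sqrt l)"
    using Omega(2) by (intro norm_le_op_bound) auto
  then show ?thesis by simp
qed

context
  assumes close: "norm (Qh - Q) \<le> c\<^sub>Q / 2"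
begin

lemma Qh_coercive: "c\<^sub>Q / 2 * (v \<bullet> v) \<le> v \<bullet> (Qh *v v)"
proof -
  have "norm ((Qh - Q) *v v) \<le> c\<^sub>Q / 2 * norm v"
    using norm_matrix_vector_mult_le[of "Qh - Q" v] close by (meson mult_right_mono norm_ge_zero order_trans)
  then have "\<bar>v \<bullet> ((Qh - Q) *v v)\<bar> \<le> norm v * (c\<^sub>Q / 2 * norm v)"
    by (meson Cauchy_Schwarz_ineq2 mult_left_mono norm_ge_zero order_trans)
  moreover have "norm v * (c\<^sub>Q / 2 * norm v) = c\<^sub>Q / 2 * (v \<bullet> v)"
    by (simp add: power2_norm_eq_inner[symmetric] power2_eq_square)
  moreover have "v \<bullet> (Qh *v v) = v \<bullet> (Q *v v) + v \<bullet> ((Qh - Q) *v v)"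
    by (simp add: matrix_vector_mult_diff_rdistrib inner_diff_right)
  ultimately show ?thesis using Q(3)[of v] by linarith
qed

lemma Qh_inverse: "invertible Qh" "norm (matrix_inv Qh) \<le> 2 * sqrt CARD('k) / c\<^sub>Q"
  using coercive_invertible(1,3)[OF _ Qh_coercive] Q(2) by (auto simp: field_simps)

lemma invertible_gram: "invertible (gram N xs)"
proof -
  have "gram N xs = real N *\<^sub>R Qh" using N0 by (simp add: Q_hat_def)
  then show ?thesis using Qh_inverse(1) N0 scalar_invertible[of "real N" Qh] by simp
qed

lemma matrix_inv_gram: "matrix_inv (gram N xs) = (1 / real N) *\<^sub>R matrix_inv Qh"
proof -
  have "matrix_inv Qh = real N *\<^sub>R matrix_inv (gram N xs)"
    unfolding Q_hat_def using N0 by (subst matrix_inv_scaleR) (auto simp: invertible_gram)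
  then show ?thesis using N0 by simp
qed

lemma err_eq: "err = (1 / real N) *\<^sub>R (matrix_inv Qh *v score)"
proof -
  have "err = matrix_inv (gram N xs) *v score"
    unfolding err_def score_def by (rule beta_hat_error[OF invertible_gram y])
  then show ?thesis by (simp add: matrix_inv_gram scaleR_matrix_vector_assoc)
qed

lemma norm_err: "norm err \<le> 2 * sqrt CARD('k) / c\<^sub>Q * norm score / N"
proof -
  have "norm err = norm (matrix_inv Qh *v score) / N" unfolding err_eq by simp
  also have "\<dots> \<le> norm (matrix_inv Qh) * norm score / N"
    by (intro divide_right_mono norm_matrix_vector_mult_le) simp
  also have "\<dots> \<le> 2 * sqrt CARD('k) / c\<^sub>Q * norm score / N"
    by (intro divide_right_mono mult_right_mono Qh_inverse) auto
  finally show ?thesis .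
qed

text \<open>The resolvent identity, with P R' Q^(-1) regrouped into A so that the error is relative
  to A and not to R.\<close>

lemma Ah_minus_A: "Ah - A = A ** (Q - Qh) ** matrix_inv Qh"
proof -
  note iQ = matrix_inv[OF pos_def_invertible[OF Q(1)]]
  have "A ** Q = (1 / real N) *\<^sub>R (P ** transpose R ** (matrix_inv Q ** Q))"
    by (simp add: A_def mat_algebra)
  then have AQ: "A ** Q = (1 / real N) *\<^sub>R (P ** transpose R)" by (simp add: iQ)
  have "A ** (Q - Qh) ** matrix_inv Qh = A ** Q ** matrix_inv Qh - A ** (Qh ** matrix_inv Qh)"
    by (simp add: mat_algebra)
  then show ?thesis by (simp add: AQ Ah_def matrix_inv[OF Qh_inverse(1)] matrix_mul_scaleR_left)
qed

lemma norm_Ah_minus_A: "norm (Ah - A) \<le> norm A * (norm (Qh - Q) * (2 * sqrt CARD('k) / c\<^sub>Q))"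
proof -
  have "norm (Ah - A) \<le> norm A * norm (Q - Qh) * norm (matrix_inv Qh)"
    unfolding Ah_minus_A by (rule norm_matrix_mul3_le)
  also have "\<dots> \<le> norm A * norm (Q - Qh) * (2 * sqrt CARD('k) / c\<^sub>Q)"
    by (intro mult_left_mono Qh_inverse) auto
  finally show ?thesis by (simp add: norm_minus_commute mult.assoc)
qed

lemma scaled_error: "P *v (transpose R *v err) = Ah *v score"
  by (simp add: err_eq Ah_def matrix_vector_mult_scaleR scaleR_matrix_vector_assoc[symmetric]
      matrix_vector_mul_assoc matrix_mul_assoc del: transpose_matrix_vector)

lemma transpose_Qh: "transpose (matrix_inv Qh) = matrix_inv Qh"
  using matrix_inv_transpose[OF Qh_inverse(1)] by (simp add: Q_hat_def transpose_scalar transpose_gram)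

lemma V_hat_eq: "V_hat N \<psi> xs ys = (1 / (real N)\<^sup>2) *\<^sub>R (matrix_inv Qh ** Omega_hat N \<psi> xs ys ** matrix_inv Qh)"
  by (simp add: V_hat_def invertible_gram)

lemma scaled_V_hat: "P ** sandwich R (V_hat N \<psi> xs ys) ** P = Ah ** Omega_hat N \<psi> xs ys ** transpose Ah"
  by (simp add: Ah_def V_hat_eq sandwich_def transpose_scalar matrix_transpose_mul transpose_Qh P(2) mat_algebra power2_eq_square)

lemma transpose_sandwich_V_hat: "transpose (sandwich R (V_hat N \<psi> xs ys)) = sandwich R (V_hat N \<psi> xs ys)"
  by (simp add: V_hat_eq sandwich_def transpose_scalar matrix_transpose_mul transpose_Qh transpose_Omega_hat mat_algebra)

lemma scaled_error_deviation:
  "norm (P *v (transpose R *v err) - A *v score)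
    \<le> sqrt CARD('q) / sqrt l * (norm (Qh - Q) * (2 * sqrt CARD('k) / c\<^sub>Q)) * norm score"
proof -
  have "P *v (transpose R *v err) - A *v score = (Ah - A) *v score"
    unfolding scaled_error by (simp add: matrix_vector_mult_diff_rdistrib)
  then have "norm (P *v (transpose R *v err) - A *v score) \<le> norm (Ah - A) * norm score"
    by (simp add: norm_matrix_vector_mult_le del: transpose_matrix_vector)
  also have "\<dots> \<le> norm A * (norm (Qh - Q) * (2 * sqrt CARD('k) / c\<^sub>Q)) * norm score"
    by (intro mult_right_mono norm_Ah_minus_A) simp
  also have "\<dots> \<le> sqrt CARD('q) / sqrt l * (norm (Qh - Q) * (2 * sqrt CARD('k) / c\<^sub>Q)) * norm score"
    using Q(2) by (intro mult_right_mono norm_A) auto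
  finally show ?thesis .
qed

text \<open>Substitute Ah = A + E and I = A \<Omega> A'. The term in Oh - \<Omega> carries the error
  of the covariance estimator; the two cross terms and the quadratic one, with |E| \<le> |A| t, give
  2 t + t^2.\<close>

lemma scaled_V_hat_deviation:
  defines "t \<equiv> norm (Qh - Q) * (2 * sqrt CARD('k) / c\<^sub>Q)" and "Oh \<equiv> Omega_hat N \<psi> xs ys"
  shows "norm (P ** sandwich R (V_hat N \<psi> xs ys) ** P - mat 1)
    \<le> CARD('q) / l * (norm (Oh - \<Omega>) + (2 * t + t\<^sup>2) * norm Oh)"
proof -
  define E where "E = Ah - A"
  have t0: "0 \<le> t" using Q(2) by (simp add: t_def)
  have E: "norm E \<le> norm A * t" unfolding E_def t_def by (rule norm_Ah_minus_A)
  have Ah: "Ah = A + E" by (simp add: E_def)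
  have "P ** sandwich R (V_hat N \<psi> xs ys) ** P - mat 1 = A ** (Oh - \<Omega>) ** transpose A + E ** Oh ** transpose A
     + A ** Oh ** transpose E + E ** Oh ** transpose E"
    unfolding scaled_V_hat Ah Oh_def A_isometry[symmetric] transpose_plus by (simp add: mat_algebra)
  then have "norm (P ** sandwich R (V_hat N \<psi> xs ys) ** P - mat 1) \<le> norm (A ** (Oh - \<Omega>) ** transpose A)
     + norm (E ** Oh ** transpose A) + norm (A ** Oh ** transpose E) + norm (E ** Oh ** transpose E)"
    by (smt (verit) norm_triangle_ineq)
  also have "\<dots> \<le> norm A * norm (Oh - \<Omega>) * norm A + norm E * norm Oh * norm A + norm A * norm Oh * norm E + norm E * norm Oh * norm E"
    by (intro add_mono; rule order_trans[OF norm_matrix_mul3_le]; simp)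
  also have "\<dots> \<le> norm A * norm (Oh - \<Omega>) * norm A + (norm A * t) * norm Oh * norm A + norm A * norm Oh * (norm A * t)
      + (norm A * t) * norm Oh * (norm A * t)"
    using t0 by (intro add_mono mult_mono E order_refl mult_nonneg_nonneg) auto
  also have "\<dots> = (norm A)\<^sup>2 * (norm (Oh - \<Omega>) + (2 * t + t\<^sup>2) * norm Oh)"
    by (simp add: power2_eq_square algebra_simps)
  also have "\<dots> \<le> (sqrt CARD('q) / sqrt l)\<^sup>2 * (norm (Oh - \<Omega>) + (2 * t + t\<^sup>2) * norm Oh)"
    using t0 by (intro mult_right_mono power_mono norm_A) auto
  also have "(sqrt CARD('q) / sqrt l)\<^sup>2 = CARD('q) / l"
    using Omega(2) by (simp add: power_divide)
  finally show ?thesis .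
qed

end

end


section \<open>Asymptotic negligibility and continuous mapping\<close>

definition tends_to_zero_in_prob :: "(nat \<Rightarrow> 'a measure) \<Rightarrow> (nat \<Rightarrow> 'a \<Rightarrow> 'b::real_normed_vector) \<Rightarrow> bool" where
  "tends_to_zero_in_prob M X \<longleftrightarrow> (\<forall>\<epsilon>>0. (\<lambda>G. measure (M G) {w \<in> space (M G). norm (X G w) > \<epsilon>}) \<longlonglongrightarrow> 0)"

lemma tendsto_zeroI:
  fixes f :: "nat \<Rightarrow> real"
  assumes "\<And>e. 0 < e \<Longrightarrow> \<forall>\<^sub>F n in sequentially. f n \<le> e" "\<And>n. 0 \<le> f n"
  shows "f \<longlonglongrightarrow> 0"
proof (rule tendstoI)
  fix e :: real assume "0 < e"
  then have "\<forall>\<^sub>F n in sequentially. f n \<le> e / 2" by (intro assms) simp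
  then show "\<forall>\<^sub>F n in sequentially. dist (f n) 0 < e"
    by eventually_elim (use assms(2) \<open>0 < e\<close> in \<open>simp add: dist_real_def\<close>)
qed

text \<open>If for each fixed B the bad event is eventually excluded on Z \<le> B^2, its limiting
  probability is at most c / B^2, and B is arbitrary. The negligibility claims for the estimators
  are reduced to this.\<close>

lemma measure_bad_tendsto_zero:
  fixes Z :: "nat \<Rightarrow> 'a \<Rightarrow> real"
  assumes prob: "\<forall>\<^sub>F G in sequentially. prob_space (M G)"
    and Z: "\<forall>\<^sub>F G in sequentially. Z G \<in> borel_measurable (M G)"
    and tight: "\<And>B. 0 < B \<Longrightarrow> \<forall>\<^sub>F G in sequentially. measure (M G) {w \<in> space (M G). B\<^sup>2 < Z G w} \<le> c / B\<^sup>2"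
    and Bad: "\<forall>\<^sub>F G in sequentially. {w \<in> space (M G). Bad G w} \<in> sets (M G)"
    and good: "\<And>B. 0 < B \<Longrightarrow> \<forall>\<^sub>F G in sequentially. AE w in M G. Z G w \<le> B\<^sup>2 \<longrightarrow> \<not> Bad G w"
  shows "(\<lambda>G. measure (M G) {w \<in> space (M G). Bad G w}) \<longlonglongrightarrow> 0"
proof (rule tendsto_zeroI)
  fix e :: real assume e: "0 < e"
  define B where "B = sqrt ((\<bar>c\<bar> + 1) / e)"
  have B: "0 < B" "B\<^sup>2 = (\<bar>c\<bar> + 1) / e" using e by (auto simp: B_def)
  have "c / B\<^sup>2 \<le> (\<bar>c\<bar> + 1) / B\<^sup>2" by (rule divide_right_mono) simp_all
  also have "\<dots> = e" using e by (simp add: B(2))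
  finally have ce: "c / B\<^sup>2 \<le> e" .
  show "\<forall>\<^sub>F G in sequentially. measure (M G) {w \<in> space (M G). Bad G w} \<le> e"
    using prob Z tight[OF B(1)] Bad good[OF B(1)]
  proof eventually_elim
    case (elim G)
    interpret prob_space "M G" by fact
    note [measurable] = \<open>Z G \<in> borel_measurable (M G)\<close>
    have "measure (M G) {w \<in> space (M G). Bad G w} \<le> measure (M G) {w \<in> space (M G). B\<^sup>2 < Z G w}"
      by (rule finite_measure_mono_AE) (use elim(5) in \<open>auto elim!: eventually_mono simp: not_le\<close>)
    then show ?case using elim(3) ce by linarith
  qed
qed simp

text \<open>cos is 1-Lipschitz where Y and U are close, and two of its values differ by at most 2
  elsewhere.\<close>

lemma (in prob_space) cos_expectation_close:
  fixes Y U :: "'a \<Rightarrow> real^'q"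
  assumes [measurable]: "Y \<in> borel_measurable M" "U \<in> borel_measurable M" and "0 \<le> \<epsilon>"
  shows "\<bar>expectation (\<lambda>w. cos (t \<bullet> Y w + \<theta>)) - expectation (\<lambda>w. cos (t \<bullet> U w + \<theta>))\<bar>
    \<le> norm t * \<epsilon> + 2 * prob {w \<in> space M. norm (Y w - U w) > \<epsilon>}"
proof -
  let ?A = "{w \<in> space M. norm (Y w - U w) > \<epsilon>}"
  have i: "integrable M (\<lambda>w. cos (t \<bullet> Y w + \<theta>))" "integrable M (\<lambda>w. cos (t \<bullet> U w + \<theta>))"
    by (rule integrable_const_bound[of _ 1]; simp)+
  have "\<bar>expectation (\<lambda>w. cos (t \<bullet> Y w + \<theta>)) - expectation (\<lambda>w. cos (t \<bullet> U w + \<theta>))\<bar>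
    = \<bar>expectation (\<lambda>w. cos (t \<bullet> Y w + \<theta>) - cos (t \<bullet> U w + \<theta>))\<bar>" using i by simp
  also have "\<dots> \<le> expectation (\<lambda>w. \<bar>cos (t \<bullet> Y w + \<theta>) - cos (t \<bullet> U w + \<theta>)\<bar>)" by (rule integral_abs_bound)
  also have "\<dots> \<le> expectation (\<lambda>w. norm t * \<epsilon> + 2 * indicator ?A w)"
  proof (rule integral_mono)
    fix w assume w: "w \<in> space M"
    show "\<bar>cos (t \<bullet> Y w + \<theta>) - cos (t \<bullet> U w + \<theta>)\<bar> \<le> norm t * \<epsilon> + 2 * indicator ?A w"
    proof (cases "norm (Y w - U w) > \<epsilon>")
      case True
      have "\<bar>cos (t \<bullet> Y w + \<theta>) - cos (t \<bullet> U w + \<theta>)\<bar> \<le> 2"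
        using cos_ge_minus_one[of "t \<bullet> Y w + \<theta>"] cos_le_one[of "t \<bullet> Y w + \<theta>"]
          cos_ge_minus_one[of "t \<bullet> U w + \<theta>"] cos_le_one[of "t \<bullet> U w + \<theta>"] by linarith
      moreover have "0 \<le> norm t * \<epsilon>" using assms by simp
      ultimately show ?thesis using True w by simp
    next
      case False
      have "\<bar>cos a - cos b\<bar> \<le> \<bar>a - b\<bar>" for a b :: real
        using field_differentiable_bound[of UNIV cos "\<lambda>x. - sin x" 1 a b]
        by (auto intro!: derivative_eq_intros)
      then have "\<bar>cos (t \<bullet> Y w + \<theta>) - cos (t \<bullet> U w + \<theta>)\<bar> \<le> \<bar>t \<bullet> (Y w - U w)\<bar>"
        by (metis add_diff_cancel_right inner_diff_right)
      also have "\<dots> \<le> norm t * norm (Y w - U w)" by (rule Cauchy_Schwarz_ineq2)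
      also have "\<dots> \<le> norm t * \<epsilon>" using False by (intro mult_left_mono) auto
      finally show ?thesis by (simp add: indicator_def)
    qed
  qed (use i in \<open>auto simp: emeasure_eq_measure\<close>)
  also have "\<dots> = norm t * \<epsilon> + 2 * prob ?A" by (simp add: prob_space emeasure_eq_measure)
  finally show ?thesis .
qed

text \<open>Slutsky's lemma: tightness and the limit of the characteristic function both pass from U
  to Y.\<close>

lemma converges_in_distribution_perturb:
  fixes Y U :: "nat \<Rightarrow> 'a \<Rightarrow> real^'q"
  assumes prob: "\<forall>\<^sub>F G in sequentially. prob_space (M G)"
    and Y: "\<forall>\<^sub>F G in sequentially. Y G \<in> borel_measurable (M G)"
    and U: "\<forall>\<^sub>F G in sequentially. U G \<in> borel_measurable (M G)"
    and tight: "tight_seq M U"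
    and char: "\<And>t \<theta>. (\<lambda>G. \<integral>w. cos (t \<bullet> U G w + \<theta>) \<partial>M G) \<longlonglongrightarrow> cos \<theta> * exp (- (norm t)\<^sup>2 / 2)"
    and diff: "tends_to_zero_in_prob M (\<lambda>G w. Y G w - U G w)"
  shows "converges_in_distribution M Y std_normal_vec"
proof (rule converges_in_distribution_of_char[OF prob Y])
  have d: "\<forall>\<^sub>F G in sequentially. measure (M G) {w \<in> space (M G). norm (Y G w - U G w) > \<epsilon>} \<le> \<delta>"
    if "0 < \<epsilon>" "0 < \<delta>" for \<epsilon> \<delta>
  proof -
    have "(\<lambda>G. measure (M G) {w \<in> space (M G). norm (Y G w - U G w) > \<epsilon>}) \<longlonglongrightarrow> 0"
      using diff that(1) by (simp add: tends_to_zero_in_prob_def)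
    from order_tendstoD(2)[OF this that(2)] show ?thesis by eventually_elim simp
  qed
  show "tight_seq M Y" unfolding tight_seq_def
  proof (intro allI impI)
    fix \<epsilon> :: real assume e: "0 < \<epsilon>"
    obtain L where L: "0 < L" "\<forall>\<^sub>F G in sequentially. measure (M G) {w \<in> space (M G). L < norm (U G w)} \<le> \<epsilon> / 2"
      using tight e unfolding tight_seq_def by (meson half_gt_zero)
    have "\<forall>\<^sub>F G in sequentially. measure (M G) {w \<in> space (M G). L + 1 < norm (Y G w)} \<le> \<epsilon>"
      using prob Y U L(2) d[OF zero_less_one half_gt_zero[OF e]]
    proof eventually_elim
      case (elim G)
      interpret prob_space "M G" by fact
      note [measurable] = elim(2,3)
      have "measure (M G) {w \<in> space (M G). L + 1 < norm (Y G w)}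
          \<le> measure (M G) ({w \<in> space (M G). L < norm (U G w)} \<union> {w \<in> space (M G). norm (Y G w - U G w) > 1})"
      proof (rule finite_measure_mono)
        show "{w \<in> space (M G). L + 1 < norm (Y G w)} \<subseteq> {w \<in> space (M G). L < norm (U G w)} \<union> {w \<in> space (M G). norm (Y G w - U G w) > 1}"
          using norm_triangle_sub by (auto, smt (verit))
      qed simp
      also have "\<dots> \<le> measure (M G) {w \<in> space (M G). L < norm (U G w)} + measure (M G) {w \<in> space (M G). norm (Y G w - U G w) > 1}"
        by (rule measure_Un_le) auto
      finally show ?case using elim(4,5) by linarith
    qed
    then show "\<exists>L>0. \<forall>\<^sub>F G in sequentially. measure (M G) {w \<in> space (M G). L < norm (Y G w)} \<le> \<epsilon>"
      using L(1) by (intro exI[of _ "L + 1"]) auto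
  qed
  show "(\<lambda>G. \<integral>w. cos (t \<bullet> Y G w + \<theta>) \<partial>M G) \<longlonglongrightarrow> cos \<theta> * exp (- (norm t)\<^sup>2 / 2)" for t \<theta>
  proof (rule Lim_transform[OF char[of t \<theta>]])
    have "(\<lambda>G. \<bar>(\<integral>w. cos (t \<bullet> Y G w + \<theta>) \<partial>M G) - (\<integral>w. cos (t \<bullet> U G w + \<theta>) \<partial>M G)\<bar>) \<longlonglongrightarrow> 0"
    proof (rule tendsto_zeroI)
      fix e :: real assume e: "0 < e"
      define \<epsilon> where "\<epsilon> = e / (2 * (norm t + 1))"
      have eps: "0 < \<epsilon>" "norm t * \<epsilon> \<le> e / 2"
        using e by (auto simp: \<epsilon>_def field_simps add_pos_nonneg)
      have "0 < e / 4" using e by simp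
      show "\<forall>\<^sub>F G in sequentially. \<bar>(\<integral>w. cos (t \<bullet> Y G w + \<theta>) \<partial>M G) - (\<integral>w. cos (t \<bullet> U G w + \<theta>) \<partial>M G)\<bar> \<le> e"
        using prob Y U d[OF eps(1) \<open>0 < e / 4\<close>]
      proof eventually_elim
        case (elim G)
        then show ?case
          using prob_space.cos_expectation_close[OF elim(1,2,3) less_imp_le[OF eps(1)], of t \<theta>] eps(2) by linarith
      qed
    qed simp
    then show "(\<lambda>G. (\<integral>w. cos (t \<bullet> Y G w + \<theta>) \<partial>M G) - (\<integral>w. cos (t \<bullet> U G w + \<theta>) \<partial>M G)) \<longlonglongrightarrow> 0"
      by (subst tendsto_rabs_zero_iff[symmetric])
  qed
qed

section \<open>The chi-square limit\<close>

text \<open>The two laws come from products over different index sets, {1..q} and the type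
  \<open>'q\<close>; a bijection between them transports one product measure to the other.\<close>

lemma chi_square_eq_distr_std_normal_vec:
  "chi_square_distribution CARD('q::finite) = distr std_normal_vec borel (\<lambda>z :: real^'q. (norm z)\<^sup>2)"
proof -
  obtain e where e: "bij_betw e {1..CARD('q)} (UNIV :: 'q set)"
    using ex_bij_betw_nat_finite_1[OF finite_class.finite_UNIV] by blast
  let ?n = "CARD('q)"
  let ?PM = "\<Pi>\<^sub>M i\<in>(UNIV :: 'q set). std_normal_distribution"
  let ?PN = "\<Pi>\<^sub>M i\<in>{1..?n}. std_normal_distribution"
  have re: "distr ?PM ?PN (\<lambda>\<omega>. \<lambda>n\<in>{1..?n}. \<omega> (e n)) = ?PN"
    by (rule distr_PiM_reindex) (use e in \<open>auto simp: bij_betw_def std_normal.prob_space_axioms\<close>)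
  have m1: "(\<lambda>\<omega>. \<lambda>n\<in>{1..?n}. \<omega> (e n)) \<in> measurable ?PM ?PN"
    by (rule measurable_restrict) (simp add: measurable_component_singleton)
  have m2: "(\<lambda>z. \<Sum>i=1..?n. (z i)\<^sup>2) \<in> borel_measurable ?PN"
    by (intro borel_measurable_sum borel_measurable_power measurable_component_singleton[where M = "\<lambda>_. std_normal_distribution", simplified]) auto
  have "chi_square_distribution ?n = distr (distr ?PM ?PN (\<lambda>\<omega>. \<lambda>n\<in>{1..?n}. \<omega> (e n))) borel (\<lambda>z. \<Sum>i=1..?n. (z i)\<^sup>2)"
    unfolding chi_square_distribution_def re ..
  also have "\<dots> = distr ?PM borel ((\<lambda>z. \<Sum>i=1..?n. (z i)\<^sup>2) \<circ> (\<lambda>\<omega>. \<lambda>n\<in>{1..?n}. \<omega> (e n)))"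
    by (rule distr_distr[OF m2 m1])
  also have "((\<lambda>z. \<Sum>i=1..?n. (z i)\<^sup>2) \<circ> (\<lambda>\<omega>. \<lambda>n\<in>{1..?n}. \<omega> (e n))) = (\<lambda>z. (norm (z :: real^'q))\<^sup>2) \<circ> (\<lambda>z. \<chi> i. z i)"
  proof
    fix \<omega> :: "'q \<Rightarrow> real"
    have "(\<Sum>i=1..?n. (\<omega> (e i))\<^sup>2) = (\<Sum>i\<in>UNIV. (\<omega> i)\<^sup>2)"
      by (rule sum.reindex_bij_betw[OF e])
    moreover have "(norm (\<chi> i. \<omega> i))\<^sup>2 = (\<Sum>i\<in>UNIV. (\<omega> i)\<^sup>2)"
      by (simp only: power2_norm_eq_inner inner_vec_def) (simp add: power2_eq_square)
    ultimately show "((\<lambda>z. \<Sum>i=1..?n. (z i)\<^sup>2) \<circ> (\<lambda>\<omega>. \<lambda>n\<in>{1..?n}. \<omega> (e n))) \<omega> = ((\<lambda>z. (norm (z :: real^'q))\<^sup>2) \<circ> (\<lambda>z. \<chi> i. z i)) \<omega>"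
      by simp
  qed
  also have "distr ?PM borel ((\<lambda>z. (norm (z :: real^'q))\<^sup>2) \<circ> (\<lambda>z. \<chi> i. z i)) = distr std_normal_vec borel (\<lambda>z :: real^'q. (norm z)\<^sup>2)"
    unfolding std_normal_vec_def by (rule distr_distr[symmetric]) (auto simp: vec_lambda_measurable)
  finally show ?thesis .
qed

text \<open>Continuous mapping for |Y|^2. Changing a statistic on an event moves expectations of
  functions bounded by 1 by at most twice its probability, so X inherits the limit.\<close>

lemma weak_conv_chi_square:
  fixes Y :: "nat \<Rightarrow> 'a \<Rightarrow> real^'q" and X :: "nat \<Rightarrow> 'a \<Rightarrow> real"
  assumes prob: "\<And>G. 2 \<le> G \<Longrightarrow> prob_space (M G)"
    and X: "\<And>G. 2 \<le> G \<Longrightarrow> X G \<in> borel_measurable (M G)"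
    and Y: "converges_in_distribution M Y std_normal_vec"
    and eq: "(\<lambda>G. measure (M G) {w \<in> space (M G). X G w \<noteq> (norm (Y G w))\<^sup>2}) \<longlonglongrightarrow> 0"
  shows "weak_conv_m (\<lambda>G. distr (M G) borel (X G)) (chi_square_distribution CARD('q))"
proof -
  let ?chi = "chi_square_distribution CARD('q)"
  interpret N: prob_space "std_normal_vec :: (real^'q) measure" by (rule prob_space_std_normal_vec)
  have chi: "real_distribution ?chi"
    unfolding chi_square_eq_distr_std_normal_vec by (intro N.real_distribution_distr) measurable
  have int: "(\<lambda>G. \<integral>w. f (X G w) \<partial>M G) \<longlonglongrightarrow> integral\<^sup>L ?chi f"
    if f: "\<And>x. isCont f x" "\<And>x. \<bar>f x\<bar> \<le> 1" for f :: "real \<Rightarrow> real"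
  proof -
    have cf: "continuous_on UNIV f" using f(1) by (simp add: continuous_at_imp_continuous_on)
    then have [measurable]: "f \<in> borel_measurable borel" by (rule borel_measurable_continuous_onI)
    have "continuous_on UNIV (\<lambda>z :: real^'q. f ((norm z)\<^sup>2))"
      by (rule continuous_on_compose2[OF cf]) (auto intro!: continuous_intros)
    moreover have "bounded (range (\<lambda>z :: real^'q. f ((norm z)\<^sup>2)))"
      using f(2) by (auto simp: bounded_iff)
    ultimately have "(\<lambda>G. \<integral>w. f ((norm (Y G w))\<^sup>2) \<partial>M G) \<longlonglongrightarrow> (\<integral>z. f ((norm (z :: real^'q))\<^sup>2) \<partial>std_normal_vec)"
      using Y[unfolded converges_in_distribution_def, THEN conjunct2, rule_format, OF conjI] by blast
    also have "(\<integral>z. f ((norm (z :: real^'q))\<^sup>2) \<partial>std_normal_vec) = integral\<^sup>L ?chi f"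
      unfolding chi_square_eq_distr_std_normal_vec by (rule integral_distr[symmetric]) measurable
    finally have lim: "(\<lambda>G. \<integral>w. f ((norm (Y G w))\<^sup>2) \<partial>M G) \<longlonglongrightarrow> integral\<^sup>L ?chi f" .
    have bound: "\<forall>\<^sub>F G in sequentially. norm ((\<integral>w. f ((norm (Y G w))\<^sup>2) \<partial>M G) - (\<integral>w. f (X G w) \<partial>M G))
        \<le> 2 * measure (M G) {w \<in> space (M G). X G w \<noteq> (norm (Y G w))\<^sup>2}"
      using Y[unfolded converges_in_distribution_def, THEN conjunct1] eventually_ge_at_top[of 2]
    proof eventually_elim
      case (elim G)
      interpret prob_space "M G" by (rule prob[OF elim(2)])
      note [measurable] = elim(1) X[OF elim(2)]
      let ?A = "{w \<in> space (M G). X G w \<noteq> (norm (Y G w))\<^sup>2}"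
      have i: "integrable (M G) (\<lambda>w. f ((norm (Y G w))\<^sup>2))" "integrable (M G) (\<lambda>w. f (X G w))"
        by (rule integrable_const_bound[of _ 1]; simp add: f)+
      have "norm ((\<integral>w. f ((norm (Y G w))\<^sup>2) \<partial>M G) - (\<integral>w. f (X G w) \<partial>M G))
          = \<bar>\<integral>w. f ((norm (Y G w))\<^sup>2) - f (X G w) \<partial>M G\<bar>" using i by simp
      also have "\<dots> \<le> (\<integral>w. \<bar>f ((norm (Y G w))\<^sup>2) - f (X G w)\<bar> \<partial>M G)" by (rule integral_abs_bound)
      also have "\<dots> \<le> (\<integral>w. 2 * indicator ?A w \<partial>M G)"
      proof (rule integral_mono)
        show "\<bar>f ((norm (Y G w))\<^sup>2) - f (X G w)\<bar> \<le> 2 * indicator ?A w" if "w \<in> space (M G)" for w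
          using f(2)[of "(norm (Y G w))\<^sup>2"] f(2)[of "X G w"] that by (auto simp: indicator_def)
      qed (use i in \<open>auto simp: emeasure_eq_measure\<close>)
      also have "\<dots> = 2 * measure (M G) ?A" by (simp add: emeasure_eq_measure)
      finally show ?case .
    qed
    have "(\<lambda>G. 2 * measure (M G) {w \<in> space (M G). X G w \<noteq> (norm (Y G w))\<^sup>2}) \<longlonglongrightarrow> 2 * 0"
      by (intro tendsto_mult_left eq)
    then have "(\<lambda>G. 2 * measure (M G) {w \<in> space (M G). X G w \<noteq> (norm (Y G w))\<^sup>2}) \<longlonglongrightarrow> 0" by simp
    then have "(\<lambda>G. (\<integral>w. f ((norm (Y G w))\<^sup>2) \<partial>M G) - (\<integral>w. f (X G w) \<partial>M G)) \<longlonglongrightarrow> 0"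
      by (rule Lim_null_comparison[OF bound])
    from tendsto_diff[OF lim this] show ?thesis by simp
  qed
  \<comment> \<open>The criterion asks for a real distribution at every index, which is available
    only from G = 2 on; hence the shift.\<close>
  have "weak_conv_m (\<lambda>G. distr (M (G + 2)) borel (X (G + 2))) ?chi"
  proof (rule integral_bdd_continuous_conv_imp_weak_conv)
    show "real_distribution (distr (M (G + 2)) borel (X (G + 2)))" for G
      using prob_space.real_distribution_distr[OF prob X] by simp
    show "(\<lambda>G. integral\<^sup>L (distr (M (G + 2)) borel (X (G + 2))) f) \<longlonglongrightarrow> integral\<^sup>L ?chi f"
      if f: "\<And>x. isCont f x" "\<And>x. \<bar>f x\<bar> \<le> 1" for f :: "real \<Rightarrow> real"
    proof -
      have "f \<in> borel_measurable borel"
        using f(1) by (intro borel_measurable_continuous_onI) (simp add: continuous_at_imp_continuous_on)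
      then have "integral\<^sup>L (distr (M (G + 2)) borel (X (G + 2))) f = (\<integral>w. f (X (G + 2) w) \<partial>M (G + 2))" for G
        using X[of "G + 2"] by (intro integral_distr) auto
      then show ?thesis using LIMSEQ_ignore_initial_segment[OF int[OF f], of 2] by simp
    qed
  qed (rule chi)
  then show ?thesis
    unfolding weak_conv_m_def weak_conv_def by (blast intro: LIMSEQ_offset)
qed


section \<open>The dyadic regression\<close>

locale dyadic_regression = dyadic_sample M N \<psi> x u C D
  for M :: "'a measure" and N :: nat and \<psi> :: "nat \<Rightarrow> nat set"
    and x :: "nat \<Rightarrow> 'a \<Rightarrow> real ^ 'k" and u :: "nat \<Rightarrow> 'a \<Rightarrow> real" and C D :: real +
  fixes y :: "nat \<Rightarrow> 'a \<Rightarrow> real" and \<beta> :: "real^'k" and R :: "real^'q^'k" and c\<^sub>Q :: real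
  assumes model: "\<And>n w. n \<in> {1..N} \<Longrightarrow> w \<in> space M \<Longrightarrow> y n w = \<beta> \<bullet> x n w + u n w"
    and C1: "1 \<le> C" and D1: "1 \<le> D" and DN: "D \<le> 2 * real N"
    and Omega: "pos_def \<Omega>" and cQ: "0 < c\<^sub>Q" "c\<^sub>Q \<le> lambda_min Q"
    and R: "\<And>v. R *v v = 0 \<Longrightarrow> v = 0"
begin

definition l where "l = lambda_min \<Omega>"
text \<open>The single rate in which all errors are expressed; its square is the ratio of the
  variance condition with D in place of the maximal count.\<close>

definition \<eta> where "\<eta> = sqrt (N * D ^ 3) / l"
definition b where "b w = beta_hat N (\<lambda>n. x n w) (\<lambda>n. y n w)"
definition V where "V = sandwich R (V_pop M N x u)"
definition Vh where "Vh w = sandwich R (V_hat N \<psi> (\<lambda>n. x n w) (\<lambda>n. y n w))"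
definition P where "P = mat_inv_sqrt V"
definition A where "A = (1 / real N) *\<^sub>R (P ** transpose R ** matrix_inv Q)"
definition T where "T w = P *v (transpose R *v (b w - \<beta>))"
definition U where "U w = A *v S w"
text \<open>Each squared error is divided by the order of its mean, so that E Z is bounded by a
  constant and one application of Markov's inequality controls all four.\<close>

definition Z where "Z w = (norm (Qt w - Q))\<^sup>2 * (N / D) + (norm (S w))\<^sup>2 / (N * D)
  + (norm (\<Omega>t w - \<Omega>))\<^sup>2 / (N * D ^ 3) + (norm (U w))\<^sup>2"

lemma l_pos: "0 < l" and l_rayleigh: "l * (v \<bullet> v) \<le> v \<bullet> (\<Omega> *v v)"
  unfolding l_def using lambda_min_pos[OF Omega] lambda_min_rayleigh(1)[OF pos_defD(1)[OF Omega]] by auto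

lemma Q_pos_def: "pos_def Q" and Q_coercive: "c\<^sub>Q * (v \<bullet> v) \<le> v \<bullet> (Q *v v)"
proof -
  have t: "transpose Q = Q"
    by (simp add: vec_eq_iff transpose_def Q_nth Qt_nth mult.commute)
  show c: "c\<^sub>Q * (v \<bullet> v) \<le> v \<bullet> (Q *v v)" for v
    using mult_right_mono[OF cQ(2) inner_ge_zero[of v]] lambda_min_rayleigh(1)[OF t, of v] by linarith
  show "pos_def Q" by (rule pos_defI[OF t cQ(1) c])
qed

lemma sandwich_perturbation:
  assumes w: "w \<in> space M" and tr: "\<forall>n\<in>{1..N}. x n w = xt n w \<and> u n w = ut n w"
  shows "sandwich_perturbation N \<psi> (\<lambda>n. x n w) (\<lambda>n. u n w) (\<lambda>n. y n w) \<beta> C D Q \<Omega> R c\<^sub>Q l"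
  by unfold_locales
    (use w tr xt_bounded ut_bounded model degree_le C1 D1 N_pos Q_pos_def Q_coercive cQ Omega l_pos l_rayleigh R in auto)

lemma trunc_sample: "\<forall>n\<in>{1..N}. x n w = xt n w \<and> u n w = ut n w \<Longrightarrow>
   Q_hat N (\<lambda>n. x n w) = Qt w \<and> (\<Sum>n=1..N. u n w *\<^sub>R x n w) = S w \<and>
   (\<Sum>n=1..N. \<Sum>m\<in>{m\<in>{1..N}. \<psi> n \<inter> \<psi> m \<noteq> {}}. (u n w * u m w) *\<^sub>R outer (x n w) (x m w)) = \<Omega>t w"
  unfolding Q_hat_def gram_def Qt_def S_def \<Omega>t_def nb_def
  by (intro conjI arg_cong2[of _ _ _ _ scaleR] refl sum.cong) auto

lemma pos_def_V: "pos_def V" and A_isometry: "A ** \<Omega> ** transpose A = mat 1" and norm_A: "norm A \<le> sqrt CARD('q) / sqrt l"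
proof -
  \<comment> \<open>The claims mention no outcome, but the pathwise locale needs one. The sure
    bounds hold almost surely, hence somewhere.\<close>
  obtain w where "w \<in> space M" "\<forall>n\<in>{1..N}. x n w = xt n w \<and> u n w = ut n w"
  proof -
    have "\<exists>w\<in>space M. \<forall>n\<in>{1..N}. x n w = xt n w \<and> u n w = ut n w"
    proof (rule ccontr)
      assume none: "\<not> ?thesis"
      have "AE w in M. False" using trunc_AE AE_space
      proof eventually_elim
        case (elim w)
        with none show ?case by blast
      qed
      then show False using AE_False by blast
    qed
    then show ?thesis using that by blast
  qed
  then interpret p: sandwich_perturbation N \<psi> "\<lambda>n. x n w" "\<lambda>n. u n w" "\<lambda>n. y n w" \<beta> C D Q \<Omega> R c\<^sub>Q l
    by (rule sandwich_perturbation)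
  have VV: "V = sandwich R p.V" by (simp add: V_def V_pop_def)
  show "pos_def V" unfolding VV by (rule p.pos_def_V)
  have AA: "A = p.A" unfolding A_def p.A_def P_def p.P_def VV ..
  show "A ** \<Omega> ** transpose A = mat 1" "norm A \<le> sqrt CARD('q) / sqrt l"
    unfolding AA by (rule p.A_isometry p.norm_A)+
qed

lemma U_meas [measurable]: "U \<in> borel_measurable M"
  unfolding U_def[abs_def] by measurable

text \<open>The second-moment matrix of U is A \<Omega> A' = I. Through \<open>Z\<close> this bound
  also yields tightness.\<close>

lemma expectation_U: "expectation (\<lambda>w. (norm (U w))\<^sup>2) = CARD('q)" and U_square_integrable: "integrable M (\<lambda>w. (norm (U w))\<^sup>2)"
proof -
  have c: "U w $ i = (transpose A *v axis i 1) \<bullet> S w" for w i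
    unfolding transpose_dot U_def by (simp add: inner_axis')
  have "expectation (\<lambda>w. (U w $ i)\<^sup>2) = 1" for i
  proof -
    have "expectation (\<lambda>w. (U w $ i)\<^sup>2) = (transpose A *v axis i 1) \<bullet> (\<Omega> *v (transpose A *v axis i 1))"
      unfolding c Omega_quadratic_form ..
    also have "\<dots> = axis i 1 \<bullet> ((A ** \<Omega> ** transpose A) *v axis i 1)"
      by (simp only: transpose_dot matrix_vector_mul_assoc matrix_mul_assoc)
    also have "\<dots> = 1" by (simp add: A_isometry inner_axis)
    finally show ?thesis .
  qed
  moreover have i: "integrable M (\<lambda>w. (U w $ i)\<^sup>2)" for i
  proof (rule bounded_integrable)
    have "\<bar>U w $ i\<bar> \<le> norm A * (real N * (C * C))" for w
      using component_le_norm_cart[of "U w" i] norm_matrix_vector_mult_le[of A "S w"] mult_left_mono[OF S_bounded[of w], of "norm A"]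
      unfolding U_def by (simp add: mult.assoc)
    then show "\<bar>(U w $ i)\<^sup>2\<bar> \<le> (norm A * (real N * (C * C)))\<^sup>2" for w
      using power_mono[OF _ abs_ge_zero, of "U w $ i" _ 2] by simp
  qed (intro borel_measurable_power borel_measurable_vec_nth U_meas)
  ultimately show "expectation (\<lambda>w. (norm (U w))\<^sup>2) = CARD('q)" "integrable M (\<lambda>w. (norm (U w))\<^sup>2)"
    by (simp_all add: vec_norm_sq)
qed

lemma square_norm_integrable:
  fixes f :: "'a \<Rightarrow> 'v::{real_normed_vector,second_countable_topology}"
  assumes "f \<in> borel_measurable M" "\<And>w. norm (f w) \<le> c"
  shows "integrable M (\<lambda>w. (norm (f w))\<^sup>2)"
proof (rule bounded_integrable)
  show "\<bar>(norm (f w))\<^sup>2\<bar> \<le> c\<^sup>2" for w using power_mono[OF assms(2) norm_ge_zero, of w 2] by simp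
qed (use assms(1) in measurable)

definition K\<^sub>Z :: real where "K\<^sub>Z = (CARD('k))\<^sup>2 * (2 * (C * C)\<^sup>2) + CARD('k) * (2 * (C * C)\<^sup>2) + (CARD('k))\<^sup>2 * (8 * (C ^ 4)\<^sup>2) + CARD('q)"

lemma Z_meas [measurable]: "Z \<in> borel_measurable M"
  unfolding Z_def[abs_def] by measurable

lemma Z_integrable: "integrable M Z" and Z_mean: "expectation Z \<le> K\<^sub>Z"
proof -
  have iQ: "integrable M (\<lambda>w. (norm (Qt w - Q))\<^sup>2)"
  proof (rule square_norm_integrable)
    have "norm (Qt w) \<le> C * C" for w
    proof -
      have "norm (\<Sum>n=1..N. outer (xt n w) (xt n w)) \<le> (\<Sum>n=1..N. C * C)"
        by (rule order_trans[OF norm_sum sum_mono]) (use C1 in \<open>auto simp: norm_outer intro!: mult_mono xt_bounded\<close>)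
      then show ?thesis using N_pos by (simp add: Qt_def field_simps)
    qed
    then show "norm (Qt w - Q) \<le> C * C + norm Q" for w
      using norm_triangle_ineq4[of "Qt w" Q] by (meson add_right_mono order_trans)
  qed measurable
  have iS: "integrable M (\<lambda>w. (norm (S w))\<^sup>2)" by (rule square_norm_integrable[OF S_meas S_bounded])
  have iO: "integrable M (\<lambda>w. (norm (\<Omega>t w - \<Omega>))\<^sup>2)"
  proof (rule square_norm_integrable)
    have "norm (\<Omega>t w) \<le> (\<Sum>n=1..N. \<Sum>m\<in>nb n. C * C * (C * C))" for w
      unfolding \<Omega>t_def
      by (rule order_trans[OF norm_sum sum_mono])+
        (use C1 in \<open>auto simp: norm_outer abs_mult intro!: mult_mono xt_bounded ut_bounded mult_nonneg_nonneg\<close>)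
    then show "norm (\<Omega>t w - \<Omega>) \<le> (\<Sum>n=1..N. \<Sum>m\<in>nb n. C * C * (C * C)) + norm \<Omega>" for w
      using norm_triangle_ineq4[of "\<Omega>t w" \<Omega>] by (meson add_right_mono order_trans)
  qed measurable
  show "integrable M Z" unfolding Z_def[abs_def] using iQ iS iO U_square_integrable by simp
  have "expectation Z = expectation (\<lambda>w. (norm (Qt w - Q))\<^sup>2) * (N / D) + expectation (\<lambda>w. (norm (S w))\<^sup>2) / (N * D)
     + expectation (\<lambda>w. (norm (\<Omega>t w - \<Omega>))\<^sup>2) / (N * D ^ 3) + CARD('q)"
    unfolding Z_def[abs_def] using iQ iS iO U_square_integrable expectation_U by simp
  also have "\<dots> \<le> ((CARD('k))\<^sup>2 * (2 * (C * C)\<^sup>2 * (D / N))) * (N / D) + (CARD('k) * (2 * (C * C)\<^sup>2 * (N * D))) / (N * D)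
     + ((CARD('k))\<^sup>2 * (8 * (C ^ 4)\<^sup>2 * (N * D ^ 3))) / (N * D ^ 3) + CARD('q)"
    using D1 by (intro add_mono mult_right_mono divide_right_mono Q_variance S_second_moment Omega_variance) auto
  also have "\<dots> = K\<^sub>Z" using D1 N_pos by (simp add: K\<^sub>Z_def)
  finally show "expectation Z \<le> K\<^sub>Z" .
qed

lemma Z_nonneg: "0 \<le> Z w"
  unfolding Z_def using D1 by (intro add_nonneg_nonneg mult_nonneg_nonneg divide_nonneg_nonneg) auto

lemma Z_tail: "0 < B \<Longrightarrow> prob {w \<in> space M. B\<^sup>2 < Z w} \<le> K\<^sub>Z / B\<^sup>2"
proof -
  assume B: "0 < B"
  have "prob {w \<in> space M. B\<^sup>2 < Z w} \<le> prob {w \<in> space M. B\<^sup>2 \<le> Z w}"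
    by (intro finite_measure_mono) auto
  also have "\<dots> \<le> expectation Z / B\<^sup>2"
    by (rule integral_Markov_inequality_measure[OF Z_integrable, of "{}"]) (use B Z_nonneg in auto)
  also have "\<dots> \<le> K\<^sub>Z / B\<^sup>2" by (intro divide_right_mono Z_mean) simp
  finally show ?thesis .
qed

lemma Z_components:
  assumes Z: "Z w \<le> B\<^sup>2" and B: "0 \<le> B"
  shows "norm (Qt w - Q) \<le> B * sqrt (D / N)" "norm (S w) \<le> B * sqrt (N * D)"
    "norm (\<Omega>t w - \<Omega>) \<le> B * sqrt (N * D ^ 3)" "norm (U w) \<le> B"
proof -
  have pos: "0 \<le> (norm (Qt w - Q))\<^sup>2 * (N / D)" "0 \<le> (norm (S w))\<^sup>2 / (N * D)"
    "0 \<le> (norm (\<Omega>t w - \<Omega>))\<^sup>2 / (N * D ^ 3)" "0 \<le> (norm (U w))\<^sup>2"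
    using D1 by auto
  have 1: "(norm (Qt w - Q))\<^sup>2 * (N / D) \<le> B\<^sup>2" and 2: "(norm (S w))\<^sup>2 / (N * D) \<le> B\<^sup>2"
    and 3: "(norm (\<Omega>t w - \<Omega>))\<^sup>2 / (N * D ^ 3) \<le> B\<^sup>2" and 4: "(norm (U w))\<^sup>2 \<le> B\<^sup>2"
    using Z pos unfolding Z_def by linarith+
  have N: "0 < real N" "0 < D" using N_pos D1 by auto
  have "(norm (Qt w - Q))\<^sup>2 \<le> (B * sqrt (D / N))\<^sup>2"
    using 1 N by (simp add: power_mult_distrib field_simps)
  then show "norm (Qt w - Q) \<le> B * sqrt (D / N)" by (rule power2_le_imp_le) (use B N in simp)
  have "(norm (S w))\<^sup>2 \<le> (B * sqrt (N * D))\<^sup>2"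
    using 2 N by (simp add: power_mult_distrib pos_divide_le_eq)
  then show "norm (S w) \<le> B * sqrt (N * D)" by (rule power2_le_imp_le) (use B N in simp)
  have "(norm (\<Omega>t w - \<Omega>))\<^sup>2 \<le> (B * sqrt (N * D ^ 3))\<^sup>2"
    using 3 N by (simp add: power_mult_distrib pos_divide_le_eq)
  then show "norm (\<Omega>t w - \<Omega>) \<le> B * sqrt (N * D ^ 3)" by (rule power2_le_imp_le) (use B N in simp)
  show "norm (U w) \<le> B" using 4 B by (rule power2_le_imp_le)
qed

definition c1 :: real where "c1 = CARD('k) * (2 * (C * C)\<^sup>2)"
definition kk :: real where "kk = 2 * sqrt CARD('k) / c\<^sub>Q"

text \<open>Everything reduces to \<eta>. The second claim uses \<lambda> \<le> \<open>c1\<close> N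
  D, the third D \<le> 2 N. The two identities are the scales of the Gram error times the order of
  \<open>Omega_hat\<close>, and times the order of the score.\<close>

lemma sqrt_scales:
  "sqrt (D / N) * (N * D) = sqrt (N * D ^ 3)" "sqrt (D / N) \<le> c1 * \<eta>" "D / sqrt l \<le> sqrt (2 * \<eta>)"
  "sqrt (D / N) * sqrt (N * D) = D"
proof -
  have N: "0 < real N" "0 < D" using N_pos D1 by auto
  have "sqrt (D / N) * (N * D) = sqrt (D / N) * sqrt ((N * D)\<^sup>2)" using N by simp
  also have "\<dots> = sqrt (D / N * (N * D)\<^sup>2)" by (rule real_sqrt_mult[symmetric])
  also have "D / N * (N * D)\<^sup>2 = N * D ^ 3" using N by (simp add: power2_eq_square power3_eq_cube)
  finally show 1: "sqrt (D / N) * (N * D) = sqrt (N * D ^ 3)" .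
  have l: "l \<le> c1 * (N * D)" using lambda_min_le_second_moment[OF Omega] by (simp add: l_def c1_def mult.assoc)
  have "sqrt (D / N) * l \<le> sqrt (D / N) * (c1 * (N * D))" using N by (intro mult_left_mono l) simp
  also have "\<dots> = c1 * sqrt (N * D ^ 3)" using 1 by (simp add: mult.left_commute)
  finally show "sqrt (D / N) \<le> c1 * \<eta>" using l_pos by (simp add: \<eta>_def field_simps)
  have "D\<^sup>2 = sqrt (D * D ^ 3)" using N by (simp add: power2_eq_square eval_nat_numeral real_sqrt_mult)
  \<comment> \<open>From D \<le> 2 N, with 2 relaxed to the square 4.\<close>
  also have "\<dots> \<le> sqrt (4 * (N * D ^ 3))" using N DN by (intro real_sqrt_le_mono) (simp add: mult_right_mono)
  also have "\<dots> = 2 * sqrt (N * D ^ 3)" by (simp add: real_sqrt_mult)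
  finally have "D\<^sup>2 / l \<le> 2 * \<eta>" using l_pos by (simp add: \<eta>_def divide_right_mono)
  moreover have "D / sqrt l = sqrt (D\<^sup>2 / l)" using N by (simp add: real_sqrt_divide)
  ultimately show "D / sqrt l \<le> sqrt (2 * \<eta>)" by simp
  have "sqrt (D / N) * sqrt (N * D) = sqrt (D / N * (N * D))" by (rule real_sqrt_mult[symmetric])
  also have "D / N * (N * D) = D * D" using N by simp
  also have "sqrt (D * D) = D" using N by simp
  finally show "sqrt (D / N) * sqrt (N * D) = D" .
qed

definition K\<^sub>T :: "real \<Rightarrow> real" where "K\<^sub>T B = sqrt CARD('q) * kk * B * B"
definition K\<^sub>V :: "real \<Rightarrow> real" where
  "K\<^sub>V B = CARD('q) * (B + 3 * C ^ 4 * kk * B + (2 + sqrt CARD('k)) * (kk * B * (4 * C ^ 4)))"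

text \<open>On Z \<le> B^2 everything is deterministic. The two smallness conditions give
  |\<open>Q_hat\<close> - Q| \<le> \<open>c\<^sub>Q\<close>/2, which opens the perturbation bounds,
  and |err| \<le> 1, which the residuals need. The constants \<open>K\<^sub>T B\<close> and
  \<open>K\<^sub>V B\<close> depend neither on R nor on the sample size.\<close>

lemma good_event:
  assumes w: "w \<in> space M" and tr: "\<forall>n\<in>{1..N}. x n w = xt n w \<and> u n w = ut n w"
    and Z: "Z w \<le> B\<^sup>2" and B: "0 \<le> B" and small: "B * (c1 * \<eta>) \<le> c\<^sub>Q / 2" "kk * B * (c1 * \<eta>) \<le> 1"
  shows "norm (T w - U w) \<le> K\<^sub>T B * sqrt (2 * \<eta>)" "norm (P ** Vh w ** P - mat 1) \<le> K\<^sub>V B * \<eta>"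
    "transpose (Vh w) = Vh w"
proof -
  interpret p: sandwich_perturbation N \<psi> "\<lambda>n. x n w" "\<lambda>n. u n w" "\<lambda>n. y n w" \<beta> C D Q \<Omega> R c\<^sub>Q l
    by (rule sandwich_perturbation[OF w tr])
  have VV: "V = sandwich R p.V" by (simp add: V_def V_pop_def)
  have PP: "P = p.P" unfolding P_def p.P_def VV ..
  have AA: "A = p.A" unfolding A_def p.A_def PP ..
  have Qh: "Q_hat N (\<lambda>n. x n w) = Qt w" and sc: "p.score = S w" and Ot: "p.Omega_true = \<Omega>t w"
    using trunc_sample[OF tr] unfolding p.score_def p.Omega_true_def p.nbs_def by auto
  note z = Z_components[OF Z B]
  have N: "0 < real N" "0 < D" using N_pos D1 by auto
  have kk0: "0 \<le> kk" using cQ by (simp add: kk_def)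
  define s where "s = sqrt (D / N)"
  have s0: "0 \<le> s" using N by (simp add: s_def)
  have s1: "s \<le> c1 * \<eta>" "s * (N * D) = sqrt (N * D ^ 3)" "s * sqrt (N * D) = D"
    unfolding s_def by (rule sqrt_scales)+
  have Qd: "norm (Qt w - Q) \<le> B * s" using z(1) by (simp add: s_def)
  have close: "norm (Q_hat N (\<lambda>n. x n w) - Q) \<le> c\<^sub>Q / 2"
    unfolding Qh using Qd mult_left_mono[OF s1(1) B] small(1) by linarith
  note close_facts = p.norm_err[OF close] p.scaled_error_deviation[OF close] p.scaled_V_hat_deviation[OF close]
  have err_eq: "p.err = b w - \<beta>" by (simp add: p.err_def b_def)
  have sqN: "sqrt (N * D) / N = s"
  proof -
    have "s = sqrt (N * D / (real N)\<^sup>2)" using N by (simp add: s_def power2_eq_square)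
    then show ?thesis by (simp add: real_sqrt_divide)
  qed
  have err: "norm p.err \<le> kk * B * s"
  proof -
    have "norm p.err \<le> kk * norm (S w) / N" using close_facts(1) by (simp add: kk_def sc)
    also have "\<dots> \<le> kk * (B * sqrt (N * D)) / N" by (intro divide_right_mono mult_left_mono z kk0) simp
    also have "\<dots> = kk * B * (sqrt (N * D) / N)" by simp
    finally show ?thesis by (simp only: sqN)
  qed
  have err1: "norm p.err \<le> 1"
    using err mult_left_mono[OF s1(1), of "kk * B"] kk0 B small(2) by (simp add: mult.assoc)
  have sq: "0 \<le> sqrt CARD('q) / sqrt l" using l_pos by simp
  have "norm (T w - U w) \<le> sqrt CARD('q) / sqrt l * (norm (Qt w - Q) * kk) * norm (S w)"
    using close_facts(2) by (simp only: T_def U_def PP AA err_eq Qh sc kk_def)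
  also have "\<dots> \<le> sqrt CARD('q) / sqrt l * ((B * s) * kk) * (B * sqrt (N * D))"
    using sq s0 B kk0 by (intro mult_mono mult_left_mono mult_right_mono Qd z mult_nonneg_nonneg) auto
  also have "\<dots> = K\<^sub>T B * ((s * sqrt (N * D)) / sqrt l)" by (simp add: K\<^sub>T_def)
  also have "\<dots> \<le> K\<^sub>T B * sqrt (2 * \<eta>)"
    unfolding s1(3) using kk0 B by (intro mult_left_mono sqrt_scales) (auto simp: K\<^sub>T_def)
  finally show "norm (T w - U w) \<le> K\<^sub>T B * sqrt (2 * \<eta>)" .
  define Oh where "Oh = Omega_hat N \<psi> (\<lambda>n. x n w) (\<lambda>n. y n w)"
  have C4: "0 \<le> C ^ 4" using C1 by simp
  have Oh1: "norm (Oh - \<Omega>) \<le> (B + 3 * C ^ 4 * kk * B) * sqrt (N * D ^ 3)"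
  proof -
    have "norm (Oh - \<Omega>t w) \<le> N * D * (3 * C ^ 4 * norm p.err)"
      using p.Omega_hat_deviation[OF err1] by (simp add: Oh_def Ot)
    also have "\<dots> \<le> N * D * (3 * C ^ 4 * (kk * B * s))"
      using N C4 by (intro mult_left_mono err) auto
    also have "\<dots> = 3 * C ^ 4 * kk * B * (s * (N * D))" by simp
    also have "\<dots> = 3 * C ^ 4 * kk * B * sqrt (N * D ^ 3)" by (simp only: s1)
    finally have "norm (Oh - \<Omega>t w) \<le> 3 * C ^ 4 * kk * B * sqrt (N * D ^ 3)" .
    moreover have "norm (Oh - \<Omega>) \<le> norm (Oh - \<Omega>t w) + norm (\<Omega>t w - \<Omega>)"
      using norm_triangle_ineq[of "Oh - \<Omega>t w" "\<Omega>t w - \<Omega>"] by simp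
    ultimately show ?thesis using z(3) by (simp add: distrib_right)
  qed
  define t where "t = norm (Qt w - Q) * kk"
  have t0: "0 \<le> t" using kk0 by (simp add: t_def)
  have t1: "t \<le> B * s * kk" unfolding t_def by (intro mult_right_mono Qd kk0)
  \<comment> \<open>Turns t^2 into a multiple of t, so that all terms are linear in the Gram
    error.\<close>
  have t2: "t \<le> sqrt CARD('k)"
  proof -
    have "t \<le> c\<^sub>Q / 2 * kk" unfolding t_def by (intro mult_right_mono close[unfolded Qh] kk0)
    then show ?thesis using cQ by (simp add: kk_def)
  qed
  have Oh2: "(2 * t + t\<^sup>2) * norm Oh \<le> (2 + sqrt CARD('k)) * (kk * B * (4 * C ^ 4)) * sqrt (N * D ^ 3)"
  proof -
    have "2 * t + t\<^sup>2 = (2 + t) * t" by (simp add: power2_eq_square algebra_simps)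
    also have "\<dots> \<le> (2 + sqrt CARD('k)) * (B * s * kk)"
      using t0 t1 t2 by (intro mult_mono add_mono) auto
    finally have "(2 * t + t\<^sup>2) * norm Oh \<le> (2 + sqrt CARD('k)) * (B * s * kk) * (N * D * (4 * C ^ 4))"
      using p.Omega_hat_bound[OF err1] t0 B s0 kk0 unfolding Oh_def
      by (intro mult_mono mult_nonneg_nonneg) auto
    also have "\<dots> = (2 + sqrt CARD('k)) * (kk * B * (4 * C ^ 4)) * (s * (N * D))" by simp
    finally show ?thesis by (simp only: s1)
  qed
  have "norm (P ** Vh w ** P - mat 1) \<le> CARD('q) / l * (norm (Oh - \<Omega>) + (2 * t + t\<^sup>2) * norm Oh)"
    using close_facts(3) by (simp only: PP Vh_def Qh t_def Oh_def kk_def)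
  also have "\<dots> \<le> CARD('q) / l * ((B + 3 * C ^ 4 * kk * B) * sqrt (N * D ^ 3) + (2 + sqrt CARD('k)) * (kk * B * (4 * C ^ 4)) * sqrt (N * D ^ 3))"
    using l_pos by (intro mult_left_mono add_mono Oh1 Oh2) auto
  also have "\<dots> = K\<^sub>V B * \<eta>" by (simp add: K\<^sub>V_def \<eta>_def field_simps)
  finally show "norm (P ** Vh w ** P - mat 1) \<le> K\<^sub>V B * \<eta>" .
  show "transpose (Vh w) = Vh w" unfolding Vh_def by (rule p.transpose_sandwich_V_hat[OF close])
qed

lemma good_event_AE:
  assumes "0 \<le> B" "B * (c1 * \<eta>) \<le> c\<^sub>Q / 2" "kk * B * (c1 * \<eta>) \<le> 1"
  shows "AE w in M. Z w \<le> B\<^sup>2 \<longrightarrow> norm (T w - U w) \<le> K\<^sub>T B * sqrt (2 * \<eta>) \<and> norm (P ** Vh w ** P - mat 1) \<le> K\<^sub>V B * \<eta>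
     \<and> transpose (Vh w) = Vh w \<and> norm (U w) \<le> B"
  using trunc_AE AE_space
proof eventually_elim
  case (elim w)
  then show ?case using good_event[OF elim(2) elim(1) _ assms] Z_components(4)[OF _ assms(1)] by blast
qed

lemma P: "pos_def P" "transpose P = P" "P ** mat_sqrt V = mat 1" "mat_sqrt V ** P = mat 1"
  using mat_inv_sqrt(1)[OF pos_def_V] pos_defD(1) matrix_inv[OF pos_def_invertible[OF mat_sqrt(1)[OF pos_def_V]]]
  by (auto simp: P_def mat_inv_sqrt_def)

text \<open>A symmetric matrix within 1/2 of I is positive definite, and congruence with V^(1/2)
  leads back from P Vh P to Vh.\<close>

lemma pos_def_Vh:
  assumes "norm (P ** Vh w ** P - mat 1) \<le> 1/2" "transpose (Vh w) = Vh w"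
  shows "pos_def (Vh w)"
proof -
  let ?W = "P ** Vh w ** P"
  have "pos_def ?W"
  proof (rule pos_defI[of _ "1/2"])
    show "transpose ?W = ?W" by (simp add: matrix_transpose_mul assms(2) P(2) matrix_mul_assoc)
    fix v
    have "norm ((?W - mat 1) *v v) \<le> 1/2 * norm v"
      using norm_matrix_vector_mult_le[of "?W - mat 1" v] assms(1) by (meson mult_right_mono norm_ge_zero order_trans)
    then have "\<bar>v \<bullet> ((?W - mat 1) *v v)\<bar> \<le> norm v * (1/2 * norm v)"
      by (meson Cauchy_Schwarz_ineq2 mult_left_mono norm_ge_zero order_trans)
    moreover have "norm v * (1/2 * norm v) = 1/2 * (v \<bullet> v)"
      by (simp add: power2_norm_eq_inner[symmetric] power2_eq_square)
    moreover have "v \<bullet> (?W *v v) = v \<bullet> v + v \<bullet> ((?W - mat 1) *v v)"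
      by (simp add: matrix_vector_mult_diff_rdistrib inner_diff_right)
    ultimately show "1/2 * (v \<bullet> v) \<le> v \<bullet> (?W *v v)" by linarith
  qed simp
  then have "pos_def (transpose (mat_sqrt V) ** ?W ** mat_sqrt V)"
    by (rule pos_def_congruence) (metis P(3) matrix_vector_mul_assoc matrix_vector_mul_lid matrix_vector_mult_0_right)
  moreover have "transpose (mat_sqrt V) ** ?W ** mat_sqrt V = (mat_sqrt V ** P) ** Vh w ** (P ** mat_sqrt V)"
    by (simp add: pos_defD(1)[OF mat_sqrt(1)[OF pos_def_V]] matrix_mul_assoc)
  ultimately show ?thesis by (simp add: P)
qed

text \<open>Vh^(-1/2) = H V^(-1/2) with H = Vh^(-1/2) V^(1/2), so the studentized error is H T, and
  \<open>inv_sqrt_ratio_bound\<close> applies to H - I.\<close>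

lemma studentized_deviation:
  assumes W: "norm (P ** Vh w ** P - mat 1) \<le> 1/2" and sym: "transpose (Vh w) = Vh w"
  shows "norm (mat_inv_sqrt (Vh w) *v (transpose R *v (b w - \<beta>)) - T w) \<le> 2 * sqrt CARD('q) * norm (P ** Vh w ** P - mat 1) * norm (T w)"
proof -
  define H where "H = mat_inv_sqrt (Vh w) ** mat_sqrt V"
  have "mat_sqrt V *v T w = transpose R *v (b w - \<beta>)"
    unfolding T_def matrix_vector_mul_assoc[of "mat_sqrt V"] P(4) by (simp del: transpose_matrix_vector)
  then have "mat_inv_sqrt (Vh w) *v (transpose R *v (b w - \<beta>)) - T w = (H - mat 1) *v T w"
    by (simp add: H_def matrix_vector_mult_diff_rdistrib matrix_vector_mul_assoc[symmetric] del: transpose_matrix_vector)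
  then have "norm (mat_inv_sqrt (Vh w) *v (transpose R *v (b w - \<beta>)) - T w) \<le> norm (H - mat 1) * norm (T w)"
    by (simp add: norm_matrix_vector_mult_le del: transpose_matrix_vector)
  also have "\<dots> \<le> 2 * sqrt CARD('q) * norm (P ** Vh w ** P - mat 1) * norm (T w)"
    unfolding H_def P_def
    by (intro mult_right_mono inv_sqrt_ratio_bound pos_def_V pos_def_Vh W[unfolded P_def] W sym) simp
  finally show ?thesis .
qed

text \<open>Under the null hypothesis R' b - r = R' (b - \<beta>), and the inverse of Vh is the
  square of its symmetric inverse root.\<close>

lemma wald_eq:
  assumes pd: "pos_def (Vh w)" and r: "transpose R *v \<beta> = r"
  shows "wald N \<psi> R r (\<lambda>n. x n w) (\<lambda>n. y n w) = (norm (mat_inv_sqrt (Vh w) *v (transpose R *v (b w - \<beta>))))\<^sup>2"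
proof -
  define d where "d = transpose R *v (b w - \<beta>)"
  have d: "d = transpose R *v b w - r" by (simp add: d_def r[symmetric] matrix_vector_mult_diff_distrib del: transpose_matrix_vector)
  let ?H = "mat_inv_sqrt (Vh w)"
  have "wald N \<psi> R r (\<lambda>n. x n w) (\<lambda>n. y n w) = d \<bullet> (matrix_inv (Vh w) *v d)"
    using pos_def_invertible[OF pd] by (simp add: wald_def Let_def d b_def Vh_def del: transpose_matrix_vector)
  also have "matrix_inv (Vh w) = ?H ** ?H" by (rule mat_inv_sqrt(3)[OF pd, symmetric])
  also have "d \<bullet> ((?H ** ?H) *v d) = (?H *v d) \<bullet> (?H *v d)"
    using symmetric_dot[OF pos_defD(1)[OF mat_inv_sqrt(1)[OF pd]]] by (simp add: matrix_vector_mul_assoc[symmetric])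
  finally show ?thesis by (simp add: d_def power2_norm_eq_inner del: transpose_matrix_vector)
qed

section \<open>Measurability of the estimators and test statistics\<close>

lemma y_meas: "n \<in> {1..N} \<Longrightarrow> y n \<in> borel_measurable M"
proof -
  assume n: "n \<in> {1..N}"
  note [measurable] = x_meas[OF n] u_meas[OF n]
  have "(\<lambda>w. \<beta> \<bullet> x n w + u n w) \<in> borel_measurable M" by measurable
  then show ?thesis by (rule measurable_cong[THEN iffD2, rotated]) (rule model[OF n])
qed

lemma gram_meas [measurable]: "(\<lambda>w. gram N (\<lambda>n. x n w)) \<in> borel_measurable M"
  unfolding gram_def by (intro borel_measurable_sum borel_measurable_outer x_meas)

lemma b_meas [measurable]: "b \<in> borel_measurable M"
proof -
  have s: "(\<lambda>w. \<Sum>n=1..N. y n w *\<^sub>R x n w) \<in> borel_measurable M"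
    by (intro borel_measurable_sum borel_measurable_scaleR y_meas x_meas)
  have "b = (\<lambda>w. (if invertible (gram N (\<lambda>n. x n w)) then matrix_inv (gram N (\<lambda>n. x n w)) else 0) *v (\<Sum>n=1..N. y n w *\<^sub>R x n w))"
    by (auto simp: b_def beta_hat_def fun_eq_iff)
  also have "\<dots> \<in> borel_measurable M"
    by (intro borel_measurable_mat_vec borel_measurable_matrix_inv gram_meas s)
  finally show ?thesis .
qed

lemma Vh_meas [measurable]: "Vh \<in> borel_measurable M"
proof -
  have r: "(\<lambda>w. residual N (\<lambda>n. x n w) (\<lambda>n. y n w) n) \<in> borel_measurable M" if "n \<in> {1..N}" for n
    unfolding residual_def b_def[symmetric] using y_meas[OF that] x_meas[OF that] by measurable
  have o: "(\<lambda>w. Omega_hat N \<psi> (\<lambda>n. x n w) (\<lambda>n. y n w)) \<in> borel_measurable M"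
    unfolding Omega_hat_def
    by (intro borel_measurable_sum borel_measurable_scaleR borel_measurable_outer borel_measurable_times borel_measurable_const x_meas r)
  let ?inv = "\<lambda>w. if invertible (Q_hat N (\<lambda>n. x n w)) then matrix_inv (Q_hat N (\<lambda>n. x n w)) else 0"
  have q: "?inv \<in> borel_measurable M"
    unfolding Q_hat_def by (intro borel_measurable_matrix_inv) measurable
  have i: "invertible (Q_hat N (\<lambda>n. x n w)) \<longleftrightarrow> invertible (gram N (\<lambda>n. x n w))" for w
  proof -
    have "gram N (\<lambda>n. x n w) = real N *\<^sub>R Q_hat N (\<lambda>n. x n w)" using N_pos by (simp add: Q_hat_def)
    then show ?thesis
      using scalar_invertible[of "real N" "Q_hat N (\<lambda>n. x n w)"] scalar_invertible[of "1 / real N" "gram N (\<lambda>n. x n w)"] N_pos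
      unfolding Q_hat_def by auto
  qed
  have "Vh = (\<lambda>w. transpose R ** (if invertible (gram N (\<lambda>n. x n w)) then (1 / (real N)\<^sup>2) *\<^sub>R
      (?inv w ** Omega_hat N \<psi> (\<lambda>n. x n w) (\<lambda>n. y n w) ** ?inv w) else 0) ** R)"
    by (auto simp: Vh_def sandwich_def V_hat_def i fun_eq_iff)
  also have "\<dots> \<in> borel_measurable M"
    by (intro borel_measurable_mat_mul borel_measurable_const measurable_If borel_measurable_scaleR q o) measurable
  finally show ?thesis .
qed

lemma T_meas [measurable]: "T \<in> borel_measurable M"
  unfolding T_def[abs_def] by measurable

text \<open>The free function z is the arbitrary value of the statistic off the event.\<close>

lemma studentized_meas:
  assumes [measurable]: "z \<in> borel_measurable M"
  shows "(\<lambda>w. if pos_def (Vh w) then mat_inv_sqrt (Vh w) *v (transpose R *v (b w - \<beta>)) else z w) \<in> borel_measurable M"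
proof -
  have "(\<lambda>w. if pos_def (Vh w) then (if pos_def (Vh w) then mat_inv_sqrt (Vh w) else 0) *v (transpose R *v (b w - \<beta>)) else z w) \<in> borel_measurable M"
    by (intro measurable_If borel_measurable_mat_vec borel_measurable_mat_inv_sqrt) measurable
  then show ?thesis by (simp cong: if_cong)
qed

lemma wald_meas: "(\<lambda>w. wald N \<psi> R r (\<lambda>n. x n w) (\<lambda>n. y n w)) \<in> borel_measurable M"
proof -
  have "(\<lambda>w. wald N \<psi> R r (\<lambda>n. x n w) (\<lambda>n. y n w)) = (\<lambda>w. if invertible (Vh w) then
     (transpose R *v b w - r) \<bullet> ((if invertible (Vh w) then matrix_inv (Vh w) else 0) *v (transpose R *v b w - r)) else 0)"
    by (auto simp: wald_def Let_def Vh_def b_def fun_eq_iff)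
  also have "\<dots> \<in> borel_measurable M"
    by (intro measurable_If borel_measurable_inner borel_measurable_mat_vec borel_measurable_matrix_inv Vh_meas) measurable
  finally show ?thesis .
qed

text \<open>\<open>score_char_bound\<close> in the direction A' t, whose score variance is |t|^2 by
  \<open>A_isometry\<close>.\<close>

lemma U_char_bound:
  assumes t: "t \<noteq> 0"
  defines "e \<equiv> C ^ 8 * \<eta>\<^sup>2"
  defines "r \<equiv> 3 * sqrt e + 4 * e"
  assumes k: "0 < k" "r \<le> 1" "r * 40 < exp (- 1 - (14 + 2 / k)\<^sup>2)"
  shows "\<bar>expectation (\<lambda>w. cos (t \<bullet> U w + \<theta>)) - cos \<theta> * exp (- (norm t)\<^sup>2 / 2)\<bar> \<le> norm t * (k * (norm t)\<^sup>2 + (1 + norm t) ^ 3 * r)"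
proof -
  have e: "e = C ^ 8 * (N * D ^ 3 / (lambda_min \<Omega>)\<^sup>2)"
    using D1 by (simp add: e_def \<eta>_def power_divide l_def)
  let ?a = "transpose A *v t"
  have "?a \<bullet> (\<Omega> *v ?a) = t \<bullet> ((A ** \<Omega> ** transpose A) *v t)"
    by (simp only: transpose_dot matrix_vector_mul_assoc matrix_mul_assoc)
  then have a: "?a \<bullet> (\<Omega> *v ?a) = (norm t)\<^sup>2" by (simp add: A_isometry power2_norm_eq_inner)
  have "\<bar>expectation (\<lambda>w. cos (?a \<bullet> S w + \<theta>)) - cos \<theta> * exp (- (norm t)\<^sup>2 / 2)\<bar> \<le> norm t * (k * (norm t)\<^sup>2 + (1 + norm t) ^ 3 * r)"
    unfolding r_def e
    by (rule score_char_bound[OF Omega _ a]) (use t k in \<open>auto simp: r_def e\<close>)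
  then show ?thesis by (simp only: transpose_dot U_def)
qed

end


section \<open>Limits along the sequence of samples\<close>

text \<open>Stated for a sequence that is regular at every index; the final theorem applies it to
  the sequence started at G = 2.\<close>

lemma dyadic_regression_limits:
  fixes M :: "nat \<Rightarrow> 'a measure"
    and x :: "nat \<Rightarrow> nat \<Rightarrow> 'a \<Rightarrow> real ^ 'k"
    and u y :: "nat \<Rightarrow> nat \<Rightarrow> 'a \<Rightarrow> real"
    and R :: "nat \<Rightarrow> real ^ 'q ^ 'k"
  assumes reg: "\<And>G. dyadic_regression (M G) (N G) (\<psi> G) (x G) (u G) C (D G) (y G) (\<beta> G) (R G) c\<^sub>Q"
    and eta: "(\<lambda>G. sqrt (N G * D G ^ 3) / lambda_min (Omega_pop (M G) (N G) (x G) (u G))) \<longlonglongrightarrow> 0"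
  defines "b \<equiv> \<lambda>G w. beta_hat (N G) (\<lambda>n. x G n w) (\<lambda>n. y G n w)"
    and "V \<equiv> \<lambda>G. sandwich (R G) (V_pop (M G) (N G) (x G) (u G))"
    and "Vh \<equiv> \<lambda>G w. sandwich (R G) (V_hat (N G) (\<psi> G) (\<lambda>n. x G n w) (\<lambda>n. y G n w))"
  shows "converges_in_distribution M
           (\<lambda>G w. mat_inv_sqrt (V G) *v (transpose (R G) *v (b G w - \<beta> G))) std_normal_vec"
    and "mat_converges_in_probability M
           (\<lambda>G w. mat_inv_sqrt (V G) ** Vh G w ** mat_inv_sqrt (V G)) (mat 1)"
    and "(\<lambda>G. measure (M G) {w \<in> space (M G). pos_def (Vh G w)}) \<longlonglongrightarrow> 1"
    and "(\<And>G. z G \<in> borel_measurable (M G)) \<Longrightarrow> converges_in_distribution M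
             (\<lambda>G w. if pos_def (Vh G w) then mat_inv_sqrt (Vh G w) *v (transpose (R G) *v (b G w - \<beta> G)) else z G w)
             std_normal_vec"
    and "(\<And>G. transpose (R G) *v \<beta> G = r G) \<Longrightarrow>
      (\<lambda>G. measure (M G) {w \<in> space (M G). wald (N G) (\<psi> G) (R G) (r G) (\<lambda>n. x G n w) (\<lambda>n. y G n w)
        \<noteq> (norm (if pos_def (Vh G w) then mat_inv_sqrt (Vh G w) *v (transpose (R G) *v (b G w - \<beta> G)) else 0))\<^sup>2}) \<longlonglongrightarrow> 0"
proof -
  interpret dr: dyadic_regression "M G" "N G" "\<psi> G" "x G" "u G" C "D G" "y G" "\<beta> G" "R G" c\<^sub>Q for G
    by (rule reg)
  have b: "b G w = dr.b G w" and Vh: "Vh G w = dr.Vh G w" and V: "V G = dr.V G" for G w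
    by (simp_all add: b_def Vh_def V_def dr.b_def dr.Vh_def dr.V_def)
  have eta0: "(\<lambda>G. dr.\<eta> G) \<longlonglongrightarrow> 0" using eta by (simp add: dr.\<eta>_def dr.l_def)
  have small: "\<forall>\<^sub>F G in sequentially. a * dr.\<eta> G \<le> e" if "0 < e" for a e :: real
  proof -
    have "(\<lambda>G. a * dr.\<eta> G) \<longlonglongrightarrow> a * 0" by (intro tendsto_mult_left eta0)
    then have "(\<lambda>G. a * dr.\<eta> G) \<longlonglongrightarrow> 0" by simp
    from order_tendstoD(2)[OF this that] show ?thesis by eventually_elim simp
  qed
  have small': "\<forall>\<^sub>F G in sequentially. a * sqrt (2 * dr.\<eta> G) \<le> e" if "0 < e" for a e :: real
  proof -
    have "(\<lambda>G. a * sqrt (2 * dr.\<eta> G)) \<longlonglongrightarrow> a * sqrt (2 * 0)" by (intro tendsto_intros eta0)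
    then have "(\<lambda>G. a * sqrt (2 * dr.\<eta> G)) \<longlonglongrightarrow> 0" by simp
    from order_tendstoD(2)[OF this that] show ?thesis by eventually_elim simp
  qed
  define good where "good B \<epsilon> G w \<longleftrightarrow> norm (dr.T G w - dr.U G w) \<le> \<epsilon> \<and> norm (dr.P G ** dr.Vh G w ** dr.P G - mat 1) \<le> \<epsilon>
     \<and> transpose (dr.Vh G w) = dr.Vh G w \<and> norm (dr.U G w) \<le> B" for B \<epsilon> G w
  have good: "\<forall>\<^sub>F G in sequentially. AE w in M G. dr.Z G w \<le> B\<^sup>2 \<longrightarrow> good B \<epsilon> G w" if "0 < B" "0 < \<epsilon>" for B \<epsilon>
  proof -
    have "0 < c\<^sub>Q / 2" using dr.cQ by simp
    from small[OF this, of "B * dr.c1"] show ?thesis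
      using small[OF zero_less_one, of "dr.kk * B * dr.c1"]
        small[OF that(2), of "dr.K\<^sub>V B"] small'[OF that(2), of "dr.K\<^sub>T B"]
    proof eventually_elim
      case (elim G)
      have "AE w in M G. dr.Z G w \<le> B\<^sup>2 \<longrightarrow> norm (dr.T G w - dr.U G w) \<le> dr.K\<^sub>T B * sqrt (2 * dr.\<eta> G)
          \<and> norm (dr.P G ** dr.Vh G w ** dr.P G - mat 1) \<le> dr.K\<^sub>V B * dr.\<eta> G
          \<and> transpose (dr.Vh G w) = dr.Vh G w \<and> norm (dr.U G w) \<le> B"
        by (rule dr.good_event_AE) (use elim(1,2) that in \<open>simp_all add: mult.assoc\<close>)
      then show ?case
        by eventually_elim (use elim(3,4) in \<open>auto simp: good_def\<close>)
    qed
  qed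
  \<comment> \<open>To show that an event is negligible it now suffices to name, for each B, an
    \<epsilon> for which \<open>good\<close> excludes it.\<close>
  have bad: "(\<lambda>G. measure (M G) {w \<in> space (M G). Bad G w}) \<longlonglongrightarrow> 0"
    if Bad: "\<And>G. {w \<in> space (M G). Bad G w} \<in> sets (M G)"
      and ex: "\<And>B. 0 < B \<Longrightarrow> \<exists>\<epsilon>>0. \<forall>G w. good B \<epsilon> G w \<longrightarrow> \<not> Bad G w" for Bad
  proof (rule measure_bad_tendsto_zero[where Z = "dr.Z" and c = "dr.K\<^sub>Z"])
    fix B :: real assume B: "0 < B"
    show "\<forall>\<^sub>F G in sequentially. measure (M G) {w \<in> space (M G). B\<^sup>2 < dr.Z G w} \<le> dr.K\<^sub>Z / B\<^sup>2"
      using dr.Z_tail[OF B] by simp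
    obtain \<epsilon> where e: "0 < \<epsilon>" "\<And>G w. good B \<epsilon> G w \<Longrightarrow> \<not> Bad G w" using ex[OF B] by blast
    show "\<forall>\<^sub>F G in sequentially. AE w in M G. dr.Z G w \<le> B\<^sup>2 \<longrightarrow> \<not> Bad G w"
      using good[OF B e(1)] by eventually_elim (auto elim!: eventually_mono dest: e(2))
  qed (use Bad dr.prob_space_axioms dr.Z_meas in auto)
  have prob: "\<forall>\<^sub>F G in sequentially. prob_space (M G)" using dr.prob_space_axioms by simp
  have char: "(\<lambda>G. \<integral>w. cos (t \<bullet> dr.U G w + \<theta>) \<partial>M G) \<longlonglongrightarrow> cos \<theta> * exp (- (norm t)\<^sup>2 / 2)" for t \<theta>
  proof (cases "t = 0")
    case True
    then show ?thesis by (simp add: dr.prob_space)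
  next
    case False
    define r where "r G = 3 * sqrt (C ^ 8 * (dr.\<eta> G)\<^sup>2) + 4 * (C ^ 8 * (dr.\<eta> G)\<^sup>2)" for G
    have "r \<longlonglongrightarrow> 3 * sqrt (C ^ 8 * 0\<^sup>2) + 4 * (C ^ 8 * 0\<^sup>2)"
      unfolding r_def[abs_def] by (intro tendsto_intros eta0)
    then have r0: "r \<longlonglongrightarrow> 0" by simp
    have "(\<lambda>G. \<bar>(\<integral>w. cos (t \<bullet> dr.U G w + \<theta>) \<partial>M G) - cos \<theta> * exp (- (norm t)\<^sup>2 / 2)\<bar>) \<longlonglongrightarrow> 0"
    proof (rule tendsto_zeroI)
      fix e :: real assume e: "0 < e"
      \<comment> \<open>Makes the contribution of the third-order coefficient equal to e/2; the last
        threshold on r leaves e/2 for the rest.\<close>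
      define k where "k = e / (2 * norm t ^ 3)"
      have k: "0 < k" "norm t * (k * (norm t)\<^sup>2) = e / 2"
        using e False by (auto simp: k_def power2_eq_square power3_eq_cube)
      have c: "0 < norm t * (1 + norm t) ^ 3" using False by (simp add: add_pos_nonneg)
      have "0 < exp (- 1 - (14 + 2 / k)\<^sup>2) / 40" "0 < e / (2 * (norm t * (1 + norm t) ^ 3))"
        using e c by auto
      note ev = order_tendstoD(2)[OF r0 zero_less_one] order_tendstoD(2)[OF r0 this(1)] order_tendstoD(2)[OF r0 this(2)]
      show "\<forall>\<^sub>F G in sequentially. \<bar>(\<integral>w. cos (t \<bullet> dr.U G w + \<theta>) \<partial>M G) - cos \<theta> * exp (- (norm t)\<^sup>2 / 2)\<bar> \<le> e"
        using ev
      proof eventually_elim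
        case (elim G)
        have "\<bar>(\<integral>w. cos (t \<bullet> dr.U G w + \<theta>) \<partial>M G) - cos \<theta> * exp (- (norm t)\<^sup>2 / 2)\<bar> \<le> norm t * (k * (norm t)\<^sup>2 + (1 + norm t) ^ 3 * r G)"
          using elim(1,2) unfolding r_def by (intro dr.U_char_bound[OF False k(1)]) simp_all
        also have "\<dots> = e / 2 + (norm t * (1 + norm t) ^ 3) * r G" using k(2) by (simp add: distrib_left)
        also have "\<dots> \<le> e / 2 + (norm t * (1 + norm t) ^ 3) * (e / (2 * (norm t * (1 + norm t) ^ 3)))"
          using elim(3) c by (intro add_left_mono mult_left_mono) auto
        also have "\<dots> = e"
        proof -
          have "q * (e / (2 * q)) = e / 2" if "0 < q" for q :: real using that by (simp add: field_simps)
          from this[OF c] show ?thesis by simp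
        qed
        finally show ?case .
      qed
    qed simp
    then show ?thesis by (simp add: tendsto_rabs_zero_iff LIM_zero_iff)
  qed
  have tight: "tight_seq M dr.U" unfolding tight_seq_def
  proof (intro allI impI)
    fix e :: real assume e: "0 < e"
    define B where "B = sqrt ((\<bar>dr.K\<^sub>Z\<bar> + 1) / e)"
    have B: "0 < B" "B\<^sup>2 = (\<bar>dr.K\<^sub>Z\<bar> + 1) / e" using e by (auto simp: B_def)
    have "dr.K\<^sub>Z / B\<^sup>2 \<le> (\<bar>dr.K\<^sub>Z\<bar> + 1) / B\<^sup>2" by (rule divide_right_mono) simp_all
    also have "\<dots> = e" using e by (simp add: B(2))
    finally have ce: "dr.K\<^sub>Z / B\<^sup>2 \<le> e" .
    have "measure (M G) {w \<in> space (M G). B < norm (dr.U G w)} \<le> e" for G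
    proof -
      have "measure (M G) {w \<in> space (M G). B < norm (dr.U G w)} \<le> measure (M G) {w \<in> space (M G). B\<^sup>2 < dr.Z G w}"
        using dr.Z_components(4)[of _ _ B] B(1)
        by (intro dr.finite_measure_mono) (auto simp: not_le[symmetric] less_imp_le)
      then show ?thesis using dr.Z_tail[OF B(1), of G] ce by linarith
    qed
    then show "\<exists>L>0. \<forall>\<^sub>F G in sequentially. measure (M G) {w \<in> space (M G). L < norm (dr.U G w)} \<le> e"
      using B(1) by (intro exI[of _ B]) simp
  qed
  have TU: "tends_to_zero_in_prob M (\<lambda>G w. dr.T G w - dr.U G w)" unfolding tends_to_zero_in_prob_def
  proof (intro allI impI bad)
    fix e B :: real assume e: "0 < e"
    show "\<exists>\<epsilon>>0. \<forall>G w. good B \<epsilon> G w \<longrightarrow> \<not> e < norm (dr.T G w - dr.U G w)"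
      by (intro exI[of _ e]) (auto simp: good_def e)
  qed simp
  have "converges_in_distribution M dr.T std_normal_vec"
    by (rule converges_in_distribution_perturb[OF prob _ _ tight char TU]) simp_all
  then show "converges_in_distribution M (\<lambda>G w. mat_inv_sqrt (V G) *v (transpose (R G) *v (b G w - \<beta> G))) std_normal_vec"
    by (simp only: dr.T_def[abs_def] b V dr.P_def)
  show "mat_converges_in_probability M (\<lambda>G w. mat_inv_sqrt (V G) ** Vh G w ** mat_inv_sqrt (V G)) (mat 1)"
    unfolding mat_converges_in_probability_def V Vh dr.P_def[symmetric]
  proof (intro conjI allI impI)
    show "\<forall>\<^sub>F G in sequentially. (\<lambda>w. dr.P G ** dr.Vh G w ** dr.P G) \<in> borel_measurable (M G)" by simp
    fix e :: real assume e: "0 < e"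
    have lim: "(\<lambda>G. measure (M G) {w \<in> space (M G). e < norm (dr.P G ** dr.Vh G w ** dr.P G - mat 1)}) \<longlonglongrightarrow> 0"
    proof (rule bad)
      show "\<exists>\<epsilon>>0. \<forall>G w. good B \<epsilon> G w \<longrightarrow> \<not> e < norm (dr.P G ** dr.Vh G w ** dr.P G - mat 1)" for B
        by (intro exI[of _ e]) (auto simp: good_def e)
    qed simp
    have le: "measure (M G) {w \<in> space (M G). e < spectral_norm (dr.P G ** dr.Vh G w ** dr.P G - mat 1)}
      \<le> measure (M G) {w \<in> space (M G). e < norm (dr.P G ** dr.Vh G w ** dr.P G - mat 1)}" for G
      by (rule dr.finite_measure_mono) (auto intro: less_le_trans[OF _ spectral_norm_le_norm])
    show "(\<lambda>G. measure (M G) {w \<in> space (M G). e < spectral_norm (dr.P G ** dr.Vh G w ** dr.P G - mat 1)}) \<longlonglongrightarrow> 0"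
      by (rule tendsto_sandwich[OF _ _ tendsto_const lim]) (use le in auto)
  qed
  have notpd: "(\<lambda>G. measure (M G) {w \<in> space (M G). \<not> pos_def (dr.Vh G w)}) \<longlonglongrightarrow> 0"
  proof (rule bad)
    show "\<exists>\<epsilon>>0. \<forall>G w. good B \<epsilon> G w \<longrightarrow> \<not> \<not> pos_def (dr.Vh G w)" for B
      by (intro exI[of _ "1/2"]) (auto simp: good_def intro: dr.pos_def_Vh)
  qed measurable
  have "measure (M G) {w \<in> space (M G). pos_def (dr.Vh G w)} = 1 - measure (M G) {w \<in> space (M G). \<not> pos_def (dr.Vh G w)}" for G
    by (subst dr.prob_neg) auto
  then show "(\<lambda>G. measure (M G) {w \<in> space (M G). pos_def (Vh G w)}) \<longlonglongrightarrow> 1"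
    unfolding Vh using tendsto_diff[OF tendsto_const notpd, of 1] by simp
  show "converges_in_distribution M
      (\<lambda>G w. if pos_def (Vh G w) then mat_inv_sqrt (Vh G w) *v (transpose (R G) *v (b G w - \<beta> G)) else z G w) std_normal_vec"
    if z: "\<And>G. z G \<in> borel_measurable (M G)"
  proof -
    define Y where "Y G w = (if pos_def (dr.Vh G w) then mat_inv_sqrt (dr.Vh G w) *v (transpose (R G) *v (dr.b G w - \<beta> G)) else z G w)" for G w
    have Ym[measurable]: "Y G \<in> borel_measurable (M G)" for G
      unfolding Y_def[abs_def] by (rule dr.studentized_meas[OF z])
    have "tends_to_zero_in_prob M (\<lambda>G w. Y G w - dr.U G w)" unfolding tends_to_zero_in_prob_def
    proof (intro allI impI bad)
      fix e B :: real assume e: "0 < e" and B: "0 < B"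
      \<comment> \<open>2 sqrt q (B + 1) comes from studentization with |T| \<le> B + 1, and 1 from
        the distance of T to U.\<close>
      define c where "c = 2 * sqrt CARD('q) * (B + 1) + 1"
      have c: "1 \<le> c" using B by (simp add: c_def)
      define \<epsilon> where "\<epsilon> = min (1/2) (e / c)"
      have eps: "0 < \<epsilon>" "\<epsilon> \<le> 1/2" "c * \<epsilon> \<le> e"
      proof -
        show "0 < \<epsilon>" using e c by (simp add: \<epsilon>_def)
        show "\<epsilon> \<le> 1/2" unfolding \<epsilon>_def by (rule min.cobounded1)
        have "c * \<epsilon> \<le> c * (e / c)" using c by (intro mult_left_mono) (auto simp: \<epsilon>_def)
        then show "c * \<epsilon> \<le> e" using c by simp
      qed
      have "norm (Y G w - dr.U G w) \<le> e" if g: "good B \<epsilon> G w" for G w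
      proof -
        have g': "norm (dr.T G w - dr.U G w) \<le> \<epsilon>" "norm (dr.P G ** dr.Vh G w ** dr.P G - mat 1) \<le> \<epsilon>"
          "transpose (dr.Vh G w) = dr.Vh G w" "norm (dr.U G w) \<le> B"
          using g by (auto simp: good_def)
        have half: "norm (dr.P G ** dr.Vh G w ** dr.P G - mat 1) \<le> 1/2" using g'(2) eps by linarith
        have "norm (dr.T G w) \<le> B + 1"
          using norm_triangle_sub[of "dr.T G w" "dr.U G w"] g'(1,4) eps by linarith
        moreover have Y: "Y G w = mat_inv_sqrt (dr.Vh G w) *v (transpose (R G) *v (dr.b G w - \<beta> G))"
          unfolding Y_def using dr.pos_def_Vh[OF half g'(3)] by simp
        ultimately have "norm (Y G w - dr.T G w) \<le> 2 * sqrt CARD('q) * \<epsilon> * (B + 1)"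
          unfolding Y using g'(2) eps
          by (intro order_trans[OF dr.studentized_deviation[OF half g'(3)]] mult_mono mult_nonneg_nonneg) auto
        moreover have "norm (Y G w - dr.U G w) \<le> norm (Y G w - dr.T G w) + norm (dr.T G w - dr.U G w)"
          using norm_triangle_ineq[of "Y G w - dr.T G w" "dr.T G w - dr.U G w"] by simp
        moreover have "2 * sqrt CARD('q) * \<epsilon> * (B + 1) + \<epsilon> = c * \<epsilon>" by (simp add: c_def algebra_simps)
        ultimately show ?thesis using g'(1) eps(3) by linarith
      qed
      then show "\<exists>\<epsilon>>0. \<forall>G w. good B \<epsilon> G w \<longrightarrow> \<not> e < norm (Y G w - dr.U G w)"
        using eps(1) by (intro exI[of _ \<epsilon>]) (auto simp: not_less)
    qed simp
    then have "converges_in_distribution M Y std_normal_vec"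
      by (intro converges_in_distribution_perturb[OF prob _ _ tight char]) simp_all
    then show ?thesis by (simp only: Y_def[abs_def] b Vh)
  qed
  show "(\<lambda>G. measure (M G) {w \<in> space (M G). wald (N G) (\<psi> G) (R G) (r G) (\<lambda>n. x G n w) (\<lambda>n. y G n w)
        \<noteq> (norm (if pos_def (Vh G w) then mat_inv_sqrt (Vh G w) *v (transpose (R G) *v (b G w - \<beta> G)) else 0))\<^sup>2}) \<longlonglongrightarrow> 0"
    if r: "\<And>G. transpose (R G) *v \<beta> G = r G"
  \<comment> \<open>Where \<open>Vh\<close> is positive definite the two statistics coincide by
    \<open>wald_eq\<close>.\<close>
  proof (rule tendsto_sandwich[OF _ _ tendsto_const notpd])
    show "\<forall>\<^sub>F G in sequentially. measure (M G) {w \<in> space (M G). wald (N G) (\<psi> G) (R G) (r G) (\<lambda>n. x G n w) (\<lambda>n. y G n w)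
        \<noteq> (norm (if pos_def (Vh G w) then mat_inv_sqrt (Vh G w) *v (transpose (R G) *v (b G w - \<beta> G)) else 0))\<^sup>2}
      \<le> measure (M G) {w \<in> space (M G). \<not> pos_def (dr.Vh G w)}"
      unfolding Vh b by (intro always_eventually allI dr.finite_measure_mono) (auto simp: dr.wald_eq[OF _ r])
  qed simp
qed

section \<open>From the dyadic configuration to the final theorem\<close>

text \<open>Each of the two units of a dyad is shared by at most \<open>count_max\<close>
  observations, the given one included.\<close>

lemma dyadic_degree_le:
  assumes \<psi>: "\<And>n. n \<in> {1..N} \<Longrightarrow> \<psi> n \<subseteq> {1..G} \<and> card (\<psi> n) = 2" and n: "n \<in> {1..N}"
  shows "card {m \<in> {1..N}. \<psi> n \<inter> \<psi> m \<noteq> {}} \<le> 2 * count_max G N \<psi>"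
proof -
  have "{m \<in> {1..N}. \<psi> n \<inter> \<psi> m \<noteq> {}} = (\<Union>g\<in>\<psi> n. {m \<in> {1..N}. g \<in> \<psi> m})" by auto
  moreover have fin: "finite (\<psi> n)" using \<psi>[OF n] by (metis card.infinite zero_neq_numeral)
  ultimately have "card {m \<in> {1..N}. \<psi> n \<inter> \<psi> m \<noteq> {}} \<le> (\<Sum>g\<in>\<psi> n. card {m \<in> {1..N}. g \<in> \<psi> m})"
    using card_UN_le[OF fin] by simp
  also have "\<dots> \<le> (\<Sum>g\<in>\<psi> n. count_max G N \<psi>)"
  proof (rule sum_mono)
    fix g assume "g \<in> \<psi> n"
    then have "g \<in> {1..G}" using \<psi>[OF n] by blast
    then show "card {m \<in> {1..N}. g \<in> \<psi> m} \<le> count_max G N \<psi>"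
      unfolding count_max_def unit_count_def by (intro Max_ge) auto
  qed
  also have "\<dots> = 2 * count_max G N \<psi>" using \<psi>[OF n] by simp
  finally show ?thesis .
qed

text \<open>With D twice the maximal count these yield 1 \<le> D and D \<le> 2 N, the side
  conditions of \<open>dyadic_regression\<close>.\<close>

lemma count_max_bounds:
  assumes \<psi>: "\<And>n. n \<in> {1..N} \<Longrightarrow> \<psi> n \<subseteq> {1..G} \<and> card (\<psi> n) = 2" and N: "0 < N"
  shows "1 \<le> count_max G N \<psi>" "count_max G N \<psi> \<le> N"
proof -
  have n: "1 \<in> {1..N}" using N by simp
  obtain g where g: "g \<in> \<psi> 1" using \<psi>[OF n] by (metis all_not_in_conv card.empty zero_neq_numeral)
  then have gG: "g \<in> {1..G}" using \<psi>[OF n] by blast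
  have "card {1::nat} \<le> card {m \<in> {1..N}. g \<in> \<psi> m}" using n g by (intro card_mono) auto
  then have "1 \<le> unit_count N \<psi> g" by (simp add: unit_count_def)
  also have "\<dots> \<le> count_max G N \<psi>" unfolding count_max_def using gG by (intro Max_ge) auto
  finally show "1 \<le> count_max G N \<psi>" .
  have "unit_count N \<psi> g \<le> N" for g
  proof -
    have "unit_count N \<psi> g \<le> card {1..N}" unfolding unit_count_def by (intro card_mono) auto
    then show ?thesis by simp
  qed
  then show "count_max G N \<psi> \<le> N" unfolding count_max_def using gG by (subst Max_le_iff) auto
qed

theorem theorem1:
  fixes M :: "nat \<Rightarrow> 'a measure"
    and N :: "nat \<Rightarrow> nat"
    and \<psi> :: "nat \<Rightarrow> nat \<Rightarrow> nat set"
    and x :: "nat \<Rightarrow> nat \<Rightarrow> 'a \<Rightarrow> real ^ 'k"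
    and u y :: "nat \<Rightarrow> nat \<Rightarrow> 'a \<Rightarrow> real"
    and \<beta> :: "nat \<Rightarrow> real ^ 'k"
    and R :: "nat \<Rightarrow> real ^ 'q ^ 'k"
    and r :: "nat \<Rightarrow> real ^ 'q"
    and C\<^sub>x C\<^sub>u c\<^sub>Q :: real
  assumes prob: "\<And>G. 2 \<le> G \<Longrightarrow> prob_space (M G)"
    and x_meas: "\<And>G n. \<lbrakk>2 \<le> G; n \<in> {1..N G}\<rbrakk> \<Longrightarrow> x G n \<in> borel_measurable (M G)"
    and u_meas: "\<And>G n. \<lbrakk>2 \<le> G; n \<in> {1..N G}\<rbrakk> \<Longrightarrow> u G n \<in> borel_measurable (M G)"
    and dyads: "\<And>G n. \<lbrakk>2 \<le> G; n \<in> {1..N G}\<rbrakk> \<Longrightarrow> \<psi> G n \<subseteq> {1..G} \<and> card (\<psi> G n) = 2"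
    and model: "\<And>G n \<omega>. \<lbrakk>2 \<le> G; n \<in> {1..N G}; \<omega> \<in> space (M G)\<rbrakk>
                  \<Longrightarrow> y G n \<omega> = \<beta> G \<bullet> x G n \<omega> + u G n \<omega>"
    and dyadic_dependence:
      "\<And>G S\<^sub>1 S\<^sub>2. \<lbrakk>2 \<le> G; S\<^sub>1 \<subseteq> {1..N G}; S\<^sub>2 \<subseteq> {1..N G}; S\<^sub>1 \<inter> S\<^sub>2 = {};
                   \<forall>n\<in>S\<^sub>1. \<forall>m\<in>S\<^sub>2. \<psi> G n \<inter> \<psi> G m = {}\<rbrakk>
         \<Longrightarrow> prob_space.indep_var (M G)
               (\<Pi>\<^sub>M n\<in>S\<^sub>1. borel) (\<lambda>\<omega>. \<lambda>n\<in>S\<^sub>1. (x G n \<omega>, u G n \<omega>))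
               (\<Pi>\<^sub>M n\<in>S\<^sub>2. borel) (\<lambda>\<omega>. \<lambda>n\<in>S\<^sub>2. (x G n \<omega>, u G n \<omega>))"
    and bounded_x: "\<And>G n. \<lbrakk>2 \<le> G; n \<in> {1..N G}\<rbrakk> \<Longrightarrow> AE \<omega> in M G. norm (x G n \<omega>) \<le> C\<^sub>x"
    and bounded_u: "\<And>G n. \<lbrakk>2 \<le> G; n \<in> {1..N G}\<rbrakk> \<Longrightarrow> AE \<omega> in M G. \<bar>u G n \<omega>\<bar> \<le> C\<^sub>u"
    and exogeneity: "\<And>G n. \<lbrakk>2 \<le> G; n \<in> {1..N G}\<rbrakk> \<Longrightarrow> (\<integral>\<omega>. u G n \<omega> *\<^sub>R x G n \<omega> \<partial>M G) = 0"
    and c\<^sub>Q_pos: "0 < c\<^sub>Q"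
    and identification: "\<And>G. 2 \<le> G \<Longrightarrow> c\<^sub>Q \<le> lambda_min (Q_pop (M G) (N G) (x G))"
    and Omega_pos_def: "\<And>G. 2 \<le> G \<Longrightarrow> pos_def (Omega_pop (M G) (N G) (x G) (u G))"
    and variance_accumulation:
      "(\<lambda>G. real (N G) * real (count_max G (N G) (\<psi> G)) ^ 3
              / (lambda_min (Omega_pop (M G) (N G) (x G) (u G)))\<^sup>2) \<longlonglongrightarrow> 0"
    and configuration: "\<forall>\<^sub>F G in sequentially. 1 \<le> count_min G (N G) (\<psi> G)"
    and full_column_rank: "\<And>G. 2 \<le> G \<Longrightarrow> rank (R G) = CARD('q)"
  defines "b \<equiv> \<lambda>G \<omega>. beta_hat (N G) (\<lambda>n. x G n \<omega>) (\<lambda>n. y G n \<omega>)"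
    and "\<V> \<equiv> \<lambda>G. sandwich (R G) (V_pop (M G) (N G) (x G) (u G))"
    and "\<V>hat \<equiv> \<lambda>G \<omega>. sandwich (R G) (V_hat (N G) (\<psi> G) (\<lambda>n. x G n \<omega>) (\<lambda>n. y G n \<omega>))"
  shows "(converges_in_distribution M
           (\<lambda>G \<omega>. mat_inv_sqrt (\<V> G) *v (transpose (R G) *v (b G \<omega> - \<beta> G)))
           std_normal_vec) \<and>
     (mat_converges_in_probability M
           (\<lambda>G \<omega>. mat_inv_sqrt (\<V> G) ** \<V>hat G \<omega> ** mat_inv_sqrt (\<V> G)) (mat 1)) \<and>
     ((\<lambda>G. measure (M G) {\<omega> \<in> space (M G). pos_def (\<V>hat G \<omega>)}) \<longlonglongrightarrow> 1) \<and>
     (\<forall>Z. (\<forall>G\<ge>2. Z G \<in> borel_measurable (M G)) \<longrightarrow>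
           converges_in_distribution M
             (\<lambda>G \<omega>. if pos_def (\<V>hat G \<omega>)
                     then mat_inv_sqrt (\<V>hat G \<omega>) *v (transpose (R G) *v (b G \<omega> - \<beta> G))
                     else Z G \<omega>)
             std_normal_vec) \<and>
     ((\<forall>G\<ge>2. transpose (R G) *v \<beta> G = r G) \<longrightarrow>
           weak_conv_m
             (\<lambda>G. distr (M G) borel (\<lambda>\<omega>. wald (N G) (\<psi> G) (R G) (r G) (\<lambda>n. x G n \<omega>) (\<lambda>n. y G n \<omega>)))
             (chi_square_distribution CARD('q)))"
proof -
  define C where "C = max 1 (max C\<^sub>x C\<^sub>u)"
  define D where "D G = 2 * real (count_max G (N G) (\<psi> G))" for G
  \<comment> \<open>An empty sample has \<Omega> = 0, which is not positive definite.\<close>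
  have N_pos: "0 < N G" if G: "2 \<le> G" for G
  proof (rule ccontr)
    assume "\<not> 0 < N G"
    then have "score_sum (N G) (x G) (u G) = (\<lambda>w. 0)" by (simp add: score_sum_def fun_eq_iff)
    then have "Omega_pop (M G) (N G) (x G) (u G) = 0"
      by (simp add: Omega_pop_def covariance_matrix_def outer_def vec_eq_iff Let_def flip: zero_vec_def)
    then have "axis undefined 1 \<bullet> (0 *v axis undefined 1 :: real^'k) > 0"
      using pos_defD(2)[OF Omega_pos_def[OF G], of "axis undefined 1"] by simp
    then show False by simp
  qed
  have reg: "dyadic_regression (M G) (N G) (\<psi> G) (x G) (u G) C (D G) (y G) (\<beta> G) (R G) c\<^sub>Q" if G: "2 \<le> G" for G
  proof -
    interpret prob_space "M G" by (rule prob[OF G])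
    note cm = count_max_bounds[of "N G" "\<psi> G" G, OF dyads[OF G] N_pos[OF G]]
    show ?thesis
    proof unfold_locales
      show "real (card {m \<in> {1..N G}. \<psi> G n \<inter> \<psi> G m \<noteq> {}}) \<le> D G" if "n \<in> {1..N G}" for n
        using of_nat_mono[OF dyadic_degree_le[of "N G" "\<psi> G" G n, OF dyads[OF G] that], where 'a = real]
        by (simp add: D_def)
      show "\<psi> G n \<noteq> {}" if "n \<in> {1..N G}" for n using dyads[OF G that] by auto
      show "AE w in M G. norm (x G n w) \<le> C" if "n \<in> {1..N G}" for n
        using bounded_x[OF G that] by eventually_elim (simp add: C_def)
      show "AE w in M G. \<bar>u G n w\<bar> \<le> C" if "n \<in> {1..N G}" for n
        using bounded_u[OF G that] by eventually_elim (simp add: C_def)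
      show "v = 0" if "R G *v v = 0" for v
        using full_rank_injective[of "R G"] full_column_rank[OF G] that
        by (metis injD matrix_vector_mult_0_right)
      show "D G \<le> 2 * real (N G)" using cm by (simp add: D_def)
      show "1 \<le> D G" using cm by (simp add: D_def)
    qed (use G x_meas u_meas dyadic_dependence exogeneity model N_pos Omega_pos_def c\<^sub>Q_pos identification in \<open>auto simp: C_def D_def\<close>)
  qed
  have eta: "(\<lambda>G. sqrt (N G * D G ^ 3) / lambda_min (Omega_pop (M G) (N G) (x G) (u G))) \<longlonglongrightarrow> 0"
  proof -
    \<comment> \<open>8 = 2^3, since D is twice the maximal count.\<close>
    have "(\<lambda>G. sqrt (8 * (real (N G) * real (count_max G (N G) (\<psi> G)) ^ 3
              / (lambda_min (Omega_pop (M G) (N G) (x G) (u G)))\<^sup>2))) \<longlonglongrightarrow> sqrt (8 * 0)"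
      by (intro tendsto_intros variance_accumulation)
    moreover have "\<forall>\<^sub>F G in sequentially. sqrt (8 * (real (N G) * real (count_max G (N G) (\<psi> G)) ^ 3
              / (lambda_min (Omega_pop (M G) (N G) (x G) (u G)))\<^sup>2)) = sqrt (N G * D G ^ 3) / lambda_min (Omega_pop (M G) (N G) (x G) (u G))"
      using eventually_ge_at_top[of 2]
    proof eventually_elim
      case (elim G)
      let ?l = "lambda_min (Omega_pop (M G) (N G) (x G) (u G))"
      have l: "0 < ?l" by (rule lambda_min_pos[OF Omega_pos_def[OF elim]])
      have "8 * (real (N G) * real (count_max G (N G) (\<psi> G)) ^ 3 / ?l\<^sup>2) = N G * D G ^ 3 / ?l\<^sup>2"
        by (simp add: D_def power_mult_distrib)
      then show ?case using l by (simp add: real_sqrt_divide)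
    qed
    ultimately show ?thesis by (simp add: filterlim_cong)
  qed
  \<comment> \<open>The hypotheses hold from G = 2 on, so the limits are taken along G + 2 and then
    shifted back.\<close>
  have reg': "dyadic_regression (M (G + 2)) (N (G + 2)) (\<psi> (G + 2)) (x (G + 2)) (u (G + 2)) C (D (G + 2)) (y (G + 2)) (\<beta> (G + 2)) (R (G + 2)) c\<^sub>Q" for G
    by (rule reg) simp
  note limits = dyadic_regression_limits[where M = "\<lambda>G. M (G + 2)" and N = "\<lambda>G. N (G + 2)" and D = "\<lambda>G. D (G + 2)" and x = "\<lambda>G. x (G + 2)"
      and u = "\<lambda>G. u (G + 2)" and y = "\<lambda>G. y (G + 2)" and R = "\<lambda>G. R (G + 2)" and \<psi> = "\<lambda>G. \<psi> (G + 2)" and \<beta> = "\<lambda>G. \<beta> (G + 2)",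
      OF reg' LIMSEQ_ignore_initial_segment[OF eta, of 2]]
  have shift_dist: "converges_in_distribution M Y std_normal_vec"
    if "converges_in_distribution (\<lambda>G. M (G + 2)) (\<lambda>G. Y (G + 2)) std_normal_vec" for Y :: "nat \<Rightarrow> 'a \<Rightarrow> real^'q"
  proof -
    have "\<forall>\<^sub>F G in sequentially. Y G \<in> borel_measurable (M G)"
      using that eventually_sequentially_seg[of "\<lambda>G. Y G \<in> borel_measurable (M G)" 2]
      by (simp only: converges_in_distribution_def)
    then show ?thesis using that unfolding converges_in_distribution_def by (blast intro: LIMSEQ_offset)
  qed
  have a: "converges_in_distribution M (\<lambda>G \<omega>. mat_inv_sqrt (\<V> G) *v (transpose (R G) *v (b G \<omega> - \<beta> G))) std_normal_vec"
    by (rule shift_dist) (use limits(1) in \<open>simp only: b_def \<V>_def\<close>)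
  have "mat_converges_in_probability (\<lambda>G. M (G + 2)) (\<lambda>G \<omega>. mat_inv_sqrt (\<V> (G + 2)) ** \<V>hat (G + 2) \<omega> ** mat_inv_sqrt (\<V> (G + 2))) (mat 1)"
    using limits(2) by (simp only: \<V>_def \<V>hat_def)
  then have b: "mat_converges_in_probability M (\<lambda>G \<omega>. mat_inv_sqrt (\<V> G) ** \<V>hat G \<omega> ** mat_inv_sqrt (\<V> G)) (mat 1)"
    unfolding mat_converges_in_probability_def
    using eventually_sequentially_seg[where P = "\<lambda>G. (\<lambda>\<omega>. mat_inv_sqrt (\<V> G) ** \<V>hat G \<omega> ** mat_inv_sqrt (\<V> G)) \<in> borel_measurable (M G)" and k = 2]
    by (auto intro: LIMSEQ_offset[where k = 2])
  have c1: "(\<lambda>G. measure (M G) {\<omega> \<in> space (M G). pos_def (\<V>hat G \<omega>)}) \<longlonglongrightarrow> 1"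
    by (rule LIMSEQ_offset[where k = 2]) (use limits(3) in \<open>simp only: \<V>hat_def\<close>)
  have c2: "converges_in_distribution M (\<lambda>G \<omega>. if pos_def (\<V>hat G \<omega>)
                     then mat_inv_sqrt (\<V>hat G \<omega>) *v (transpose (R G) *v (b G \<omega> - \<beta> G)) else Z G \<omega>) std_normal_vec"
    if "\<forall>G\<ge>2. Z G \<in> borel_measurable (M G)" for Z
    unfolding b_def \<V>hat_def by (rule shift_dist, rule limits(4)) (use that in simp)
  have d: "weak_conv_m (\<lambda>G. distr (M G) borel (\<lambda>\<omega>. wald (N G) (\<psi> G) (R G) (r G) (\<lambda>n. x G n \<omega>) (\<lambda>n. y G n \<omega>)))
             (chi_square_distribution CARD('q))"
    if r: "\<forall>G\<ge>2. transpose (R G) *v \<beta> G = r G"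
  \<comment> \<open>The studentized vector is set to 0 where \<open>\<V>hat\<close> is not positive
    definite, in agreement with the comparison in \<open>limits(5)\<close>.\<close>
  proof (rule weak_conv_chi_square[OF prob _ c2[of "\<lambda>G \<omega>. 0"]])
    show "(\<lambda>\<omega>. wald (N G) (\<psi> G) (R G) (r G) (\<lambda>n. x G n \<omega>) (\<lambda>n. y G n \<omega>)) \<in> borel_measurable (M G)" if "2 \<le> G" for G
      by (rule dyadic_regression.wald_meas[OF reg[OF that]])
    show "(\<lambda>G. measure (M G) {w \<in> space (M G). wald (N G) (\<psi> G) (R G) (r G) (\<lambda>n. x G n w) (\<lambda>n. y G n w)
        \<noteq> (norm (if pos_def (\<V>hat G w) then mat_inv_sqrt (\<V>hat G w) *v (transpose (R G) *v (b G w - \<beta> G)) else 0))\<^sup>2}) \<longlonglongrightarrow> 0"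
      unfolding b_def \<V>hat_def
      by (rule LIMSEQ_offset[where k = 2], rule limits(5)) (use r in \<open>simp del: transpose_matrix_vector\<close>)
  qed auto
  show ?thesis using a b c1 c2 d by blast
qed

end
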